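(* Let $X$ be a complex Banach space, $J=[\alpha,\infty)$ with $\alpha\in\mathbb R$, $n,r\in\mathbb N$, $a_0,\dots,a_{n-1}$ complex constant $r\times r$ matrices. Let $\emptyset\ne V\subset REC_{urc}(\mathbb R,X)$ satisfy condition ( * ), and put $\mathcal A=(rec_{urc}V)|J$ (restrictions to $J$). Let $U$ be a linear space with $X\subset U\subset L^1_{loc}(J,X)$ (where $X$ stands for the constant functions) such that $\gamma_\omega g\in U$ for all $g\in U$, $\omega\in\mathbb R$, and assume that $\mathcal A$ satisfies $(P'_U)$. Suppose $$\sigma(L):=\Big\{\lambda\in\mathbb C:\det\Big(\lambda^nI+\sum_{k=0}^{n-1}\lambda^ka_k\Big)=0\Big\}\subset\{\lambda\in\mathbb C:\operatorname{Re}\lambda\ge0\},$$ and let $y$ be a solution on $J$ of $$y^{(n)}+\sum_{k=0}^{n-1}a_ky^{(k)}=f$$ with $f\in\mathcal M(\mathcal A^r)$, $y\in\mathcal M^sO_q(J,X^r)$ for some $s,q\in\mathbb N_0$, and $y^{(k)}\in U^r$ for $0\le k\le n-1$. Then $y\in\mathcal A^r$, and $\mathcal A^r\subset REC_{urc}(J,X^r)$.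
   Context: $\gamma_\omega(t)=e^{i\omega t}$. $L^1_{loc}(J,Y)$: locally Bochner integrable functions. $C_{urc}$: uniformly continuous functions with relatively compact range. A continuous $f:\mathbb R\to Y$ is recurrent if for each compact $K\subset\mathbb R$ and $\varepsilon>0$ the set $E(f,\varepsilon,K)=\{\tau\in\mathbb R:\|f(t+\tau)-f(t)\|\le\varepsilon\ \forall t\in K\}$ is relatively dense, i.e. there is a compact $L\subset\mathbb R$ with $E(f,\varepsilon,K)+L=\mathbb R$. $REC(\mathbb R,Y)$ is the set of recurrent functions, $REC_{urc}(\mathbb R,Y)=REC(\mathbb R,Y)\cap C_{urc}(\mathbb R,Y)$; on the half line, $REC(J,Y)=REC(\mathbb R,Y)|J$ and $REC_{urc}(J,Y)=REC(J,Y)\cap C_{urc}(J,Y)$. Condition ( * ) for $W\subset REC_{urc}(\mathbb R,X)$: for all $p\in\mathbb N$ and $f_1,\dots,f_p\in W$ one has $(f_1,\dots,f_p)\in REC(\mathbb R,X^p)$. For nonempty $V\subset REC_{urc}(\mathbb R,X)$ satisfying ( * ), $rec_{urc}V$ denotes a (fixed) maximal element, with respect to inclusion, of $\{W\subset REC_{urc}(\mathbb R,X): V\subset W,\ W\text{ satisfies }( * )\}$ (it exists by Zorn's lemma). For functions on $J$: $M_hf(t)=\frac1h\int_0^hf(t+s)\,ds$; $\mathcal M\mathcal B=\{f\in L^1_{loc}(J,Y):M_hf\in\mathcal B\ \forall h>0\}$, $\mathcal M^0\mathcal B=\mathcal B\cap L^1_{loc}(J,Y)$, $\mathcal M^k\mathcal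 B=\mathcal M(\mathcal M^{k-1}\mathcal B)$. $Pf(t)=\int_\alpha^tf(s)\,ds$. $\mathcal A$ satisfies $(P'_U)$ if $f\in\mathcal M\mathcal A$ and $Pf\in U$ imply $Pf\in\mathcal A$. $O_q(J,Y)=\{g\in L^1_{loc}(J,Y):\sup_{t\in J}\|g(t)/(1+|t|)^q\|<\infty\}$. Solution on $J$: $y\in W^{1,n}_{loc}(J,X^r)$ (i.e. $y\in C^{n-1}$ and $y^{(n-1)}$ is an indefinite Bochner integral of a function $y^{(n)}\in L^1_{loc}$) and the equation holds a.e. on $J$. *)

theory Defs
  imports "HOL-Analysis.Analysis"
begin

class complex_banach = banach +
  fixes scaleC :: "complex \<Rightarrow> 'a \<Rightarrow> 'a"  (infixr \<open>*\<^sub>C\<close> 75)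
  assumes scaleC_add_right: "c *\<^sub>C (x + y) = c *\<^sub>C x + c *\<^sub>C y"
    and scaleC_add_left: "(c + d) *\<^sub>C x = c *\<^sub>C x + d *\<^sub>C x"
    and scaleC_scaleC: "c *\<^sub>C d *\<^sub>C x = (c * d) *\<^sub>C x"
    and scaleC_of_real: "complex_of_real s *\<^sub>C x = s *\<^sub>R x"
    and norm_scaleC: "norm (c *\<^sub>C x) = cmod c * norm x"

instantiation complex :: complex_banach
begin
definition "scaleC_complex = ((*) :: complex \<Rightarrow> complex \<Rightarrow> complex)"
instance
  by standard (simp_all add: scaleC_complex_def algebra_simps norm_mult scaleR_conv_of_real)
end

definition matC :: "complex^'r^'r \<Rightarrow> 'a::complex_banach^'r \<Rightarrow> 'a^'r" where
  "matC A x = (\<chi> i. \<Sum>j\<in>UNIV. (A $ i $ j) *\<^sub>C (x $ j))"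

text \<open>The library Bochner integral needs a second countable target space. The following
  one does not; strong measurability is expressed by almost everywhere convergence of the
  approximating simple functions.\<close>

definition has_Bochner :: "'c measure \<Rightarrow> ('c \<Rightarrow> 'b::real_normed_vector) \<Rightarrow> 'b \<Rightarrow> bool" where
  "has_Bochner M f x \<longleftrightarrow> (\<exists>s. (\<forall>i. Bochner_Integration.simple_bochner_integrable M (s i))
     \<and> (AE t in M. (\<lambda>i. s i t) \<longlonglongrightarrow> f t)
     \<and> (\<lambda>i. \<integral>\<^sup>+t. norm (f t - s i t) \<partial>M) \<longlonglongrightarrow> 0
     \<and> (\<lambda>i::nat. Bochner_Integration.simple_bochner_integral M (s i)) \<longlonglongrightarrow> x)"

definition Bochner_integrable_on :: "(real \<Rightarrow> 'b::real_normed_vector) \<Rightarrow> real set \<Rightarrow> bool" where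
  "Bochner_integrable_on f S \<longleftrightarrow> (\<exists>x. has_Bochner (lebesgue_on S) f x)"

definition Bochner_integral :: "real set \<Rightarrow> (real \<Rightarrow> 'b::real_normed_vector) \<Rightarrow> 'b" where
  "Bochner_integral S f = (THE x. has_Bochner (lebesgue_on S) f x)"

text \<open>A function on \<open>J\<close> is a member of \<open>extensional J\<close>, so that functions on \<open>J\<close> are equal iff
  they agree on \<open>J\<close>. No identification up to null sets is made.\<close>

definition L1_loc :: "real set \<Rightarrow> (real \<Rightarrow> 'b::banach) set" where
  "L1_loc J = {f \<in> extensional J. \<forall>K. compact K \<and> K \<subseteq> J \<longrightarrow> Bochner_integrable_on f K}"

definition C_urc :: "real set \<Rightarrow> (real \<Rightarrow> 'b::banach) set" where
  "C_urc J = {f \<in> extensional J. uniformly_continuous_on J f \<and> compact (closure (f ` J))}"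

definition O_cls :: "nat \<Rightarrow> real set \<Rightarrow> (real \<Rightarrow> 'b::banach) set" where
  "O_cls q J = {g \<in> L1_loc J. bdd_above ((\<lambda>t. norm (g t /\<^sub>R (1 + \<bar>t\<bar>) ^ q)) ` J)}"

definition mean :: "real set \<Rightarrow> real \<Rightarrow> (real \<Rightarrow> 'b::banach) \<Rightarrow> real \<Rightarrow> 'b" where
  "mean J h f = (\<lambda>t\<in>J. (1 / h) *\<^sub>R Bochner_integral {0..h} (\<lambda>s. f (t + s)))"

definition M_cls :: "real set \<Rightarrow> (real \<Rightarrow> 'b::banach) set \<Rightarrow> (real \<Rightarrow> 'b) set" where
  "M_cls J B = {f \<in> L1_loc J. \<forall>h>0. mean J h f \<in> B}"

primrec M_iter :: "nat \<Rightarrow> real set \<Rightarrow> (real \<Rightarrow> 'b::banach) set \<Rightarrow> (real \<Rightarrow> 'b) set" where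
  "M_iter 0 J B = B \<inter> L1_loc J"
| "M_iter (Suc k) J B = M_cls J (M_iter k J B)"

definition pow_cls :: "real set \<Rightarrow> (real \<Rightarrow> 'a) set \<Rightarrow> (real \<Rightarrow> 'a^'r) set" where
  "pow_cls J B = {f \<in> extensional J. \<forall>i. (\<lambda>t\<in>J. f t $ i) \<in> B}"

definition primitive :: "real \<Rightarrow> (real \<Rightarrow> 'b::banach) \<Rightarrow> real \<Rightarrow> 'b" where
  "primitive \<alpha> f = (\<lambda>t\<in>{\<alpha>..}. Bochner_integral {\<alpha>..t} f)"

definition P'_prop :: "real \<Rightarrow> (real \<Rightarrow> 'b::banach) set \<Rightarrow> (real \<Rightarrow> 'b) set \<Rightarrow> bool" where
  "P'_prop \<alpha> U A \<longleftrightarrow> (\<forall>f \<in> M_cls {\<alpha>..} A. primitive \<alpha> f \<in> U \<longrightarrow> primitive \<alpha> f \<in> A)"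

definition \<gamma> :: "real \<Rightarrow> real \<Rightarrow> complex" where
  "\<gamma> \<omega> t = exp (\<i> * of_real (\<omega> * t))"

definition linear_space_on :: "real set \<Rightarrow> (real \<Rightarrow> 'a::complex_banach) set \<Rightarrow> bool" where
  "linear_space_on J U \<longleftrightarrow> (\<lambda>t\<in>J. 0) \<in> U
     \<and> (\<forall>f\<in>U. \<forall>g\<in>U. (\<lambda>t\<in>J. f t + g t) \<in> U)
     \<and> (\<forall>c. \<forall>f\<in>U. (\<lambda>t\<in>J. c *\<^sub>C f t) \<in> U)"

definition relatively_dense :: "real set \<Rightarrow> bool" where
  "relatively_dense E \<longleftrightarrow> (\<exists>L. compact L \<and> {\<tau> + l |\<tau> l. \<tau> \<in> E \<and> l \<in> L} = UNIV)"

text \<open>The argument \<open>d s t\<close> stands for the distance of the values of a function at \<open>s\<close> and \<open>t\<close>.\<close>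

definition recurrent_dist :: "(real \<Rightarrow> real \<Rightarrow> real) \<Rightarrow> bool" where
  "recurrent_dist d \<longleftrightarrow>
     (\<forall>K \<epsilon>. compact K \<and> \<epsilon> > 0 \<longrightarrow> relatively_dense {\<tau>. \<forall>t\<in>K. d (t + \<tau>) t \<le> \<epsilon>})"

definition recurrent :: "(real \<Rightarrow> 'b::banach) \<Rightarrow> bool" where
  "recurrent f \<longleftrightarrow> continuous_on UNIV f \<and> recurrent_dist (\<lambda>s t. norm (f s - f t))"

text \<open>Recurrence of \<open>(F 0, \<dots>, F (p - 1))\<close> as a function into \<open>X\<^sup>p\<close>, where \<open>p\<close> is a number
  instead of a type. The norm on \<open>X\<^sup>p\<close> is that of the type \<open>vec\<close>.\<close>

definition recurrent_tuple :: "nat \<Rightarrow> (nat \<Rightarrow> real \<Rightarrow> 'b::banach) \<Rightarrow> bool" where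
  "recurrent_tuple p F \<longleftrightarrow> (\<forall>i<p. continuous_on UNIV (F i))
     \<and> recurrent_dist (\<lambda>s t. L2_set (\<lambda>i. norm (F i s - F i t)) {..<p})"

definition REC :: "real set \<Rightarrow> (real \<Rightarrow> 'b::banach) set" where
  "REC J = (\<lambda>f. restrict f J) ` {f. recurrent f}"

definition REC_urc :: "real set \<Rightarrow> (real \<Rightarrow> 'b::banach) set" where
  "REC_urc J = REC J \<inter> C_urc J"

definition jointly_recurrent :: "(real \<Rightarrow> 'b::banach) set \<Rightarrow> bool" where
  "jointly_recurrent W \<longleftrightarrow> (\<forall>p F. (\<forall>i<p. F i \<in> W) \<longrightarrow> recurrent_tuple p F)"

text \<open>Such a maximal \<open>R\<close> is not unique, hence a predicate instead of a function of \<open>V\<close>.\<close>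

definition is_rec_urc :: "(real \<Rightarrow> 'b::banach) set \<Rightarrow> (real \<Rightarrow> 'b) set \<Rightarrow> bool" where
  "is_rec_urc V R \<longleftrightarrow>
     (let \<W> = {W. W \<subseteq> REC_urc UNIV \<and> V \<subseteq> W \<and> jointly_recurrent W}
      in R \<in> \<W> \<and> (\<forall>W\<in>\<W>. R \<subseteq> W \<longrightarrow> W = R))"

text \<open>\<open>y\<close> has the derivatives \<open>D 0 = y, D 1, \<dots>, D n\<close> on \<open>J = {\<alpha>..}\<close> (one-sided at \<open>\<alpha>\<close>) in the sense
  of the local Sobolev space, for \<open>n \<ge> 1\<close>. All but \<open>D n\<close> are determined by \<open>y\<close>, and \<open>D n\<close> is
  determined almost everywhere.\<close>

definition W1_loc_derivs :: "real \<Rightarrow> nat \<Rightarrow> (real \<Rightarrow> 'b::banach) \<Rightarrow> (nat \<Rightarrow> real \<Rightarrow> 'b) \<Rightarrow> bool" where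
  "W1_loc_derivs \<alpha> n y D \<longleftrightarrow>
     D 0 = y
     \<and> (\<forall>k\<le>n. D k \<in> extensional {\<alpha>..})
     \<and> (\<forall>k<n-1. \<forall>t\<ge>\<alpha>. (D k has_vector_derivative D (Suc k) t) (at t within {\<alpha>..}))
     \<and> continuous_on {\<alpha>..} (D (n-1))
     \<and> D n \<in> L1_loc {\<alpha>..}
     \<and> (\<forall>t\<ge>\<alpha>. D (n-1) t = D (n-1) \<alpha> + Bochner_integral {\<alpha>..t} (D n))"

definition solution_derivs ::
  "real \<Rightarrow> nat \<Rightarrow> (nat \<Rightarrow> complex^'r^'r) \<Rightarrow> (real \<Rightarrow> 'a::complex_banach^'r) \<Rightarrow>
    (real \<Rightarrow> 'a^'r) \<Rightarrow> (nat \<Rightarrow> real \<Rightarrow> 'a^'r) \<Rightarrow> bool" where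
  "solution_derivs \<alpha> n a f y D \<longleftrightarrow> W1_loc_derivs \<alpha> n y D
     \<and> (AE t in lebesgue_on {\<alpha>..}. D n t + (\<Sum>k<n. matC (a k) (D k t)) = f t)"

definition \<sigma>_L :: "nat \<Rightarrow> (nat \<Rightarrow> complex^'r^'r) \<Rightarrow> complex set" where
  "\<sigma>_L n a = {z. det (mat (z ^ n) + (\<Sum>k<n. (\<chi> i j. z ^ k * a k $ i $ j))) = 0}"

end

theory Submission
  imports Defs "HOL-Computational_Algebra.Fundamental_Theorem_Algebra"
begin

text \<open>
The system is reduced to scalar equations \<open>z' = l z + g\<close> by linear algebra, and a scalar equation is
solved inside the class \<open>\<A>\<close> of restrictions to \<open>J\<close> of members of the maximal jointly recurrent set.

Maximality makes \<open>\<A>\<close> rich. A function all of whose return times are controlled by the return times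
of finitely many members can be added to the set without destroying joint recurrence, hence is a
member (\<open>hull_controlled\<close>). So \<open>\<A>\<close> is a linear space, invariant under forward translations, that contains the constants
and is closed under uniform limits on \<open>J\<close>; the last point uses that recurrence carries a bound on \<open>J\<close>
over to the whole line. It is also closed under multiplication by \<open>\<gamma>\<^sub>\<omega>\<close> (\<open>hull_\<gamma>\<close>), because almost
periodic functions are recurrent jointly with every recurrent function: the unimodular numbers that
are limits of \<open>\<gamma>\<^sub>\<omega> \<tau>\<close> along better and better return times \<open>\<tau>\<close> form a closed subgroup of the circle, so a
return with a wrong phase can be followed by a bounded return that corrects it.

Now let \<open>g \<in> \<M>\<A>\<close> and let \<open>\<phi>\<close> be its primitive. All differences \<open>\<phi>(\<cdot> + h) - \<phi>\<close> lie in \<open>\<A>\<close>, hence are bounded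
and uniformly continuous, and by a Baire category argument \<open>\<phi>\<close> itself is uniformly continuous
(\<open>uniformly_continuous_if_differences\<close>). Therefore Riemann sums show that \<open>\<A>\<close> contains
\<open>\<integral>\<^sub>0\<^sup>h k(s) (\<phi>(\<cdot> + s) - \<phi>) ds\<close>, and by variation of constants the function \<open>exp(-l h) z(\<cdot> + h) - z\<close>
belongs to \<open>\<A>\<close> whenever \<open>z' = l z + g\<close> (\<open>linear_equation_one_step_member\<close>). If \<open>Re l > 0\<close> and \<open>z\<close> grows at
most polynomially, iterating this relation with \<open>h = 1\<close> expresses \<open>z\<close> as the sum of a geometric series
in \<open>\<A>\<close>. If \<open>l = \<i> \<omega>\<close>, the relation says that \<open>\<gamma>\<^bsub>-\<omega>\<^esub> g \<in> \<M>\<A>\<close>; its primitive is \<open>\<gamma>\<^bsub>-\<omega>\<^esub> z\<close> up to a constant and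
belongs to \<open>U\<close>, so the property \<open>(P'\<^sub>U)\<close> applies. Polynomial growth is not assumed for \<open>z\<close>, only for an
iterated mean; as \<open>z(t + 1) - z(t)\<close> is \<open>l\<close> times the mean of \<open>z\<close> over \<open>[t, t + 1]\<close> plus a bounded function,
the means can be removed one after the other.

For the system, attach to every coefficient family \<open>\<xi>\<close> the linear combination \<open>z\<^sub>\<xi>\<close> of the components of
\<open>y, y', \<dots>, y\<^bsup>(n-1)\<^esup>\<close>. Then \<open>z\<^sub>\<xi>' = z\<^bsub>B \<xi>\<^esub> + g\<^sub>\<xi>\<close> with \<open>g\<^sub>\<xi> \<in> \<M>\<A>\<close> and the companion operator \<open>B\<close>. By the scalar
result, \<open>z\<^bsub>(B - l) \<xi>\<^esub> \<in> \<A>\<close> implies \<open>z\<^sub>\<xi> \<in> \<A>\<close> if \<open>Re l \<ge> 0\<close>; for all other \<open>l\<close> the operator \<open>B - l\<close> is injective,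
because its eigenvalues are the zeros of the determinant in \<open>\<sigma>(L)\<close>. Some product of factors \<open>B - l\<close>
annihilates \<open>\<xi>\<close>, so removing the factors one by one gives \<open>z\<^sub>\<xi> \<in> \<A>\<close> for every \<open>\<xi>\<close>
(\<open>operator_eigenvalue_induct\<close>).
\<close>

section \<open>Bochner integrals as limits of Henstock-Kurzweil integrals\<close>

text \<open>Bochner integrability with the Bochner integral of \<open>norm (f - s)\<close> replaced by a Henstock-Kurzweil
integrable bound. Closure properties and translations then follow from those of simple functions and of
the Henstock-Kurzweil integral, which is used for all calculations.\<close>

definition L1_approximable_on :: "(real \<Rightarrow> 'b::real_normed_vector) \<Rightarrow> real set \<Rightarrow> bool" where
  "L1_approximable_on f S \<longleftrightarrow> (\<forall>e>0. \<exists>s g c. simple_function (lebesgue_on S) s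
     \<and> (\<forall>t\<in>S. norm (f t - s t) \<le> g t) \<and> (g has_integral c) S \<and> c < e)"

lemma L1_approximableE:
  assumes "L1_approximable_on f S" "e > 0"
  obtains s g c where "simple_function (lebesgue_on S) s"
    "\<And>t. t \<in> S \<Longrightarrow> norm (f t - s t) \<le> g t" "(g has_integral c) S" "0 \<le> c" "c < e"
proof -
  obtain s g c where *: "simple_function (lebesgue_on S) s"
    "\<And>t. t \<in> S \<Longrightarrow> norm (f t - s t) \<le> g t" "(g has_integral c) S" "c < e"
    using assms unfolding L1_approximable_on_def by metis
  have "0 \<le> c"
    using *(2) norm_ge_zero order_trans by (intro has_integral_nonneg[OF *(3)]) blast
  with * that show ?thesis by blast
qed

lemma simple_function_has_integral:
  fixes s :: "real \<Rightarrow> 'b::banach"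
  assumes S: "S \<in> lmeasurable" and s: "simple_function (lebesgue_on S) s"
  shows "(s has_integral Bochner_Integration.simple_bochner_integral (lebesgue_on S) s) S"
proof -
  have fin: "finite (s ` S)" using s by (simp add: simple_function_def)
  have Sl: "S \<in> sets lebesgue" using S by (simp add: fmeasurableD)
  have meas: "{x\<in>S. s x = y} \<in> lmeasurable" for y
  proof (cases "y \<in> s ` S")
    case True
    then have "s -` {y} \<inter> S \<in> sets (lebesgue_on S)"
      using s by (auto simp: simple_function_def)
    moreover have "s -` {y} \<inter> S = {x\<in>S. s x = y}" by auto
    ultimately have "{x\<in>S. s x = y} \<in> sets lebesgue"
      using Sl by (simp add: sets_restrict_space_iff)
    from fmeasurableI2[OF S _ this] show ?thesis by auto
  next
    case False
    then have "{x\<in>S. s x = y} = {}" by auto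
    then show ?thesis by (simp only: fmeasurable.empty_sets)
  qed
  have piece: "((\<lambda>x. indicator {x\<in>S. s x = y} x *\<^sub>R y) has_integral measure lebesgue {x\<in>S. s x = y} *\<^sub>R y) S" for y
  proof -
    have "((indicat_real {x\<in>S. s x = y}) has_integral measure lebesgue {x\<in>S. s x = y}) UNIV"
      using meas lmeasurable_iff_has_integral by blast
    then have "((\<lambda>x. if x \<in> S then indicat_real {x\<in>S. s x = y} x else 0)
        has_integral measure lebesgue {x\<in>S. s x = y}) UNIV"
      by (rule has_integral_eq[rotated]) (auto simp: indicator_def)
    then have "((indicat_real {x\<in>S. s x = y}) has_integral measure lebesgue {x\<in>S. s x = y}) S"
      by (simp only: has_integral_restrict_UNIV)
    then show ?thesis by (rule has_integral_scaleR_left)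
  qed
  have "((\<lambda>x. \<Sum>y\<in>s ` S. indicator {x\<in>S. s x = y} x *\<^sub>R y) has_integral
      (\<Sum>y\<in>s ` S. measure lebesgue {x\<in>S. s x = y} *\<^sub>R y)) S"
    using fin piece by (intro has_integral_sum) auto
  moreover have "(\<Sum>y\<in>s ` S. measure lebesgue {x\<in>S. s x = y} *\<^sub>R y) = Bochner_Integration.simple_bochner_integral (lebesgue_on S) s"
    unfolding Bochner_Integration.simple_bochner_integral_def
    using Sl by (intro sum.cong) (auto simp: measure_restrict_space)
  moreover have "(\<Sum>y\<in>s ` S. indicator {x\<in>S. s x = y} x *\<^sub>R y) = s x" if "x \<in> S" for x
  proof -
    have "(\<Sum>y\<in>s ` S. indicator {x\<in>S. s x = y} x *\<^sub>R y) = (\<Sum>y\<in>s ` S. if y = s x then y else 0)"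
      using that by (intro sum.cong) (auto simp: indicator_def)
    then show ?thesis using fin that by simp
  qed
  ultimately show ?thesis by (metis (no_types, lifting) has_integral_cong)
qed

text \<open>Every Riemann sum of \<open>f - s\<close> is dominated by the corresponding Riemann sum of \<open>g\<close>.\<close>

lemma has_integral_L1_limit:
  fixes f :: "real \<Rightarrow> 'b::banach"
  assumes S: "bounded S"
    and approx: "\<And>e. e > 0 \<Longrightarrow> \<exists>s y g c. (s has_integral y) S \<and> (\<forall>t\<in>S. norm (f t - s t) \<le> g t)
      \<and> (g has_integral c) S \<and> c < e \<and> norm (x - y) < e"
  shows "(f has_integral x) S"
proof -
  obtain a b :: real where ab: "S \<subseteq> cbox a b" using bounded_subset_cbox_symmetric[OF S] by blast
  let ?r = "\<lambda>h t. if t \<in> S then h t else 0"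
  have "(?r f has_integral x) (cbox a b)"
    unfolding has_integral
  proof (intro allI impI)
    fix e :: real assume "e > 0"
    then obtain s y g c where h: "(s has_integral y) S" "\<forall>t\<in>S. norm (f t - s t) \<le> g t"
      "(g has_integral c) S" "c < e / 4" "norm (x - y) < e / 4"
      using approx[of "e / 4"] by auto
    have s: "(?r s has_integral y) (cbox a b)" and g: "(?r g has_integral c) (cbox a b)"
      using h(1,3) has_integral_restrict[OF ab] by auto
    obtain d1 where d1: "gauge d1"
      "\<And>D. D tagged_division_of (cbox a b) \<Longrightarrow> d1 fine D \<Longrightarrow>
        norm ((\<Sum>(x,k)\<in>D. measure lborel k *\<^sub>R ?r s x) - y) < e / 4"
      using s \<open>e > 0\<close> unfolding has_integral by (meson divide_pos_pos zero_less_numeral)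
    obtain d2 where d2: "gauge d2"
      "\<And>D. D tagged_division_of (cbox a b) \<Longrightarrow> d2 fine D \<Longrightarrow>
        norm ((\<Sum>(x,k)\<in>D. measure lborel k *\<^sub>R ?r g x) - c) < e / 4"
      using g \<open>e > 0\<close> unfolding has_integral by (meson divide_pos_pos zero_less_numeral)
    show "\<exists>\<gamma>. gauge \<gamma> \<and> (\<forall>D. D tagged_division_of (cbox a b) \<and> \<gamma> fine D \<longrightarrow>
        norm ((\<Sum>(x,k)\<in>D. measure lborel k *\<^sub>R ?r f x) - x) < e)"
    proof (intro exI conjI allI impI)
      show "gauge (\<lambda>x. d1 x \<inter> d2 x)" using d1 d2 by (simp add: gauge_Int)
      fix D assume D: "D tagged_division_of (cbox a b) \<and> (\<lambda>x. d1 x \<inter> d2 x) fine D"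
      have A: "norm ((\<Sum>(x,k)\<in>D. measure lborel k *\<^sub>R ?r s x) - y) < e / 4"
        and B: "norm ((\<Sum>(x,k)\<in>D. measure lborel k *\<^sub>R ?r g x) - c) < e / 4"
        using d1(2) d2(2) D by (auto simp: fine_Int)
      have "norm ((\<Sum>(x,k)\<in>D. measure lborel k *\<^sub>R ?r f x) - (\<Sum>(x,k)\<in>D. measure lborel k *\<^sub>R ?r s x))
          = norm (\<Sum>(x,k)\<in>D. measure lborel k *\<^sub>R (?r f x - ?r s x))"
        by (simp add: sum_subtractf[symmetric] split_def scaleR_diff_right)
      also have "\<dots> \<le> (\<Sum>(x,k)\<in>D. measure lborel k *\<^sub>R ?r g x)"
        using h(2) by (intro sum_norm_le) (auto intro!: mult_left_mono)
      also have "\<dots> < e / 2" using B h(4) unfolding real_norm_def real_scaleR_def by argo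
      finally have C: "norm ((\<Sum>(x,k)\<in>D. measure lborel k *\<^sub>R ?r f x) - (\<Sum>(x,k)\<in>D. measure lborel k *\<^sub>R ?r s x)) < e / 2" .
      have tri: "norm (p - x) \<le> norm (p - q) + norm (q - y) + norm (x - y)" for p q
        by (smt (verit, best) diff_add_cancel norm_diff_triangle_le norm_minus_commute order_refl)
      show "norm ((\<Sum>(x,k)\<in>D. measure lborel k *\<^sub>R ?r f x) - x) < e"
        using tri[of "\<Sum>(x,k)\<in>D. measure lborel k *\<^sub>R ?r f x" "\<Sum>(x,k)\<in>D. measure lborel k *\<^sub>R ?r s x"] A C h(5)
        by linarith
    qed
  qed
  then show ?thesis using has_integral_restrict[OF ab] by blast
qed

lemma L1_approximable_imp_integrable:
  fixes f :: "real \<Rightarrow> 'b::banach"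
  assumes S: "compact S" and f: "L1_approximable_on f S"
  shows "f integrable_on S"
proof -
  have Sm: "S \<in> lmeasurable" using S by (rule lmeasurable_compact)
  have "\<exists>s g c. simple_function (lebesgue_on S) s \<and> (\<forall>t\<in>S. norm (f t - s t) \<le> g t)
      \<and> (g has_integral c) S \<and> 0 \<le> c \<and> c < 1 / Suc n" for n
    using L1_approximableE[OF f, of "1 / Suc n"] by (metis of_nat_0_less_iff zero_less_Suc zero_less_divide_1_iff)
  then obtain s g c where s: "\<And>n. simple_function (lebesgue_on S) (s n)"
    and g: "\<And>n t. t \<in> S \<Longrightarrow> norm (f t - s n t) \<le> g n t"
    and c: "\<And>n. (g n has_integral c n) S" "\<And>n. 0 \<le> c n" "\<And>n. c n < 1 / Suc n"
    by metis
  define y where "y n = Bochner_Integration.simple_bochner_integral (lebesgue_on S) (s n)" for n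
  have y: "(s n has_integral y n) S" for n
    unfolding y_def by (rule simple_function_has_integral[OF Sm s])
  have dist: "norm (y m - y n) \<le> c m + c n" for m n
  proof -
    have "((\<lambda>t. s m t - s n t) has_integral y m - y n) S"
      by (intro has_integral_diff y)
    moreover have "((\<lambda>t. g m t + g n t) has_integral c m + c n) S"
      by (intro has_integral_add c)
    moreover have "norm (s m t - s n t) \<le> g m t + g n t" if "t \<in> S" for t
      using g[OF that, of m] g[OF that, of n] norm_triangle_ineq4[of "f t - s n t" "f t - s m t"]
      by simp
    ultimately show ?thesis
      by (metis (no_types, lifting) has_integral_iff integral_norm_bound_integral)
  qed
  have "Cauchy y"
  proof (rule metric_CauchyI)
    fix e :: real assume "e > 0"
    then obtain N where N: "1 / Suc N < e / 2" by (meson half_gt_zero nat_approx_posE)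
    have "dist (y m) (y n) < e" if "m \<ge> N" "n \<ge> N" for m n
    proof -
      have "c k < e / 2" if "k \<ge> N" for k
      proof -
        have "1 / real (Suc k) \<le> 1 / Suc N" using that by (intro divide_left_mono) auto
        then show ?thesis using c(3)[of k] N by linarith
      qed
      then show ?thesis using dist[of m n] that by (smt (verit) dist_norm field_sum_of_halves)
    qed
    then show "\<exists>M. \<forall>m\<ge>M. \<forall>n\<ge>M. dist (y m) (y n) < e" by blast
  qed
  then obtain x where x: "y \<longlonglongrightarrow> x" using Cauchy_convergent_iff convergent_def by blast
  have "(f has_integral x) S"
  proof (rule has_integral_L1_limit)
    show "bounded S" using S by (rule compact_imp_bounded)
    fix e :: real assume "e > 0"
    then have "eventually (\<lambda>n. norm (x - y n) < e) sequentially"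
      using x by (metis (mono_tags, lifting) dist_norm eventually_mono norm_minus_commute tendstoD)
    moreover have "eventually (\<lambda>n. c n < e) sequentially"
    proof -
      obtain N where "1 / Suc N < e" using \<open>e > 0\<close> nat_approx_posE by blast
      moreover have "c n < 1 / Suc N" if "n \<ge> N" for n
      proof -
        have "1 / real (Suc n) \<le> 1 / Suc N" using that by (intro divide_left_mono) auto
        then show ?thesis using c(3)[of n] by linarith
      qed
      ultimately show ?thesis unfolding eventually_sequentially by (meson less_trans)
    qed
    ultimately have "eventually (\<lambda>n. norm (x - y n) < e \<and> c n < e) sequentially"
      by eventually_elim auto
    from eventually_happens'[OF sequentially_bot this] obtain n where "norm (x - y n) < e" "c n < e"
      by blast
    then show "\<exists>s y g c. (s has_integral y) S \<and> (\<forall>t\<in>S. norm (f t - s t) \<le> g t)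
      \<and> (g has_integral c) S \<and> c < e \<and> norm (x - y) < e"
      using y g c(1) by blast
  qed
  then show ?thesis by blast
qed

text \<open>Approximations with errors below \<open>(1/2)\<^sup>n\<close> have a summable total error, so the errors tend to zero
almost everywhere by monotone convergence.\<close>

lemma L1_approximable_imp_has_Bochner:
  fixes f :: "real \<Rightarrow> 'b::banach"
  assumes S: "compact S" and f: "L1_approximable_on f S"
  shows "has_Bochner (lebesgue_on S) f (integral S f)"
proof -
  have Sm: "S \<in> lmeasurable" using S by (rule lmeasurable_compact)
  then have Sl: "S \<in> sets lebesgue" by (rule fmeasurableD)
  have fi: "(f has_integral integral S f) S"
    using L1_approximable_imp_integrable[OF S f] by (rule integrable_integral)
  have "\<exists>s g c. simple_function (lebesgue_on S) s \<and> (\<forall>t\<in>S. norm (f t - s t) \<le> g t)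
      \<and> (g has_integral c) S \<and> 0 \<le> c \<and> c < (1/2) ^ n" for n :: nat
    using L1_approximableE[OF f, of "(1/2) ^ n"] by (metis half_gt_zero_iff zero_less_one zero_less_power)
  then obtain s g c where s: "\<And>n. simple_function (lebesgue_on S) (s n)"
    and g: "\<And>n t. t \<in> S \<Longrightarrow> norm (f t - s n t) \<le> g n t"
    and c: "\<And>n. (g n has_integral c n) S" "\<And>n. 0 \<le> c n" "\<And>n::nat. c n < (1/2) ^ n"
    by metis
  have g0: "0 \<le> g n t" if "t \<in> S" for n t using g[OF that, of n] norm_ge_zero order_trans by blast
  have "integrable (lebesgue_on S) (g n)" for n
    using c(1) g0 Sl by (metis absolutely_integrable_on_iff_nonneg has_integral_integrable
      integrable_restrict_space set_integrable_def sets.Int_space_eq2 sets.sets_Collect_const sets.top space_completion space_lborel)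
  then have gi: "integrable (lebesgue_on S) (g n)" and gm: "g n \<in> borel_measurable (lebesgue_on S)" for n
    by auto
  have gc: "(\<integral>\<^sup>+t. ennreal (g n t) \<partial>lebesgue_on S) = ennreal (c n)" for n
  proof -
    have "integral\<^sup>L (lebesgue_on S) (g n) = c n"
      using gi c(1) Sl by (metis integral_unique lebesgue_integral_eq_integral)
    then show ?thesis
      using gi g0 by (subst nn_integral_eq_integral) (auto intro!: AE_I2)
  qed
  have tozero: "c \<longlonglongrightarrow> 0"
  proof (rule tendsto_sandwich[OF _ _ tendsto_const])
    show "(\<lambda>n. (1/2) ^ n :: real) \<longlonglongrightarrow> 0" by (rule LIMSEQ_power_zero) simp
  qed (use c in \<open>auto intro!: always_eventually less_imp_le\<close>)
  show ?thesis
    unfolding has_Bochner_def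
  proof (intro exI conjI allI)
    show "Bochner_Integration.simple_bochner_integrable (lebesgue_on S) (s i)" for i
    proof (intro Bochner_Integration.simple_bochner_integrable.intros s)
      have "emeasure (lebesgue_on S) {y \<in> space (lebesgue_on S). s i y \<noteq> 0} \<le> emeasure (lebesgue_on S) S"
        by (rule emeasure_mono) auto
      also have "\<dots> < \<infinity>" using Sm Sl by (simp add: emeasure_restrict_space fmeasurable_def)
      finally show "emeasure (lebesgue_on S) {y \<in> space (lebesgue_on S). s i y \<noteq> 0} \<noteq> \<infinity>" by simp
    qed
    have "(\<integral>\<^sup>+t. (\<Sum>n. ennreal (g n t)) \<partial>lebesgue_on S) = (\<Sum>n. ennreal (c n))"
      by (subst nn_integral_suminf) (simp_all add: gc measurable_compose[OF gm measurable_ennreal])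
    also have "\<dots> \<noteq> \<infinity>"
    proof -
      have "summable c"
        by (rule summable_comparison_test[OF _ summable_geometric[of "1/2"]])
           (use c in \<open>auto intro!: exI[of _ 0] less_imp_le\<close>)
      then show ?thesis using c by (simp add: suminf_ennreal2)
    qed
    finally have "AE t in lebesgue_on S. (\<Sum>n. ennreal (g n t)) \<noteq> \<infinity>"
      using gm by (intro nn_integral_PInf_AE) auto
    then show "AE t in lebesgue_on S. (\<lambda>i. s i t) \<longlonglongrightarrow> f t"
    proof (rule AE_mp, intro AE_I2 impI)
      fix t assume t: "t \<in> space (lebesgue_on S)" and fin: "(\<Sum>n. ennreal (g n t)) \<noteq> \<infinity>"
      then have tS: "t \<in> S" by simp
      have "summable (\<lambda>n. g n t)"
        using fin g0[OF tS] by (intro summable_suminf_not_top) (auto simp: top_ennreal.rep_eq)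
      then have "(\<lambda>n. g n t) \<longlonglongrightarrow> 0" by (rule summable_LIMSEQ_zero)
      then have "(\<lambda>n. s n t - f t) \<longlonglongrightarrow> 0"
        by (rule Lim_null_comparison[rotated])
           (use g[OF tS] in \<open>auto intro!: always_eventually simp: norm_minus_commute\<close>)
      then show "(\<lambda>i. s i t) \<longlonglongrightarrow> f t" by (simp add: LIM_zero_iff)
    qed
    show "(\<lambda>i. \<integral>\<^sup>+t. ennreal (norm (f t - s i t)) \<partial>lebesgue_on S) \<longlonglongrightarrow> 0"
    proof (rule tendsto_sandwich[OF _ _ tendsto_const])
      show "(\<lambda>n. ennreal (c n)) \<longlonglongrightarrow> 0" using tendsto_ennrealI[OF tozero] by simp
      have "(\<integral>\<^sup>+t. ennreal (norm (f t - s i t)) \<partial>lebesgue_on S) \<le> ennreal (c i)" for i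
        unfolding gc[symmetric] using g by (intro nn_integral_mono) (auto intro!: ennreal_leI)
      then show "\<forall>\<^sub>F i in sequentially. (\<integral>\<^sup>+t. ennreal (norm (f t - s i t)) \<partial>lebesgue_on S) \<le> ennreal (c i)"
        by simp
    qed auto
    show "(\<lambda>i. Bochner_Integration.simple_bochner_integral (lebesgue_on S) (s i)) \<longlonglongrightarrow> integral S f"
    proof (rule LIM_zero_cancel)
      show "(\<lambda>i. Bochner_Integration.simple_bochner_integral (lebesgue_on S) (s i) - integral S f) \<longlonglongrightarrow> 0"
      proof (rule Lim_null_comparison[OF _ tozero], intro always_eventually allI)
        fix n
        have "((\<lambda>t. s n t - f t) has_integral
            Bochner_Integration.simple_bochner_integral (lebesgue_on S) (s n) - integral S f) S"
          by (intro has_integral_diff fi simple_function_has_integral Sm s)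
        moreover have "norm (s n t - f t) \<le> g n t" if "t \<in> S" for t
          using g[OF that, of n] by (simp add: norm_minus_commute)
        ultimately show "norm (Bochner_Integration.simple_bochner_integral (lebesgue_on S) (s n) - integral S f) \<le> c n"
          using c(1)[of n] by (metis (no_types, lifting) has_integral_iff integral_norm_bound_integral)
      qed
    qed
  qed
qed

text \<open>The function \<open>norm (f - s\<^sub>i)\<close> is almost everywhere the limit of the measurable functions
\<open>norm (s\<^sub>j - s\<^sub>i)\<close>, hence it is itself an admissible bound.\<close>

lemma has_Bochner_imp_L1_approximable:
  fixes f :: "real \<Rightarrow> 'b::banach"
  assumes S: "compact S" and f: "has_Bochner (lebesgue_on S) f x"
  shows "L1_approximable_on f S" "(f has_integral x) S"
proof -
  have Sm: "S \<in> lmeasurable" using S by (rule lmeasurable_compact)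
  then have Sl: "S \<in> sets lebesgue" by (rule fmeasurableD)
  obtain s where s: "\<And>i. Bochner_Integration.simple_bochner_integrable (lebesgue_on S) (s i)"
    and ae: "AE t in lebesgue_on S. (\<lambda>i. s i t) \<longlonglongrightarrow> f t"
    and nn: "(\<lambda>i. \<integral>\<^sup>+t. norm (f t - s i t) \<partial>lebesgue_on S) \<longlonglongrightarrow> 0"
    and x: "(\<lambda>i. Bochner_Integration.simple_bochner_integral (lebesgue_on S) (s i)) \<longlonglongrightarrow> x"
    using f unfolding has_Bochner_def by blast
  have sf: "simple_function (lebesgue_on S) (s i)" for i
    using s[of i] by (rule Bochner_Integration.simple_bochner_integrable.cases)
  obtain N where N: "N \<in> null_sets (lebesgue_on S)" "{t \<in> S. \<not> (\<lambda>i. s i t) \<longlonglongrightarrow> f t} \<subseteq> N"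
    using ae by (auto elim!: AE_E3 simp: eventually_ae_filter)
  have Nneg: "negligible N"
    using N(1) Sl by (metis negligible_iff_null_sets null_sets_restrict_space)
  have int: "((\<lambda>t. norm (f t - s i t)) has_integral enn2real (\<integral>\<^sup>+t. norm (f t - s i t) \<partial>lebesgue_on S)) S"
    if fin: "(\<integral>\<^sup>+t. norm (f t - s i t) \<partial>lebesgue_on S) < \<infinity>" for i
  proof -
    let ?v = "\<lambda>t. if t \<in> N then 0 else norm (f t - s i t)"
    have vm: "?v \<in> borel_measurable (lebesgue_on S)"
    proof (rule borel_measurable_LIMSEQ_metric)
      fix j
      have "simple_function (lebesgue_on S) (\<lambda>t. norm (s j t - s i t))"
        using simple_function_compose2[OF sf[of j] sf[of i], of "\<lambda>a b. norm (a - b)"] .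
      then have "(\<lambda>t. norm (s j t - s i t)) \<in> borel_measurable (lebesgue_on S)"
        by (rule borel_measurable_simple_function)
      moreover have "{t \<in> space (lebesgue_on S). t \<in> N} \<in> sets (lebesgue_on S)"
      proof -
        have "N \<in> sets (lebesgue_on S)" using N(1) by (rule null_setsD2)
        moreover from sets.sets_into_space[OF this]
        have "{t \<in> space (lebesgue_on S). t \<in> N} = N" by blast
        ultimately show ?thesis by simp
      qed
      ultimately show "(\<lambda>t. if t \<in> N then 0 else norm (s j t - s i t)) \<in> borel_measurable (lebesgue_on S)"
        by (intro measurable_If borel_measurable_const)
    next
      fix t assume "t \<in> space (lebesgue_on S)"
      then have "t \<notin> N \<Longrightarrow> (\<lambda>j. s j t) \<longlonglongrightarrow> f t" using N(2) by auto
      then show "(\<lambda>j. if t \<in> N then 0 else norm (s j t - s i t)) \<longlonglongrightarrow> ?v t"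
        by (auto intro!: tendsto_intros)
    qed
    have eq: "(\<integral>\<^sup>+t. ennreal (?v t) \<partial>lebesgue_on S) = (\<integral>\<^sup>+t. norm (f t - s i t) \<partial>lebesgue_on S)"
      using N(1) by (intro nn_integral_cong_AE AE_I'[OF N(1)]) auto
    have vi: "integrable (lebesgue_on S) ?v"
      using vm fin eq by (intro integrableI_nonneg) auto
    then have "integral\<^sup>L (lebesgue_on S) ?v = enn2real (\<integral>\<^sup>+t. norm (f t - s i t) \<partial>lebesgue_on S)"
      unfolding eq[symmetric] by (intro integral_eq_nn_integral vm) auto
    then have "(?v has_integral enn2real (\<integral>\<^sup>+t. norm (f t - s i t) \<partial>lebesgue_on S)) S"
      using has_integral_integral_lebesgue_on[OF vi Sl] by simp
    then show ?thesis
      by (rule has_integral_spike[OF Nneg, rotated]) auto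
  qed
  have small: "\<exists>i c. ((\<lambda>t. norm (f t - s i t)) has_integral c) S \<and> c < e
      \<and> norm (x - Bochner_Integration.simple_bochner_integral (lebesgue_on S) (s i)) < e" if "e > 0" for e
  proof -
    have "eventually (\<lambda>i. (\<integral>\<^sup>+t. norm (f t - s i t) \<partial>lebesgue_on S) < ennreal e) sequentially"
      using nn that by (intro order_tendstoD) auto
    moreover have "eventually (\<lambda>i. norm (x - Bochner_Integration.simple_bochner_integral (lebesgue_on S) (s i)) < e) sequentially"
      using x that by (metis (mono_tags, lifting) dist_norm eventually_mono norm_minus_commute tendstoD)
    ultimately have "eventually (\<lambda>i. (\<integral>\<^sup>+t. norm (f t - s i t) \<partial>lebesgue_on S) < ennreal e \<and>
      norm (x - Bochner_Integration.simple_bochner_integral (lebesgue_on S) (s i)) < e) sequentially"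
      by eventually_elim auto
    then obtain i where i: "(\<integral>\<^sup>+t. norm (f t - s i t) \<partial>lebesgue_on S) < ennreal e"
      "norm (x - Bochner_Integration.simple_bochner_integral (lebesgue_on S) (s i)) < e"
      using eventually_happens'[OF sequentially_bot] by blast
    have "enn2real (\<integral>\<^sup>+t. norm (f t - s i t) \<partial>lebesgue_on S) < e"
      using i(1) that by (metis enn2real_less_iff ennreal_neq_top leI top.not_eq_extremum not_less_iff_gr_or_eq top_greatest less_le_trans)
    moreover have "(\<integral>\<^sup>+t. norm (f t - s i t) \<partial>lebesgue_on S) < \<infinity>"
      using less_trans[OF i(1) ennreal_less_top] by simp
    ultimately show ?thesis using int i(2) by blast
  qed
  show "L1_approximable_on f S"
    unfolding L1_approximable_on_def
  proof (intro allI impI)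
    fix e :: real assume "e > 0"
    from small[OF this] obtain i c where
      "((\<lambda>t. norm (f t - s i t)) has_integral c) S" "c < e" by blast
    then show "\<exists>s g c. simple_function (lebesgue_on S) s \<and> (\<forall>t\<in>S. norm (f t - s t) \<le> g t)
        \<and> (g has_integral c) S \<and> c < e"
      by (intro exI[of _ "s i"] exI[of _ "\<lambda>t. norm (f t - s i t)"] exI[of _ c]) (simp add: sf)
  qed
  show "(f has_integral x) S"
  proof (rule has_integral_L1_limit)
    show "bounded S" using S by (rule compact_imp_bounded)
    fix e :: real assume "e > 0"
    from small[OF this] obtain i c where
      "((\<lambda>t. norm (f t - s i t)) has_integral c) S" "c < e"
      "norm (x - Bochner_Integration.simple_bochner_integral (lebesgue_on S) (s i)) < e" by blast
    then show "\<exists>s y g c. (s has_integral y) S \<and> (\<forall>t\<in>S. norm (f t - s t) \<le> g t)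
      \<and> (g has_integral c) S \<and> c < e \<and> norm (x - y) < e"
      by (intro exI[of _ "s i"] exI[of _ "\<lambda>t. norm (f t - s i t)"] exI[of _ c]
          exI[of _ "Bochner_Integration.simple_bochner_integral (lebesgue_on S) (s i)"])
        (simp add: simple_function_has_integral[OF Sm sf])
  qed
qed

lemma Bochner_integrable_on_iff:
  fixes f :: "real \<Rightarrow> 'b::banach"
  assumes "compact S"
  shows "Bochner_integrable_on f S \<longleftrightarrow> L1_approximable_on f S"
  unfolding Bochner_integrable_on_def
  using L1_approximable_imp_has_Bochner[OF assms] has_Bochner_imp_L1_approximable(1)[OF assms]
  by (intro iffI) (erule exE, assumption | rule exI | assumption)+

lemma Bochner_integral_eq_integral:
  fixes f :: "real \<Rightarrow> 'b::banach"
  assumes "compact S" "L1_approximable_on f S"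
  shows "Bochner_integral S f = integral S f"
  unfolding Bochner_integral_def
  using L1_approximable_imp_has_Bochner[OF assms] has_Bochner_imp_L1_approximable(2)[OF assms(1)]
  by (metis integral_unique the_equality)

lemma L1_approximableI:
  assumes "\<And>e. e > 0 \<Longrightarrow> \<exists>s g c. simple_function (lebesgue_on S) s
     \<and> (\<forall>t\<in>S. norm (f t - s t) \<le> g t) \<and> (g has_integral c) S \<and> c < e"
  shows "L1_approximable_on f S"
  using assms by (simp add: L1_approximable_on_def)

lemma L1_approximable_cong:
  assumes "\<And>t. t \<in> S \<Longrightarrow> f t = g t"
  shows "L1_approximable_on f S \<longleftrightarrow> L1_approximable_on g S"
  using assms by (simp add: L1_approximable_on_def)

lemma L1_approximable_subset:
  assumes f: "L1_approximable_on f S" and T: "T \<in> sets lebesgue" "T \<subseteq> S" and S: "S \<in> sets lebesgue"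
  shows "L1_approximable_on f T"
proof (rule L1_approximableI)
  fix e :: real assume "e > 0"
  with f obtain s g c where s: "simple_function (lebesgue_on S) s"
    and g: "\<And>t. t \<in> S \<Longrightarrow> norm (f t - s t) \<le> g t" and c: "(g has_integral c) S" "c < e"
    by (rule L1_approximableE) blast
  have g0: "0 \<le> g t" if "t \<in> S" for t using g[OF that] norm_ge_zero order_trans by blast
  have "g absolutely_integrable_on S"
    using c(1) g0 by (intro nonnegative_absolutely_integrable_1) (auto intro: has_integral_integrable)
  then have "g absolutely_integrable_on T"
    using T by (rule set_integrable_subset)
  then have gT: "g integrable_on T" by (simp add: absolutely_integrable_on_def)
  have "integral T g \<le> integral S g"
    using T gT c(1) g0 by (intro integral_subset_le) (auto intro: has_integral_integrable)
  then have "integral T g < e" using c by (simp add: integral_unique)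
  moreover have "simple_function (lebesgue_on T) s"
  proof -
    have "(\<lambda>x. x) \<in> lebesgue_on T \<rightarrow>\<^sub>M lebesgue_on S"
      using T by (intro measurable_restrict_space3) auto
    from simple_function_comp[OF this s] show ?thesis .
  qed
  ultimately show "\<exists>s g c. simple_function (lebesgue_on T) s
     \<and> (\<forall>t\<in>T. norm (f t - s t) \<le> g t) \<and> (g has_integral c) T \<and> c < e"
    using g T gT by (intro exI[of _ s] exI[of _ g] exI[of _ "integral T g"]) (auto simp: integrable_integral)
qed

lemma L1_approximable_add:
  fixes f g :: "real \<Rightarrow> 'b::real_normed_vector"
  assumes "L1_approximable_on f S" "L1_approximable_on g S"
  shows "L1_approximable_on (\<lambda>t. f t + g t) S"
proof (rule L1_approximableI)
  fix e :: real assume "e > 0"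
  then have e2: "e / 2 > 0" by simp
  obtain s h c where 1: "simple_function (lebesgue_on S) s"
    "\<And>t. t \<in> S \<Longrightarrow> norm (f t - s t) \<le> h t" "(h has_integral c) S" "c < e / 2"
    by (rule L1_approximableE[OF assms(1) e2]) blast
  obtain s' h' c' where 2: "simple_function (lebesgue_on S) s'"
    "\<And>t. t \<in> S \<Longrightarrow> norm (g t - s' t) \<le> h' t" "(h' has_integral c') S" "c' < e / 2"
    by (rule L1_approximableE[OF assms(2) e2]) blast
  have "norm (f t + g t - (s t + s' t)) \<le> h t + h' t" if "t \<in> S" for t
    using norm_diff_triangle_ineq[of "f t" "g t" "s t" "s' t"] 1(2)[OF that] 2(2)[OF that] by simp
  moreover have "((\<lambda>t. h t + h' t) has_integral c + c') S"
    by (rule has_integral_add[OF 1(3) 2(3)])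
  moreover have "simple_function (lebesgue_on S) (\<lambda>t. s t + s' t)"
    by (rule simple_function_compose2[OF 1(1) 2(1)])
  moreover have "c + c' < e" using 1 2 by simp
  ultimately show "\<exists>s h c. simple_function (lebesgue_on S) s
     \<and> (\<forall>t\<in>S. norm (f t + g t - s t) \<le> h t) \<and> (h has_integral c) S \<and> c < e"
    by (intro exI[of _ "\<lambda>t. s t + s' t"] exI[of _ "\<lambda>t. h t + h' t"] exI[of _ "c + c'"]) simp
qed

lemma L1_approximable_Lipschitz:
  fixes f :: "real \<Rightarrow> 'b::real_normed_vector" and p :: "'b \<Rightarrow> 'c::real_normed_vector"
  assumes f: "L1_approximable_on f S" and p: "\<And>x y. norm (p x - p y) \<le> B * norm (x - y)"
  shows "L1_approximable_on (\<lambda>t. p (f t)) S"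
proof (rule L1_approximableI)
  fix e :: real assume "e > 0"
  then have e2: "e / (\<bar>B\<bar> + 1) > 0" by (simp add: field_simps)
  obtain s h c where 1: "simple_function (lebesgue_on S) s"
    "\<And>t. t \<in> S \<Longrightarrow> norm (f t - s t) \<le> h t" "(h has_integral c) S" "0 \<le> c" "c < e / (\<bar>B\<bar> + 1)"
    by (rule L1_approximableE[OF f e2]) blast
  have "norm (p (f t) - p (s t)) \<le> (\<bar>B\<bar> + 1) * h t" if "t \<in> S" for t
  proof -
    have "norm (p (f t) - p (s t)) \<le> B * norm (f t - s t)" by (rule p)
    also have "\<dots> \<le> (\<bar>B\<bar> + 1) * norm (f t - s t)" by (intro mult_right_mono) auto
    also have "\<dots> \<le> (\<bar>B\<bar> + 1) * h t" using 1(2)[OF that] by (intro mult_left_mono) auto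
    finally show ?thesis .
  qed
  moreover have "((\<lambda>t. (\<bar>B\<bar> + 1) * h t) has_integral (\<bar>B\<bar> + 1) * c) S"
    by (rule has_integral_mult_right[OF 1(3)])
  moreover have "simple_function (lebesgue_on S) (\<lambda>t. p (s t))"
    by (rule simple_function_compose1[OF 1(1)])
  moreover have "(\<bar>B\<bar> + 1) * c < e" using 1(5) by (simp add: field_simps)
  ultimately show "\<exists>s h c. simple_function (lebesgue_on S) s
     \<and> (\<forall>t\<in>S. norm (p (f t) - s t) \<le> h t) \<and> (h has_integral c) S \<and> c < e"
    by (intro exI[of _ "\<lambda>t. p (s t)"] exI[of _ "\<lambda>t. (\<bar>B\<bar> + 1) * h t"] exI[of _ "(\<bar>B\<bar> + 1) * c"]) simp
qed

text \<open>The set is cut into cells of length \<open>d\<close>, and \<open>f\<close> is replaced on each cell by its value at one point.\<close>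

lemma continuous_on_uniform_simple:
  fixes f :: "real \<Rightarrow> 'b::real_normed_vector"
  assumes S: "compact S" and f: "continuous_on S f" and e: "e > 0"
  obtains s where "simple_function (lebesgue_on S) s" "\<And>t. t \<in> S \<Longrightarrow> norm (f t - s t) \<le> e"
proof -
  obtain d where d: "d > 0" "\<And>x y. x \<in> S \<Longrightarrow> y \<in> S \<Longrightarrow> dist y x < d \<Longrightarrow> dist (f y) (f x) < e"
    using compact_uniformly_continuous[OF f S] e unfolding uniformly_continuous_on_def by metis
  define p where "p k = (SOME u. u \<in> S \<and> \<lfloor>u / d\<rfloor> = k)" for k
  have p: "p \<lfloor>t / d\<rfloor> \<in> S \<and> \<lfloor>p \<lfloor>t / d\<rfloor> / d\<rfloor> = \<lfloor>t / d\<rfloor>" if "t \<in> S" for t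
    unfolding p_def by (rule someI[of _ t]) (use that in simp)
  obtain a b where ab: "S \<subseteq> {a..b}" by (metis bounded_subset_cbox_symmetric[OF compact_imp_bounded[OF S]] interval_cbox)
  have fin: "finite ((\<lambda>t. \<lfloor>t / d\<rfloor>) ` S)"
  proof (rule finite_subset)
    show "(\<lambda>t. \<lfloor>t / d\<rfloor>) ` S \<subseteq> {\<lfloor>a / d\<rfloor>..\<lfloor>b / d\<rfloor>}"
      using subsetD[OF ab] d(1) by (auto intro!: floor_mono divide_right_mono)
  qed simp
  have "(\<lambda>t. \<lfloor>t / d\<rfloor>) \<in> borel \<rightarrow>\<^sub>M count_space UNIV" by measurable
  then have "(\<lambda>t. \<lfloor>t / d\<rfloor>) \<in> lebesgue \<rightarrow>\<^sub>M count_space UNIV"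
    by (simp add: measurable_completion)
  then have "(\<lambda>t. \<lfloor>t / d\<rfloor>) \<in> lebesgue_on S \<rightarrow>\<^sub>M count_space UNIV"
    by (rule measurable_restrict_space1)
  with fin have "simple_function (lebesgue_on S) (\<lambda>t. \<lfloor>t / d\<rfloor>)"
    by (simp add: simple_function_eq_measurable)
  then have "simple_function (lebesgue_on S) (\<lambda>t. f (p \<lfloor>t / d\<rfloor>))"
    by (rule simple_function_compose1)
  moreover have "norm (f t - f (p \<lfloor>t / d\<rfloor>)) \<le> e" if "t \<in> S" for t
  proof -
    let ?u = "p \<lfloor>t / d\<rfloor>"
    have "\<bar>?u / d - t / d\<bar> < 1"
      using p[OF that] by linarith
    then have "dist t ?u < d" using d(1) by (simp add: dist_real_def abs_less_iff field_simps)
    then show ?thesis using d(2)[of ?u t] p[OF that] that by (simp add: dist_norm)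
  qed
  ultimately show ?thesis using that by blast
qed

lemma L1_approximable_continuous:
  fixes f :: "real \<Rightarrow> 'b::real_normed_vector"
  assumes S: "compact S" and f: "continuous_on S f"
  shows "L1_approximable_on f S"
proof (rule L1_approximableI)
  fix e :: real assume e: "e > 0"
  define m where "m = measure lebesgue S"
  have m: "m \<ge> 0" by (simp add: m_def)
  define d where "d = e / (2 * (m + 1))"
  have d: "d > 0" using e m by (simp add: d_def)
  obtain s where s: "simple_function (lebesgue_on S) s" "\<And>t. t \<in> S \<Longrightarrow> norm (f t - s t) \<le> d"
    by (rule continuous_on_uniform_simple[OF S f d]) blast
  have "((\<lambda>t. d) has_integral d * m) S"
    using has_integral_mult_right[OF lmeasurable_compact[OF S, unfolded lmeasurable_iff_has_integral,
        unfolded indicator_def of_bool_def has_integral_restrict_UNIV], of d] by (simp add: m_def)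
  moreover have "d * m < e"
    using e m by (simp add: d_def field_simps) (simp add: add_nonneg_pos)
  ultimately show "\<exists>s g c. simple_function (lebesgue_on S) s
     \<and> (\<forall>t\<in>S. norm (f t - s t) \<le> g t) \<and> (g has_integral c) S \<and> c < e"
    using s by (intro exI[of _ s] exI[of _ "\<lambda>_. d"] exI[of _ "d * m"]) simp
qed

lemma L1_approximable_shift:
  fixes f :: "real \<Rightarrow> 'b::real_normed_vector"
  assumes "L1_approximable_on f {a + h..b + h}"
  shows "L1_approximable_on (\<lambda>t. f (h + t)) {a..b}"
proof (rule L1_approximableI)
  fix e :: real assume "e > 0"
  then obtain s g c where 1: "simple_function (lebesgue_on {a + h..b + h}) s"
    "\<And>t. t \<in> {a + h..b + h} \<Longrightarrow> norm (f t - s t) \<le> g t" "(g has_integral c) {a + h..b + h}" "0 \<le> c" "c < e"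
    by (rule L1_approximableE[OF assms]) blast
  have "(\<lambda>t. h + t) \<in> lebesgue \<rightarrow>\<^sub>M lebesgue"
    using lebesgue_affine_measurable[of "\<lambda>_. 1" h] by simp
  then have "(\<lambda>t. h + t) \<in> lebesgue_on {a..b} \<rightarrow>\<^sub>M lebesgue_on {a + h..b + h}"
    by (rule measurable_restrict_space3) auto
  from simple_function_comp[OF this 1(1)]
  have "simple_function (lebesgue_on {a..b}) (\<lambda>t. s (h + t))" .
  moreover have "((\<lambda>t. g (h + t)) has_integral c) {a..b}"
    using 1(3) has_integral_shift_Icc_real[of g h c a b] by (simp add: o_def)
  ultimately show "\<exists>s g c. simple_function (lebesgue_on {a..b}) s
     \<and> (\<forall>t\<in>{a..b}. norm (f (h + t) - s t) \<le> g t) \<and> (g has_integral c) {a..b} \<and> c < e"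
    using 1(2,5) by (intro exI[of _ "\<lambda>t. s (h + t)"] exI[of _ "\<lambda>t. g (h + t)"] exI[of _ c]) auto
qed

text \<open>Gives the product rules for limits, derivatives and integrals of complex multiples.\<close>

lemma bounded_bilinear_scaleC: "bounded_bilinear (\<lambda>(c::complex) (x::'a::complex_banach). c *\<^sub>C x)"
proof
  fix r :: real and c :: complex and x :: 'a
  show "(r *\<^sub>R c) *\<^sub>C x = r *\<^sub>R c *\<^sub>C x"
    by (metis scaleC_of_real scaleC_scaleC scaleR_conv_of_real)
  show "c *\<^sub>C r *\<^sub>R x = r *\<^sub>R c *\<^sub>C x"
    by (metis mult.commute scaleC_of_real scaleC_scaleC)
  show "\<exists>K. \<forall>(a::complex) (b::'a). norm (a *\<^sub>C b) \<le> norm a * norm b * K"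
    by (rule exI[of _ 1]) (simp add: norm_scaleC)
qed (simp_all add: scaleC_add_left scaleC_add_right)

interpretation scaleC: bounded_bilinear "\<lambda>(c::complex) (x::'a::complex_banach). c *\<^sub>C x"
  by (rule bounded_bilinear_scaleC)

lemma scaleC_one [simp]: "(1::complex) *\<^sub>C x = x"
  using scaleC_of_real[of 1 x] by simp

text \<open>Both factors are replaced by simple functions. The approximation of \<open>f\<close> is chosen first, since the
accuracy needed for \<open>k\<close> depends on its supremum.\<close>

lemma L1_approximable_scaleC:
  fixes f :: "real \<Rightarrow> 'a::complex_banach"
  assumes S: "compact S" and k: "continuous_on S k" and f: "L1_approximable_on f S"
  shows "L1_approximable_on (\<lambda>t. k t *\<^sub>C f t) S"
proof (rule L1_approximableI)
  fix e :: real assume e: "e > 0"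
  obtain M where M: "\<And>t. t \<in> S \<Longrightarrow> norm (k t) \<le> M" "M > 0"
    using compact_imp_bounded[OF compact_continuous_image[OF k S]] by (auto simp: bounded_pos)
  have e2: "e / (2 * M) > 0" using e M by simp
  obtain s g c where 1: "simple_function (lebesgue_on S) s"
    "\<And>t. t \<in> S \<Longrightarrow> norm (f t - s t) \<le> g t" "(g has_integral c) S" "0 \<le> c" "c < e / (2 * M)"
    by (rule L1_approximableE[OF f e2]) blast
  have "finite (s ` S)" using 1(1) by (simp add: simple_function_def)
  then obtain N where N: "\<And>t. t \<in> S \<Longrightarrow> norm (s t) \<le> N" "N > 0"
    using finite_imp_bounded[of "s ` S"] by (auto simp: bounded_pos)
  define m where "m = measure lebesgue S"
  have m: "m \<ge> 0" by (simp add: m_def)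
  define d where "d = e / (2 * (m + 1)) / N"
  have d: "d > 0" using e m N(2) by (simp add: d_def)
  obtain k' where k': "simple_function (lebesgue_on S) k'" "\<And>t. t \<in> S \<Longrightarrow> norm (k t - k' t) \<le> d"
    by (rule continuous_on_uniform_simple[OF S k d]) blast
  have "((\<lambda>t. d * N) has_integral d * N * m) S"
    using has_integral_mult_right[OF lmeasurable_compact[OF S, unfolded lmeasurable_iff_has_integral,
        unfolded indicator_def of_bool_def has_integral_restrict_UNIV], of "d * N"] by (simp add: m_def)
  then have 2: "((\<lambda>t. M * g t + d * N) has_integral M * c + d * N * m) S"
    by (intro has_integral_add has_integral_mult_right 1)
  have "norm (k t *\<^sub>C f t - k' t *\<^sub>C s t) \<le> M * g t + d * N" if t: "t \<in> S" for t
  proof -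
    have "k t *\<^sub>C f t - k' t *\<^sub>C s t = k t *\<^sub>C (f t - s t) + (k t - k' t) *\<^sub>C s t"
      by (simp add: scaleC.diff_left scaleC.diff_right)
    also have "norm \<dots> \<le> norm (k t) * norm (f t - s t) + norm (k t - k' t) * norm (s t)"
      by (rule norm_triangle_le) (simp add: norm_scaleC)
    also have "\<dots> \<le> M * g t + d * N"
      using M(2) d by (intro add_mono mult_mono M(1) 1(2) k'(2) N(1) t) auto
    finally show ?thesis .
  qed
  moreover have "simple_function (lebesgue_on S) (\<lambda>t. k' t *\<^sub>C s t)"
    by (rule simple_function_compose2[OF k'(1) 1(1)])
  moreover have "M * c + d * N * m < e"
  proof -
    have "M * c < e / 2" using 1(5) M(2) by (simp add: field_simps)
    moreover have "d * N * m = e / 2 * (m / (m + 1))"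
      using N(2) m by (simp add: d_def divide_simps)
    moreover have "e / 2 * (m / (m + 1)) \<le> e / 2 * 1" using e m by (intro mult_left_mono) (auto simp: field_simps)
    ultimately show ?thesis by linarith
  qed
  ultimately show "\<exists>s g c. simple_function (lebesgue_on S) s
     \<and> (\<forall>t\<in>S. norm (k t *\<^sub>C f t - s t) \<le> g t) \<and> (g has_integral c) S \<and> c < e"
    using 2 by (intro exI[of _ "\<lambda>t. k' t *\<^sub>C s t"] exI[of _ "\<lambda>t. M * g t + d * N"] exI[of _ "M * c + d * N * m"]) simp
qed

text \<open>Membership in \<open>L1_loc\<close> without the extensionality condition, for functions given by unrestricted
terms. For \<open>b < \<alpha>\<close> the interval is empty and the condition holds trivially.\<close>

definition locally_L1 :: "real \<Rightarrow> (real \<Rightarrow> 'b::banach) \<Rightarrow> bool" where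
  "locally_L1 \<alpha> f \<longleftrightarrow> (\<forall>b. L1_approximable_on f {\<alpha>..b})"

lemma L1_loc_iff: "f \<in> L1_loc {\<alpha>..} \<longleftrightarrow> f \<in> extensional {\<alpha>..} \<and> locally_L1 \<alpha> f"
proof -
  have "L1_approximable_on f K" if K: "locally_L1 \<alpha> f" "compact K" "K \<subseteq> {\<alpha>..}" for K
  proof -
    obtain b where "K \<subseteq> {..b}"
      using bounded_imp_bdd_above[OF compact_imp_bounded[OF K(2)]] by (auto simp: bdd_above_def)
    with K(3) have "K \<subseteq> {\<alpha>..b}" by auto
    then show ?thesis
      using K(1,2) by (intro L1_approximable_subset[of f "{\<alpha>..b}" K])
        (auto simp: locally_L1_def intro: lmeasurable_compact fmeasurableD)
  qed
  then show ?thesis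
    unfolding L1_loc_def locally_L1_def by (auto simp: Bochner_integrable_on_iff)
qed

lemma locally_L1_cong:
  "(\<And>t. t \<ge> \<alpha> \<Longrightarrow> f t = g t) \<Longrightarrow> locally_L1 \<alpha> f \<longleftrightarrow> locally_L1 \<alpha> g"
  unfolding locally_L1_def by (rule iff_allI, rule L1_approximable_cong) auto

lemma locally_L1_restrict [simp]: "locally_L1 \<alpha> (restrict f {\<alpha>..}) \<longleftrightarrow> locally_L1 \<alpha> f"
  by (rule locally_L1_cong) simp

lemma locally_L1_add: "locally_L1 \<alpha> f \<Longrightarrow> locally_L1 \<alpha> g \<Longrightarrow> locally_L1 \<alpha> (\<lambda>t. f t + g t)"
  unfolding locally_L1_def by (simp add: L1_approximable_add)

lemma locally_L1_continuous: "continuous_on {\<alpha>..} f \<Longrightarrow> locally_L1 \<alpha> f"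
  unfolding locally_L1_def
  by (intro allI L1_approximable_continuous compact_Icc) (rule continuous_on_subset, auto)

lemma locally_L1_scaleC:
  "continuous_on {\<alpha>..} k \<Longrightarrow> locally_L1 \<alpha> f \<Longrightarrow> locally_L1 \<alpha> (\<lambda>t. k t *\<^sub>C f t)"
  unfolding locally_L1_def
  by (intro allI L1_approximable_scaleC compact_Icc) (erule continuous_on_subset, auto)

lemma locally_L1_component:
  fixes f :: "real \<Rightarrow> 'b::banach^'r::finite"
  assumes "locally_L1 \<alpha> f"
  shows "locally_L1 \<alpha> (\<lambda>t. f t $ i)"
proof -
  have "norm (x $ i - y $ i) \<le> 1 * norm (x - y)" for x y :: "'b^'r"
    using Finite_Cartesian_Product.norm_nth_le[of "x - y" i] by simp
  then show ?thesis
    using assms L1_approximable_Lipschitz[of f _ "\<lambda>x. x $ i" 1] unfolding locally_L1_def by blast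
qed

lemma locally_L1_norm: "locally_L1 \<alpha> f \<Longrightarrow> locally_L1 \<alpha> (\<lambda>t. norm (f t))"
  unfolding locally_L1_def
  by (rule allI, rule L1_approximable_Lipschitz[where B=1]) (auto simp: norm_triangle_ineq3)

lemma locally_L1_sum:
  "(\<And>i. i \<in> I \<Longrightarrow> locally_L1 \<alpha> (f i)) \<Longrightarrow> locally_L1 \<alpha> (\<lambda>t. \<Sum>i\<in>I. f i t)"
proof (induction I rule: infinite_finite_induct)
  case (insert x F)
  then show ?case by (simp add: locally_L1_add)
qed (auto intro!: locally_L1_continuous)

lemma locally_L1_integrable:
  assumes "locally_L1 \<alpha> f" "\<alpha> \<le> a"
  shows "f integrable_on {a..b}"
proof -
  have "f integrable_on {\<alpha>..b}"
    using assms by (intro L1_approximable_imp_integrable) (auto simp: locally_L1_def)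
  then show ?thesis by (rule integrable_subinterval_real) (use assms in auto)
qed

lemma locally_L1_integral_diff:
  assumes "locally_L1 \<alpha> f" "\<alpha> \<le> a" "a \<le> b"
  shows "integral {a..b} f = integral {\<alpha>..b} f - integral {\<alpha>..a} f"
  using Henstock_Kurzweil_Integration.integral_combine[OF assms(2,3) locally_L1_integrable[OF assms(1) order_refl]]
  by (simp add: algebra_simps)

lemma primitive_eq:
  assumes "locally_L1 \<alpha> f"
  shows "primitive \<alpha> f = (\<lambda>t\<in>{\<alpha>..}. integral {\<alpha>..t} f)"
  using assms unfolding primitive_def locally_L1_def
  by (intro restrict_ext Bochner_integral_eq_integral) auto

lemma mean_eq:
  assumes "locally_L1 \<alpha> f" "h > 0"
  shows "mean {\<alpha>..} h f = (\<lambda>t\<in>{\<alpha>..}. (1 / h) *\<^sub>R integral {t..t + h} f)"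
  unfolding mean_def
proof (rule restrict_ext)
  fix t assume "t \<in> {\<alpha>..}"
  then have "L1_approximable_on f {t..t + h}"
    using assms by (intro L1_approximable_subset[of f "{\<alpha>..t + h}" "{t..t + h}"]) (auto simp: locally_L1_def)
  then have "L1_approximable_on (\<lambda>s. f (t + s)) {0..h}"
    using L1_approximable_shift[of f 0 t h] by (simp add: add.commute)
  then have "Bochner_integral {0..h} (\<lambda>s. f (t + s)) = integral {0..h} (\<lambda>s. f (t + s))"
    by (intro Bochner_integral_eq_integral) auto
  also have "\<dots> = integral {t..t + h} f"
    using integral_shift_Icc_real[of 0 h f t] by (simp add: o_def add.commute)
  finally show "(1 / h) *\<^sub>R Bochner_integral {0..h} (\<lambda>s. f (t + s)) = (1 / h) *\<^sub>R integral {t..t + h} f"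
    by simp
qed

lemma continuous_on_locally_L1_integral:
  assumes "locally_L1 \<alpha> f"
  shows "continuous_on {\<alpha>..} (\<lambda>t. integral {\<alpha>..t} f)"
proof -
  have "continuous (at t within {\<alpha>..}) (\<lambda>t. integral {\<alpha>..t} f)" if "t \<ge> \<alpha>" for t
  proof -
    have "continuous_on {\<alpha>..t + 1} (\<lambda>t. integral {\<alpha>..t} f)"
      by (intro indefinite_integral_continuous_1 locally_L1_integrable[OF assms]) simp
    moreover have "t \<in> {\<alpha>..t + 1}" using that by simp
    ultimately have "continuous (at t within {\<alpha>..t + 1}) (\<lambda>t. integral {\<alpha>..t} f)"
      using continuous_on_eq_continuous_within by blast
    moreover have "at t within {\<alpha>..t + 1} = at t within {\<alpha>..}"
      by (rule at_within_nhd[of t "{..<t + 1}"]) auto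
    ultimately show ?thesis by simp
  qed
  then show ?thesis by (simp add: continuous_on_eq_continuous_within)
qed

section \<open>A difference theorem for uniform continuity\<close>

text \<open>If no \<open>C N\<close> contained an interval, the complements would be dense and relatively open in \<open>{a..b}\<close>, and
so would their intersection, which is empty.\<close>

lemma Baire_interval:
  fixes C :: "nat \<Rightarrow> real set"
  assumes C: "\<And>N. closed (C N)" and cover: "{a..b} \<subseteq> (\<Union>N. C N)" and ab: "a < b"
  obtains N c \<eta> where "\<eta> > 0" "a \<le> c" "{c..c + \<eta>} \<subseteq> C N"
proof (rule ccontr)
  assume neg: "\<not> thesis"
  have dense: "{a..b} \<subseteq> closure ({a..b} - C N)" for N
  proof
    fix x assume x: "x \<in> {a..b}"
    show "x \<in> closure ({a..b} - C N)"
      unfolding closure_approachable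
    proof (intro allI impI)
      fix e :: real assume e: "e > 0"
      define u where "u = max a (x - e / 2)"
      define v where "v = min b (x + e / 2)"
      have uv: "u < v" "a \<le> u" "v \<le> b" "x - e / 2 \<le> u" "v \<le> x + e / 2"
        using x ab e by (auto simp: u_def v_def)
      have "\<not> {u..u + (v - u)} \<subseteq> C N"
        using neg that[of "v - u" u N] uv by auto
      then obtain y where "y \<in> {u..v}" "y \<notin> C N" by (auto simp: subset_iff)
      then show "\<exists>y\<in>{a..b} - C N. dist y x < e"
        using uv e by (intro bexI[of _ y]) (auto simp: dist_real_def)
    qed
  qed
  have "{a..b} \<subseteq> closure (\<Inter>(range (\<lambda>N. {a..b} - C N)))"
  proof (rule Baire)
    fix T assume "T \<in> range (\<lambda>N. {a..b} - C N)"
    then obtain N where T: "T = {a..b} - C N" by auto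
    have "openin (top_of_set {a..b}) T"
      unfolding T Diff_eq using C[of N] by (intro openin_open_Int) (simp add: open_Compl)
    then show "openin (top_of_set {a..b}) T \<and> {a..b} \<subseteq> closure T"
      using dense T by simp
  qed auto
  moreover have "\<Inter>(range (\<lambda>N. {a..b} - C N)) = {}"
    using cover by auto
  ultimately have "{a..b} \<subseteq> {}" by (simp only: closure_empty)
  with ab show False by simp
qed

text \<open>By Baire's theorem the hypotheses hold uniformly for \<open>h\<close> in some interval of length \<open>\<eta>\<close>. Interchanging
the two difference operators, \<open>\<phi>(\<tau> + d) - \<phi> \<tau>\<close> is, up to a small error, the same at all points of an
interval of length \<open>\<eta>\<close>. Hence \<open>k\<close> times this increment is close to \<open>\<phi>(\<tau> + k d) - \<phi> \<tau>\<close>, which is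
bounded, and \<open>k\<close> may be taken large when \<open>d\<close> is small.\<close>

lemma uniformly_continuous_if_differences:
  fixes \<phi> :: "real \<Rightarrow> 'b::real_normed_vector"
  assumes cont: "continuous_on {\<alpha>..} \<phi>"
    and bdd: "\<And>h. h > 0 \<Longrightarrow> bounded ((\<lambda>t. \<phi> (t + h) - \<phi> t) ` {\<alpha>..})"
    and uc: "\<And>h. h > 0 \<Longrightarrow> uniformly_continuous_on {\<alpha>..} (\<lambda>t. \<phi> (t + h) - \<phi> t)"
  shows "uniformly_continuous_on {\<alpha>..} \<phi>"
proof -
  have key: "\<exists>\<beta>\<ge>\<alpha>. \<exists>d0>0. \<forall>\<tau>\<ge>\<beta>. \<forall>d. 0 \<le> d \<and> d \<le> d0 \<longrightarrow> norm (\<phi> (\<tau> + d) - \<phi> \<tau>) \<le> 3 * \<epsilon>"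
    if e: "\<epsilon> > 0" for \<epsilon>
  proof -
    \<comment> \<open>the step \<open>h\<close> stays away from zero so that limits of admissible steps are positive\<close>
    define C where "C N = {h \<in> {1..2}. \<forall>t\<ge>\<alpha>. norm (\<phi> (t + h) - \<phi> t) \<le> real N \<and>
      (\<forall>d. 0 \<le> d \<and> d \<le> 1 / Suc N \<longrightarrow> norm ((\<phi> (t + d + h) - \<phi> (t + d)) - (\<phi> (t + h) - \<phi> t)) \<le> \<epsilon>)}" for N
    have lim: "(\<lambda>n. \<phi> (t + h n)) \<longlonglongrightarrow> \<phi> (t + l)" if "t \<ge> \<alpha>" "\<And>n. h n \<ge> 1" "h \<longlonglongrightarrow> l" "l \<ge> 1" for t h l
      by (rule continuous_on_tendsto_compose[OF cont]) (use that in \<open>auto intro!: tendsto_intros always_eventually add_increasing2 order_trans[OF zero_le_one]\<close>)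
    have C1: "norm (\<phi> (t + h) - \<phi> t) \<le> real N" if "h \<in> C N" "t \<ge> \<alpha>" for h t N
      using that by (auto simp: C_def)
    have C2: "norm ((\<phi> (t + d + h) - \<phi> (t + d)) - (\<phi> (t + h) - \<phi> t)) \<le> \<epsilon>"
      if "h \<in> C N" "t \<ge> \<alpha>" "0 \<le> d" "d \<le> 1 / Suc N" for h t d N
      using that by (auto simp: C_def)
    have closed: "closed (C N)" for N
      unfolding closed_sequential_limits
    proof (intro allI impI, elim conjE)
      fix h l assume h: "\<forall>n. h n \<in> C N" and l: "h \<longlonglongrightarrow> l"
      have h12: "1 \<le> h n" "h n \<le> 2" for n using h by (auto simp: C_def)
      then have l1: "1 \<le> l" "l \<le> 2" using l by (auto intro: LIMSEQ_le_const LIMSEQ_le_const2)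
      have "norm (\<phi> (t + l) - \<phi> t) \<le> real N" if t: "t \<ge> \<alpha>" for t
      proof (rule Lim_norm_ubound[OF sequentially_bot])
        show "(\<lambda>n. \<phi> (t + h n) - \<phi> t) \<longlonglongrightarrow> \<phi> (t + l) - \<phi> t"
          by (intro tendsto_diff lim tendsto_const t h12 l l1)
        show "\<forall>\<^sub>F n in sequentially. norm (\<phi> (t + h n) - \<phi> t) \<le> real N"
          using h t by (simp add: C_def)
      qed
      moreover have "norm ((\<phi> (t + d + l) - \<phi> (t + d)) - (\<phi> (t + l) - \<phi> t)) \<le> \<epsilon>"
        if t: "t \<ge> \<alpha>" and d: "0 \<le> d" "d \<le> 1 / Suc N" for t d
      proof (rule Lim_norm_ubound[OF sequentially_bot])
        show "(\<lambda>n. (\<phi> (t + d + h n) - \<phi> (t + d)) - (\<phi> (t + h n) - \<phi> t))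
            \<longlonglongrightarrow> (\<phi> (t + d + l) - \<phi> (t + d)) - (\<phi> (t + l) - \<phi> t)"
          using t d by (intro tendsto_diff lim tendsto_const h12 l l1) auto
        show "\<forall>\<^sub>F n in sequentially. norm ((\<phi> (t + d + h n) - \<phi> (t + d)) - (\<phi> (t + h n) - \<phi> t)) \<le> \<epsilon>"
          using h t d by (auto simp: C_def)
      qed
      ultimately show "l \<in> C N" using l1 by (simp add: C_def)
    qed
    have cover: "{1..2} \<subseteq> (\<Union>N. C N)"
    proof
      fix h :: real assume h: "h \<in> {1..2}"
      then have "h > 0" by simp
      obtain B where B: "\<And>t. t \<ge> \<alpha> \<Longrightarrow> norm (\<phi> (t + h) - \<phi> t) \<le> B"
        using bdd[OF \<open>h > 0\<close>] by (auto simp: bounded_iff)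
      obtain d where d: "d > 0" "\<And>x y. x \<ge> \<alpha> \<Longrightarrow> y \<ge> \<alpha> \<Longrightarrow> dist y x < d \<Longrightarrow>
          dist (\<phi> (y + h) - \<phi> y) (\<phi> (x + h) - \<phi> x) < \<epsilon>"
        using uc[OF \<open>h > 0\<close>] e unfolding uniformly_continuous_on_def by (metis atLeast_iff)
      obtain N1 where N1: "1 / Suc N1 < d" using d(1) nat_approx_posE by blast
      obtain N2 :: nat where N2: "B \<le> N2" using real_arch_simple by blast
      define N where "N = max N1 N2"
      have "1 / Suc N \<le> 1 / Suc N1" by (intro divide_left_mono) (auto simp: N_def)
      then have N: "1 / Suc N < d" "B \<le> N" using N1 N2 by (auto simp: N_def)
      have "norm ((\<phi> (t + u + h) - \<phi> (t + u)) - (\<phi> (t + h) - \<phi> t)) \<le> \<epsilon>"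
        if "t \<ge> \<alpha>" "0 \<le> u" "u \<le> 1 / Suc N" for t u
        using d(2)[of t "t + u"] that N(1) by (simp add: dist_norm)
      moreover have "norm (\<phi> (t + h) - \<phi> t) \<le> N" if "t \<ge> \<alpha>" for t
        using B[OF that] N(2) by linarith
      ultimately have "h \<in> C N" using h by (simp add: C_def)
      then show "h \<in> (\<Union>N. C N)" by blast
    qed
    \<comment> \<open>the admissible steps \<open>c\<close> and \<open>c + h\<close> differ by an arbitrary \<open>h\<close> between 0 and \<open>\<eta>\<close>\<close>
    obtain N c \<eta> where c: "\<eta> > 0" "1 \<le> c" "{c..c + \<eta>} \<subseteq> C N"
      by (rule Baire_interval[OF closed cover]) simp
    have hC: "c + h \<in> C N" if "0 \<le> h" "h \<le> \<eta>" for h using c that by auto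
    have bd: "norm (\<phi> (\<tau> + h) - \<phi> \<tau>) \<le> 2 * N" if "\<tau> \<ge> \<alpha> + c" "0 \<le> h" "h \<le> \<eta>" for \<tau> h
    proof -
      have "norm (\<phi> (\<tau> - c + (c + h)) - \<phi> (\<tau> - c)) \<le> N" "norm (\<phi> (\<tau> - c + (c + 0)) - \<phi> (\<tau> - c)) \<le> N"
        by (rule C1; use hC[of h] hC[of 0] that c(1) in simp)+
      then show ?thesis
        using norm_triangle_ineq4[of "\<phi> (\<tau> - c + (c + h)) - \<phi> (\<tau> - c)" "\<phi> (\<tau> - c + (c + 0)) - \<phi> (\<tau> - c)"]
        by simp
    qed
    have near: "norm ((\<phi> (\<tau> + h + d) - \<phi> (\<tau> + h)) - (\<phi> (\<tau> + d) - \<phi> \<tau>)) \<le> 2 * \<epsilon>"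
      if t: "\<tau> \<ge> \<alpha> + c" and h: "0 \<le> h" "h \<le> \<eta>" and d: "0 \<le> d" "d \<le> 1 / Suc N" for \<tau> h d
    proof -
      let ?t = "\<tau> - c"
      have a1: "norm ((\<phi> (?t + d + (c + h)) - \<phi> (?t + d)) - (\<phi> (?t + (c + h)) - \<phi> ?t)) \<le> \<epsilon>"
        and a2: "norm ((\<phi> (?t + d + (c + 0)) - \<phi> (?t + d)) - (\<phi> (?t + (c + 0)) - \<phi> ?t)) \<le> \<epsilon>"
        by (rule C2; use hC[of h] hC[of 0] t h d c(1) in simp)+
      have eq: "(\<phi> (\<tau> + h + d) - \<phi> (\<tau> + h)) - (\<phi> (\<tau> + d) - \<phi> \<tau>) =
        ((\<phi> (?t + d + (c + h)) - \<phi> (?t + d)) - (\<phi> (?t + (c + h)) - \<phi> ?t)) -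
        ((\<phi> (?t + d + (c + 0)) - \<phi> (?t + d)) - (\<phi> (?t + (c + 0)) - \<phi> ?t))"
        by (simp add: algebra_simps)
      show ?thesis
        unfolding eq mult_2 by (rule order_trans[OF norm_triangle_ineq4 add_mono[OF a1 a2]])
    qed
    obtain k0 :: nat where k0: "2 * N / \<epsilon> \<le> k0" using real_arch_simple by blast
    define k where "k = Suc k0"
    have k: "k > 0" "2 * N / \<epsilon> \<le> k" using k0 by (auto simp: k_def)
    define d0 where "d0 = min (1 / Suc N) (\<eta> / k)"
    have d0: "d0 > 0" using c(1) k by (simp add: d0_def)
    have "norm (\<phi> (\<tau> + d) - \<phi> \<tau>) \<le> 3 * \<epsilon>" if t: "\<tau> \<ge> \<alpha> + c" and d: "0 \<le> d" "d \<le> d0" for \<tau> d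
    proof -
      have kd: "k * d \<le> \<eta>"
      proof -
        have "k * d \<le> k * (\<eta> / k)" using d by (intro mult_left_mono) (auto simp: d0_def)
        then show ?thesis using k by simp
      qed
      have jd: "0 \<le> j * d" "j * d \<le> \<eta>" if "j < k" for j :: nat
      proof -
        have "j * d \<le> k * d" using that d by (intro mult_right_mono) auto
        then show "j * d \<le> \<eta>" using kd by simp
      qed (use d in auto)
      have "\<phi> (\<tau> + k * d) - \<phi> \<tau> = (\<Sum>j<k. \<phi> (\<tau> + j * d + d) - \<phi> (\<tau> + j * d))"
        using sum_lessThan_telescope[of "\<lambda>j. \<phi> (\<tau> + real j * d)" k] by (simp add: algebra_simps)
      then have "(\<phi> (\<tau> + k * d) - \<phi> \<tau>) - real k *\<^sub>R (\<phi> (\<tau> + d) - \<phi> \<tau>)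
          = (\<Sum>j<k. (\<phi> (\<tau> + j * d + d) - \<phi> (\<tau> + j * d)) - (\<phi> (\<tau> + d) - \<phi> \<tau>))"
        by (simp add: sum_subtractf sum_constant_scaleR scaleR_diff_right)
      also have "norm \<dots> \<le> (\<Sum>j<k. 2 * \<epsilon>)"
        using t jd d by (intro sum_norm_le near) (auto simp: d0_def)
      finally have "norm ((\<phi> (\<tau> + k * d) - \<phi> \<tau>) - real k *\<^sub>R (\<phi> (\<tau> + d) - \<phi> \<tau>)) \<le> 2 * \<epsilon> * k"
        by (simp add: mult.commute)
      moreover have "norm (\<phi> (\<tau> + k * d) - \<phi> \<tau>) \<le> 2 * N"
        using kd d by (intro bd t) auto
      ultimately have "norm (real k *\<^sub>R (\<phi> (\<tau> + d) - \<phi> \<tau>)) \<le> 2 * N + 2 * \<epsilon> * k"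
        by (smt (verit, best) norm_triangle_sub norm_minus_commute)
      also have "\<dots> \<le> 3 * \<epsilon> * k" using k e by (simp add: field_simps)
      finally show ?thesis using k(1) by (simp add: mult.commute)
    qed
    then show ?thesis using d0 c(2) by (intro exI[of _ "\<alpha> + c"]) auto
  qed
  show ?thesis
    unfolding uniformly_continuous_on_def
  proof (intro allI impI)
    fix e :: real assume "e > 0"
    then have e3: "e / 6 > 0" by simp
    obtain \<beta> d0 where b: "\<beta> \<ge> \<alpha>" "d0 > 0"
      "\<And>\<tau> d. \<tau> \<ge> \<beta> \<Longrightarrow> 0 \<le> d \<Longrightarrow> d \<le> d0 \<Longrightarrow> norm (\<phi> (\<tau> + d) - \<phi> \<tau>) \<le> 3 * (e / 6)"
      using key[OF e3] by metis
    have "uniformly_continuous_on {\<alpha>..\<beta> + 1} \<phi>"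
      by (intro compact_uniformly_continuous continuous_on_subset[OF cont]) auto
    then obtain d1 where d1: "d1 > 0" "\<And>x y. x \<in> {\<alpha>..\<beta> + 1} \<Longrightarrow> y \<in> {\<alpha>..\<beta> + 1} \<Longrightarrow> dist y x < d1 \<Longrightarrow> dist (\<phi> y) (\<phi> x) < e"
      using \<open>e > 0\<close> unfolding uniformly_continuous_on_def by metis
    define d where "d = Min {1, d0, d1}"
    have d: "d > 0" "d \<le> 1" "d \<le> d0" "d \<le> d1" using b d1 by (auto simp: d_def)
    have main: "dist (\<phi> y) (\<phi> x) < e" if "\<alpha> \<le> x" "x \<le> y" "y < x + d" for x y
    proof (cases "x \<ge> \<beta>")
      case True
      then show ?thesis using b(3)[of x "y - x"] that d \<open>e > 0\<close> by (simp add: dist_norm)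
    next
      case False
      then show ?thesis using that d by (intro d1(2)) (auto simp: dist_real_def)
    qed
    have "dist (\<phi> y) (\<phi> x) < e" if "x \<in> {\<alpha>..}" "y \<in> {\<alpha>..}" "dist y x < d" for x y
      using main[of x y] main[of y x] that by (cases "x \<le> y") (auto simp: dist_real_def dist_commute)
    then show "\<exists>d>0. \<forall>x\<in>{\<alpha>..}. \<forall>x'\<in>{\<alpha>..}. dist x' x < d \<longrightarrow> dist (\<phi> x') (\<phi> x) < e"
      using d(1) by blast
  qed
qed

section \<open>Integration by parts for locally integrable functions\<close>

text \<open>The difference \<open>\<Psi>\<close> of the two sides is constant: over \<open>[u, v]\<close> the product rule fails only by terms in
which \<open>k\<close> or \<open>\<phi>\<close> varies within the interval, and these are bounded by \<open>2 L (v - u) \<integral> norm f\<close>. The last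
integral tends to zero with \<open>v - u\<close>, so \<open>\<Psi>\<close> has derivative zero everywhere.\<close>

lemma integral_by_parts_locally_L1:
  fixes f :: "real \<Rightarrow> 'a::complex_banach" and k k' :: "real \<Rightarrow> complex"
  assumes f: "locally_L1 \<alpha> f"
    and k: "\<And>t. (k has_vector_derivative k' t) (at t)" and k': "continuous_on UNIV k'"
    and t: "\<alpha> \<le> t"
  shows "integral {\<alpha>..t} (\<lambda>s. k s *\<^sub>C f s) =
    k t *\<^sub>C integral {\<alpha>..t} f - integral {\<alpha>..t} (\<lambda>s. k' s *\<^sub>C integral {\<alpha>..s} f)"
proof -
  define \<phi> where "\<phi> s = integral {\<alpha>..s} f" for s
  have kc: "continuous_on UNIV k"
    using k by (meson continuous_at_imp_continuous_on has_vector_derivative_continuous)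
  have \<phi>c: "continuous_on {\<alpha>..} \<phi>"
    unfolding \<phi>_def by (rule continuous_on_locally_L1_integral[OF f])
  have nf: "locally_L1 \<alpha> (\<lambda>s. norm (f s))" by (rule locally_L1_norm[OF f])
  have kf: "locally_L1 \<alpha> (\<lambda>s. k s *\<^sub>C f s)"
    by (intro locally_L1_scaleC f continuous_on_subset[OF kc]) simp
  have k\<phi>c: "continuous_on {\<alpha>..} (\<lambda>s. k' s *\<^sub>C \<phi> s)"
    by (intro scaleC.continuous_on \<phi>c continuous_on_subset[OF k']) simp
  have k\<phi>: "locally_L1 \<alpha> (\<lambda>s. k' s *\<^sub>C \<phi> s)" by (rule locally_L1_continuous[OF k\<phi>c])
  define \<Psi> where "\<Psi> s = integral {\<alpha>..s} (\<lambda>s. k s *\<^sub>C f s) - k s *\<^sub>C \<phi> s + integral {\<alpha>..s} (\<lambda>s. k' s *\<^sub>C \<phi> s)" for s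
  define N where "N s = integral {\<alpha>..s} (\<lambda>s. norm (f s))" for s
  obtain L where L: "L > 0" "\<And>s. s \<in> {\<alpha>..t} \<Longrightarrow> norm (k' s) \<le> L"
    using compact_imp_bounded[OF compact_continuous_image[OF continuous_on_subset[OF k'] compact_Icc[of \<alpha> t]]]
    by (auto simp: bounded_pos)
  have lip: "norm (k v - k u) \<le> L * (v - u)" if "\<alpha> \<le> u" "u \<le> v" "v \<le> t" for u v
  proof -
    have "norm (k v - k u) \<le> L * norm (v - u)"
    proof (rule differentiable_bound[of "{\<alpha>..t}" k "\<lambda>s h. h *\<^sub>R k' s"])
      fix s assume s: "s \<in> {\<alpha>..t}"
      show "(k has_derivative (\<lambda>h. h *\<^sub>R k' s)) (at s within {\<alpha>..t})"
        using k[of s] by (simp add: has_vector_derivative_def has_derivative_at_withinI)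
      show "onorm (\<lambda>h. h *\<^sub>R k' s) \<le> L"
        using L(2)[OF s] by (intro onorm_bound) (auto simp: mult.commute[of _ "norm (k' s)"] L(1) less_imp_le intro: mult_right_mono)
    qed (use that in auto)
    then show ?thesis using that by simp
  qed
  have est: "norm (\<Psi> v - \<Psi> u) \<le> 2 * L * (v - u) * (N v - N u)" if uv: "\<alpha> \<le> u" "u \<le> v" "v \<le> t" for u v
  proof -
    have Nuv: "integral {u..v} (\<lambda>s. norm (f s)) = N v - N u"
      unfolding N_def by (rule locally_L1_integral_diff[OF nf uv(1,2)])
    have \<phi>uv: "\<phi> v - \<phi> u = integral {u..v} f"
      unfolding \<phi>_def by (rule locally_L1_integral_diff[OF f uv(1,2), symmetric])
    have int: "f integrable_on {u..v}" "(\<lambda>s. k s *\<^sub>C f s) integrable_on {u..v}"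
      "(\<lambda>s. k' s *\<^sub>C \<phi> s) integrable_on {u..v}" "(\<lambda>s. norm (f s)) integrable_on {u..v}"
      by (intro locally_L1_integrable[of \<alpha>] f kf k\<phi> nf uv)+
    have 1: "integral {u..v} (\<lambda>s. k s *\<^sub>C f s) - k v *\<^sub>C integral {u..v} f = integral {u..v} (\<lambda>s. (k s - k v) *\<^sub>C f s)"
    proof -
      have "integral {u..v} (\<lambda>s. k v *\<^sub>C f s) = k v *\<^sub>C integral {u..v} f"
        using integral_linear[OF int(1) scaleC.bounded_linear_right[of "k v"]] by (simp add: o_def)
      moreover have "(\<lambda>s. k v *\<^sub>C f s) integrable_on {u..v}"
        using integrable_linear[OF int(1) scaleC.bounded_linear_right[of "k v"]] by (simp add: o_def)
      ultimately show ?thesis using int(2)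
        by (simp add: scaleC.diff_left Henstock_Kurzweil_Integration.integral_diff)
    qed
    have k'int: "((\<lambda>s. k' s *\<^sub>C \<phi> u) has_integral (k v - k u) *\<^sub>C \<phi> u) {u..v}"
    proof -
      have "(k' has_integral (k v - k u)) {u..v}"
        by (rule fundamental_theorem_of_calculus[OF uv(2)]) (rule has_vector_derivative_at_within[OF k])
      from has_integral_linear[OF this scaleC.bounded_linear_left[of "\<phi> u"]]
      show ?thesis by (simp add: o_def)
    qed
    have 2: "integral {u..v} (\<lambda>s. k' s *\<^sub>C \<phi> s) - (k v - k u) *\<^sub>C \<phi> u = integral {u..v} (\<lambda>s. k' s *\<^sub>C (\<phi> s - \<phi> u))"
      using int(3) k'int
      by (simp add: scaleC.diff_right Henstock_Kurzweil_Integration.integral_diff has_integral_integrable integral_unique)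
    have e1: "norm (integral {u..v} (\<lambda>s. (k s - k v) *\<^sub>C f s)) \<le> integral {u..v} (\<lambda>s. L * (v - u) * norm (f s))"
    proof (rule Henstock_Kurzweil_Integration.integral_norm_bound_integral)
      have "continuous_on {\<alpha>..} (\<lambda>s. k s - k v)"
        by (intro continuous_intros continuous_on_subset[OF kc]) simp
      then have "locally_L1 \<alpha> (\<lambda>s. (k s - k v) *\<^sub>C f s)"
        by (rule locally_L1_scaleC[OF _ f])
      then show "(\<lambda>s. (k s - k v) *\<^sub>C f s) integrable_on {u..v}"
        by (rule locally_L1_integrable) (rule uv)
      show "(\<lambda>s. L * (v - u) * norm (f s)) integrable_on {u..v}"
        using integrable_cmul[OF int(4), of "L * (v - u)"] by simp
      fix s assume s: "s \<in> {u..v}"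
      have "norm (k s - k v) \<le> L * (v - s)" using lip[of s v] s uv by (simp add: norm_minus_commute)
      also have "\<dots> \<le> L * (v - u)" using s L by (intro mult_left_mono) auto
      finally show "norm ((k s - k v) *\<^sub>C f s) \<le> L * (v - u) * norm (f s)"
        by (simp add: norm_scaleC mult_right_mono)
    qed
    have e2: "norm (integral {u..v} (\<lambda>s. k' s *\<^sub>C (\<phi> s - \<phi> u))) \<le> integral {u..v} (\<lambda>s. L * (N v - N u))"
    proof (rule Henstock_Kurzweil_Integration.integral_norm_bound_integral)
      have "continuous_on {\<alpha>..} (\<lambda>s. k' s *\<^sub>C (\<phi> s - \<phi> u))"
        by (intro scaleC.continuous_on continuous_intros \<phi>c continuous_on_subset[OF k']) simp
      then have "locally_L1 \<alpha> (\<lambda>s. k' s *\<^sub>C (\<phi> s - \<phi> u))" by (rule locally_L1_continuous)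
      then show "(\<lambda>s. k' s *\<^sub>C (\<phi> s - \<phi> u)) integrable_on {u..v}"
        by (rule locally_L1_integrable) (rule uv)
      fix s assume s: "s \<in> {u..v}"
      have "\<phi> s - \<phi> u = integral {u..s} f"
        unfolding \<phi>_def using locally_L1_integral_diff[OF f, of u s] uv s by simp
      also have "norm \<dots> \<le> integral {u..s} (\<lambda>s. norm (f s))"
        by (rule Henstock_Kurzweil_Integration.integral_norm_bound_integral)
          (use s uv in \<open>auto intro!: locally_L1_integrable[of \<alpha>] f nf\<close>)
      also have "\<dots> \<le> integral {u..v} (\<lambda>s. norm (f s))"
        using s uv by (intro integral_subset_le locally_L1_integrable[of \<alpha>] nf) auto
      finally have "norm (\<phi> s - \<phi> u) \<le> N v - N u" by (simp add: Nuv)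
      then show "norm (k' s *\<^sub>C (\<phi> s - \<phi> u)) \<le> L * (N v - N u)"
        using L(2)[of s] L(1) s uv by (simp add: norm_scaleC mult_mono)
    qed auto
    have "\<Psi> v - \<Psi> u = integral {u..v} (\<lambda>s. k s *\<^sub>C f s) - (k v *\<^sub>C \<phi> v - k u *\<^sub>C \<phi> u) + integral {u..v} (\<lambda>s. k' s *\<^sub>C \<phi> s)"
      unfolding \<Psi>_def using locally_L1_integral_diff[OF kf, of u v] locally_L1_integral_diff[OF k\<phi>, of u v] uv by simp
    also have "k v *\<^sub>C \<phi> v - k u *\<^sub>C \<phi> u = k v *\<^sub>C integral {u..v} f + (k v - k u) *\<^sub>C \<phi> u"
      unfolding \<phi>uv[symmetric] by (simp add: scaleC.diff_left scaleC.diff_right)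
    also have "integral {u..v} (\<lambda>s. k s *\<^sub>C f s) - (k v *\<^sub>C integral {u..v} f + (k v - k u) *\<^sub>C \<phi> u)
        + integral {u..v} (\<lambda>s. k' s *\<^sub>C \<phi> s)
      = integral {u..v} (\<lambda>s. (k s - k v) *\<^sub>C f s) + integral {u..v} (\<lambda>s. k' s *\<^sub>C (\<phi> s - \<phi> u))"
      unfolding 1[symmetric] 2[symmetric] by simp
    also have "norm \<dots> \<le> L * (v - u) * (N v - N u) + L * (N v - N u) * (v - u)"
    proof (rule order_trans[OF norm_triangle_ineq add_mono])
      show "norm (integral {u..v} (\<lambda>s. (k s - k v) *\<^sub>C f s)) \<le> L * (v - u) * (N v - N u)"
        using e1 by (simp add: Nuv)
      show "norm (integral {u..v} (\<lambda>s. k' s *\<^sub>C (\<phi> s - \<phi> u))) \<le> L * (N v - N u) * (v - u)"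
        using e2 uv by (simp add: mult_ac)
    qed
    finally show ?thesis by (simp add: algebra_simps)
  qed
  have "(\<Psi> has_vector_derivative 0) (at s within {\<alpha>..t})" if s: "s \<in> {\<alpha>..t}" for s
    unfolding has_vector_derivative_def has_derivative_within
  proof (intro conjI)
    have "continuous_on {\<alpha>..t} N"
      unfolding N_def by (rule continuous_on_subset[OF continuous_on_locally_L1_integral[OF nf]]) simp
    then have "(N \<longlongrightarrow> N s) (at s within {\<alpha>..t})"
      using s by (simp add: continuous_on)
    then have "((\<lambda>u. 2 * L * \<bar>N u - N s\<bar>) \<longlongrightarrow> 2 * L * \<bar>N s - N s\<bar>) (at s within {\<alpha>..t})"
      by (intro tendsto_intros)
    then have lim: "((\<lambda>u. 2 * L * \<bar>N u - N s\<bar>) \<longlongrightarrow> 0) (at s within {\<alpha>..t})" by simp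
    have "norm ((1 / norm (u - s)) *\<^sub>R (\<Psi> u - (\<Psi> s + (u - s) *\<^sub>R 0))) \<le> 2 * L * \<bar>N u - N s\<bar>"
      if u: "u \<in> {\<alpha>..t}" "u \<noteq> s" for u
    proof -
      have "norm (\<Psi> u - \<Psi> s) \<le> 2 * L * \<bar>u - s\<bar> * \<bar>N u - N s\<bar>"
      proof (cases "u \<le> s")
        case True
        then have "norm (\<Psi> u - \<Psi> s) \<le> 2 * L * (s - u) * (N s - N u)"
          using est[of u s] s u by (simp add: norm_minus_commute)
        also have "\<dots> \<le> 2 * L * (s - u) * \<bar>N u - N s\<bar>"
          using True L by (intro mult_left_mono) auto
        finally show ?thesis using True by simp
      next
        case False
        then have "norm (\<Psi> u - \<Psi> s) \<le> 2 * L * (u - s) * (N u - N s)"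
          using est[of s u] s u by simp
        also have "\<dots> \<le> 2 * L * (u - s) * \<bar>N u - N s\<bar>"
          using False L by (intro mult_left_mono) auto
        finally show ?thesis using False by simp
      qed
      moreover have "norm ((1 / norm (u - s)) *\<^sub>R (\<Psi> u - (\<Psi> s + (u - s) *\<^sub>R 0))) = norm (\<Psi> u - \<Psi> s) / \<bar>u - s\<bar>"
        by simp
      ultimately show ?thesis using u(2) by (simp add: pos_divide_le_eq mult_ac)
    qed
    then have "\<forall>\<^sub>F u in at s within {\<alpha>..t}. norm ((1 / norm (u - s)) *\<^sub>R (\<Psi> u - (\<Psi> s + (u - s) *\<^sub>R 0))) \<le> 2 * L * \<bar>N u - N s\<bar>"
      by (simp add: eventually_at_filter)
    then show "((\<lambda>u. (1 / norm (u - s)) *\<^sub>R (\<Psi> u - (\<Psi> s + (u - s) *\<^sub>R 0))) \<longlongrightarrow> 0) (at s within {\<alpha>..t})"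
      by (rule Lim_null_comparison[OF _ lim])
  qed (rule bounded_linear_scaleR_left)
  then obtain c where c: "\<And>s. s \<in> {\<alpha>..t} \<Longrightarrow> \<Psi> s = c"
    using has_vector_derivative_zero_constant[of "{\<alpha>..t}" \<Psi>] by auto
  then have "\<Psi> t = \<Psi> \<alpha>" using t by simp
  also have "\<Psi> \<alpha> = 0" by (simp add: \<Psi>_def \<phi>_def scaleC.zero_right)
  finally show ?thesis unfolding \<Psi>_def \<phi>_def by (simp add: algebra_simps)
qed

section \<open>Return times and joint recurrence\<close>

lemma norm_diff_le_displaced:
  fixes x y u v :: "'b::real_normed_vector"
  shows "norm (x - y) \<le> norm (u - v) + norm (u - x) + norm (v - y)"
proof -
  have "x - y = (u - v) - (u - x) + (v - y)" by simp
  also have "norm \<dots> \<le> norm ((u - v) - (u - x)) + norm (v - y)" by (rule norm_triangle_ineq)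
  also have "norm ((u - v) - (u - x)) \<le> norm (u - v) + norm (u - x)" by (rule norm_triangle_ineq4)
  finally show ?thesis by simp
qed

text \<open>The compact set may be replaced by an interval \<open>{-r..r}\<close>.\<close>

lemma relatively_dense_iff:
  "relatively_dense E \<longleftrightarrow> (\<exists>r. \<forall>s. \<exists>\<tau>\<in>E. \<bar>\<tau> - s\<bar> \<le> r)"
proof
  assume "relatively_dense E"
  then obtain L where L: "compact L" "{\<tau> + l |\<tau> l. \<tau> \<in> E \<and> l \<in> L} = UNIV"
    by (auto simp: relatively_dense_def)
  obtain r where r: "\<And>l. l \<in> L \<Longrightarrow> \<bar>l\<bar> \<le> r"
    using compact_imp_bounded[OF L(1)] by (auto simp: bounded_iff)
  have "\<exists>\<tau>\<in>E. \<bar>\<tau> - s\<bar> \<le> r" for s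
  proof -
    obtain \<tau> l where "\<tau> \<in> E" "l \<in> L" "s = \<tau> + l" using L(2) by blast
    then show ?thesis using r[of l] by (intro bexI[of _ \<tau>]) auto
  qed
  then show "\<exists>r. \<forall>s. \<exists>\<tau>\<in>E. \<bar>\<tau> - s\<bar> \<le> r" by blast
next
  assume "\<exists>r. \<forall>s. \<exists>\<tau>\<in>E. \<bar>\<tau> - s\<bar> \<le> r"
  then obtain r where r: "\<And>s. \<exists>\<tau>\<in>E. \<bar>\<tau> - s\<bar> \<le> r" by blast
  have "s \<in> {\<tau> + l |\<tau> l. \<tau> \<in> E \<and> l \<in> {-r..r}}" for s
  proof -
    obtain \<tau> where "\<tau> \<in> E" "\<bar>\<tau> - s\<bar> \<le> r" using r by blast
    then show ?thesis by (intro CollectI exI[of _ \<tau>] exI[of _ "s - \<tau>"]) auto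
  qed
  then show "relatively_dense E"
    unfolding relatively_dense_def by (intro exI[of _ "{-r..r}"]) auto
qed

lemma relatively_dense_mono: "relatively_dense E \<Longrightarrow> E \<subseteq> E' \<Longrightarrow> relatively_dense E'"
  unfolding relatively_dense_iff by blast

definition return_times :: "(real \<Rightarrow> 'b::real_normed_vector) set \<Rightarrow> real set \<Rightarrow> real \<Rightarrow> real set" where
  "return_times S K \<epsilon> = {\<tau>. \<forall>F\<in>S. \<forall>t\<in>K. norm (F (t + \<tau>) - F t) \<le> \<epsilon>}"

definition uniformly_recurrent :: "(real \<Rightarrow> 'b::real_normed_vector) set \<Rightarrow> bool" where
  "uniformly_recurrent S \<longleftrightarrow> (\<forall>K \<epsilon>. compact K \<and> \<epsilon> > 0 \<longrightarrow> relatively_dense (return_times S K \<epsilon>))"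

lemma return_times_mono:
  assumes "S \<subseteq> S'" "K \<subseteq> K'" "\<epsilon>' \<le> \<epsilon>"
  shows "return_times S' K' \<epsilon>' \<subseteq> return_times S K \<epsilon>"
proof (rule subsetI, unfold return_times_def mem_Collect_eq, intro ballI)
  fix \<tau> F t assume *: "\<forall>F\<in>S'. \<forall>t\<in>K'. norm (F (t + \<tau>) - F t) \<le> \<epsilon>'" "F \<in> S" "t \<in> K"
  then have "norm (F (t + \<tau>) - F t) \<le> \<epsilon>'" using assms(1,2) by (meson subsetD)
  then show "norm (F (t + \<tau>) - F t) \<le> \<epsilon>" using assms(3) by (rule order_trans)
qed

lemma return_timesD: "\<tau> \<in> return_times S K \<epsilon> \<Longrightarrow> F \<in> S \<Longrightarrow> t \<in> K \<Longrightarrow> norm (F (t + \<tau>) - F t) \<le> \<epsilon>"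
  by (simp add: return_times_def)

lemma return_times_subsetI:
  assumes "\<And>\<tau> t. \<tau> \<in> return_times S K' \<epsilon>' \<Longrightarrow> t \<in> K \<Longrightarrow> norm (G (t + \<tau>) - G t) \<le> \<epsilon>"
  shows "return_times S K' \<epsilon>' \<subseteq> return_times {G} K \<epsilon>"
  by (rule subsetI, subst return_times_def) (simp add: assms)

lemma return_times_Un: "return_times (S \<union> T) K \<epsilon> = return_times S K \<epsilon> \<inter> return_times T K \<epsilon>"
  by (auto simp: return_times_def)

lemma uniformly_recurrent_subset:
  assumes "uniformly_recurrent S'" "S \<subseteq> S'"
  shows "uniformly_recurrent S"
  unfolding uniformly_recurrent_def
proof (intro allI impI)
  fix K :: "real set" and \<epsilon> :: real assume "compact K \<and> \<epsilon> > 0"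
  then have "relatively_dense (return_times S' K \<epsilon>)"
    using assms(1) by (simp add: uniformly_recurrent_def)
  then show "relatively_dense (return_times S K \<epsilon>)"
    by (rule relatively_dense_mono) (intro return_times_mono assms(2) order_refl)
qed

text \<open>Tuples and their Euclidean norm are exchanged for finite sets and separate estimates of the members,
which are easier to enlarge and to combine.\<close>

lemma jointly_recurrent_iff:
  fixes W :: "(real \<Rightarrow> 'b::banach) set"
  shows "jointly_recurrent W \<longleftrightarrow>
    (\<forall>F\<in>W. continuous_on UNIV F) \<and> (\<forall>S. finite S \<and> S \<subseteq> W \<longrightarrow> uniformly_recurrent S)"
proof (intro iffI conjI ballI allI impI)
  assume W: "jointly_recurrent W"
  show "continuous_on UNIV F" if "F \<in> W" for F
    using W[unfolded jointly_recurrent_def, rule_format, of 1 "\<lambda>_. F"] that by (simp add: recurrent_tuple_def)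
  fix S assume S: "finite S \<and> S \<subseteq> W"
  then obtain p :: nat and F where F: "S = F ` {i. i < p}"
    using finite_imp_nat_seg_image_inj_on by metis
  have "recurrent_tuple p F" using W F S by (auto simp: jointly_recurrent_def)
  then have rd: "relatively_dense {\<tau>. \<forall>t\<in>K. L2_set (\<lambda>i. norm (F i (t + \<tau>) - F i t)) {..<p} \<le> \<epsilon>}"
    if "compact K" "\<epsilon> > 0" for K \<epsilon>
    using that by (simp add: recurrent_tuple_def recurrent_dist_def)
  show "uniformly_recurrent S"
    unfolding uniformly_recurrent_def
  proof (intro allI impI)
    fix K :: "real set" and \<epsilon> :: real assume K: "compact K \<and> \<epsilon> > 0"
    show "relatively_dense (return_times S K \<epsilon>)"
    proof (rule relatively_dense_mono[OF rd])
      show "{\<tau>. \<forall>t\<in>K. L2_set (\<lambda>i. norm (F i (t + \<tau>) - F i t)) {..<p} \<le> \<epsilon>} \<subseteq> return_times S K \<epsilon>"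
      proof (clarsimp simp: return_times_def F)
        fix \<tau> i t
        assume *: "\<forall>t\<in>K. L2_set (\<lambda>i. norm (F i (t + \<tau>) - F i t)) {..<p} \<le> \<epsilon>" "i < p" "t \<in> K"
        have "norm (F i (t + \<tau>) - F i t) \<le> L2_set (\<lambda>i. norm (F i (t + \<tau>) - F i t)) {..<p}"
          using * by (intro member_le_L2_set[of "{..<p}" i "\<lambda>i. norm (F i (t + \<tau>) - F i t)"]) auto
        then show "norm (F i (t + \<tau>) - F i t) \<le> \<epsilon>" using * by force
      qed
    qed (use K in auto)
  qed
next
  assume W: "(\<forall>F\<in>W. continuous_on UNIV F) \<and> (\<forall>S. finite S \<and> S \<subseteq> W \<longrightarrow> uniformly_recurrent S)"
  show "jointly_recurrent W"
    unfolding jointly_recurrent_def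
  proof (intro allI impI)
    fix p :: nat and F :: "nat \<Rightarrow> real \<Rightarrow> 'b" assume F: "\<forall>i<p. F i \<in> W"
    have S: "uniformly_recurrent (F ` {..<p})" using W F by auto
    show "recurrent_tuple p F"
      unfolding recurrent_tuple_def recurrent_dist_def
    proof (intro conjI allI impI)
      show "continuous_on UNIV (F i)" if "i < p" for i using W F that by blast
      fix K :: "real set" and \<epsilon> :: real assume K: "compact K \<and> \<epsilon> > 0"
      define \<delta> where "\<delta> = \<epsilon> / (p + 1)"
      have \<delta>: "\<delta> > 0" using K by (simp add: \<delta>_def)
      have pd: "p * \<delta> \<le> \<epsilon>" using K by (simp add: \<delta>_def field_simps)
      show "relatively_dense {\<tau>. \<forall>t\<in>K. L2_set (\<lambda>i. norm (F i (t + \<tau>) - F i t)) {..<p} \<le> \<epsilon>}"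
      proof (rule relatively_dense_mono)
        show "relatively_dense (return_times (F ` {..<p}) K \<delta>)"
          using S K \<delta> unfolding uniformly_recurrent_def by blast
        show "return_times (F ` {..<p}) K \<delta> \<subseteq> {\<tau>. \<forall>t\<in>K. L2_set (\<lambda>i. norm (F i (t + \<tau>) - F i t)) {..<p} \<le> \<epsilon>}"
        proof (clarsimp simp: return_times_def)
          fix \<tau> t assume *: "\<forall>i\<in>{..<p}. \<forall>t\<in>K. norm (F i (t + \<tau>) - F i t) \<le> \<delta>" "t \<in> K"
          have "L2_set (\<lambda>i. norm (F i (t + \<tau>) - F i t)) {..<p} \<le> (\<Sum>i<p. norm (F i (t + \<tau>) - F i t))"
            by (rule L2_set_le_sum) auto
          also have "\<dots> \<le> p * \<delta>"
            using sum_bounded_above[of "{..<p}" "\<lambda>i. norm (F i (t + \<tau>) - F i t)" \<delta>] * by auto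
          finally show "L2_set (\<lambda>i. norm (F i (t + \<tau>) - F i t)) {..<p} \<le> \<epsilon>" using pd by simp
        qed
      qed
    qed
  qed
qed

lemma C_urc_iff:
  "f \<in> C_urc J \<longleftrightarrow> f \<in> extensional J \<and> uniformly_continuous_on J f \<and> (\<exists>C. compact C \<and> f ` J \<subseteq> C)"
proof -
  have "compact (closure (f ` J)) \<longleftrightarrow> (\<exists>C. compact C \<and> f ` J \<subseteq> C)"
  proof
    assume "compact (closure (f ` J))"
    then show "\<exists>C. compact C \<and> f ` J \<subseteq> C"
      by (intro exI[of _ "closure (f ` J)"]) (simp add: closure_subset)
  next
    assume "\<exists>C. compact C \<and> f ` J \<subseteq> C"
    then obtain C where C: "compact C" "f ` J \<subseteq> C" by blast
    then have "closure (f ` J) \<subseteq> C" by (simp add: closure_minimal compact_imp_closed)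
    then have "C \<inter> closure (f ` J) = closure (f ` J)" by blast
    then show "compact (closure (f ` J))" using compact_Int_closed[OF C(1) closed_closure, of "f ` J"] by simp
  qed
  then show ?thesis by (simp add: C_urc_def)
qed

lemma C_urc_uniform_limit:
  fixes G :: "real \<Rightarrow> 'b::banach"
  assumes lim: "\<And>e. e > 0 \<Longrightarrow> \<exists>F\<in>C_urc UNIV. \<forall>t. norm (G t - F t) \<le> e"
  shows "G \<in> C_urc UNIV"
  unfolding C_urc_def
proof (intro CollectI conjI)
  show "uniformly_continuous_on UNIV G"
    unfolding uniformly_continuous_on_def
  proof (intro allI impI)
    fix e :: real assume "e > 0"
    then obtain F where F: "F \<in> C_urc UNIV" "\<And>t. norm (G t - F t) \<le> e / 3"
      using lim[of "e / 3"] by auto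
    have "uniformly_continuous_on UNIV F" using F(1) by (simp add: C_urc_def)
    then obtain d where d: "d > 0" "\<And>x y. dist y x < d \<Longrightarrow> dist (F y) (F x) < e / 3"
      unfolding uniformly_continuous_on_def using \<open>e > 0\<close> by (metis UNIV_I divide_pos_pos zero_less_numeral)
    have "dist (G y) (G x) < e" if "dist y x < d" for x y
    proof -
      have "norm (G y - G x) \<le> norm (G y - F y) + norm (F y - F x) + norm (G x - F x)"
        using norm_diff_le_displaced[of "G y" "G x" "F y" "F x"] by (simp add: norm_minus_commute)
      then show ?thesis using F(2)[of x] F(2)[of y] d(2)[OF that] by (simp add: dist_norm)
    qed
    then show "\<exists>d>0. \<forall>x\<in>UNIV. \<forall>x'\<in>UNIV. dist x' x < d \<longrightarrow> dist (G x') (G x) < e"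
      using d(1) by blast
  qed
  show "compact (closure (range G))"
    unfolding compact_eq_totally_bounded
  proof (intro conjI allI impI)
    show "complete (closure (range G))" by (simp add: complete_eq_closed)
    fix e :: real assume "e > 0"
    then obtain F where F: "F \<in> C_urc UNIV" "\<And>t. norm (G t - F t) \<le> e / 4"
      using lim[of "e / 4"] by auto
    then have "compact (closure (range F))" by (simp add: C_urc_def)
    then obtain k where k: "finite k" "closure (range F) \<subseteq> (\<Union>x\<in>k. ball x (e / 4))"
      using \<open>e > 0\<close> unfolding compact_eq_totally_bounded by (meson divide_pos_pos zero_less_numeral)
    have "closure (range G) \<subseteq> (\<Union>x\<in>k. cball x (e / 2))"
    proof (rule closure_minimal)
      show "closed (\<Union>x\<in>k. cball x (e / 2))" using k(1) by (intro closed_UN) auto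
      show "range G \<subseteq> (\<Union>x\<in>k. cball x (e / 2))"
      proof
        fix z assume "z \<in> range G"
        then obtain t where z: "z = G t" by blast
        have "F t \<in> closure (range F)" by (rule subsetD[OF closure_subset rangeI])
        then obtain x where x: "x \<in> k" "dist x (F t) < e / 4" using k(2) by auto
        have "dist x z \<le> dist x (F t) + dist (F t) (G t)" unfolding z by (rule dist_triangle)
        also have "\<dots> \<le> e / 4 + e / 4" using x(2) F(2)[of t] by (simp add: dist_norm norm_minus_commute)
        finally show "z \<in> (\<Union>x\<in>k. cball x (e / 2))" using x(1) by auto
      qed
    qed
    also have "\<dots> \<subseteq> (\<Union>x\<in>k. ball x e)" using \<open>e > 0\<close> by auto
    finally show "\<exists>k. finite k \<and> closure (range G) \<subseteq> (\<Union>x\<in>k. ball x e)" using k(1) by blast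
  qed
qed (simp add: extensional_def)

context
  fixes V R :: "(real \<Rightarrow> 'b::banach) set"
  assumes R: "is_rec_urc V R"
begin

lemma hull_C_urc: "F \<in> R \<Longrightarrow> F \<in> C_urc UNIV"
  using R by (auto simp: is_rec_urc_def REC_urc_def Let_def)

lemma hull_uniformly_continuous: "F \<in> R \<Longrightarrow> uniformly_continuous_on UNIV F"
  using hull_C_urc[of F] by (simp add: C_urc_iff)

lemma hull_relatively_compact: "F \<in> R \<Longrightarrow> \<exists>C. compact C \<and> range F \<subseteq> C"
  using hull_C_urc[of F] by (simp add: C_urc_iff)

lemma hull_bounded: "F \<in> R \<Longrightarrow> \<exists>B>0. \<forall>t. norm (F t) \<le> B"
proof -
  assume "F \<in> R"
  then obtain C where C: "compact C" "range F \<subseteq> C" using hull_relatively_compact by blast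
  then have "bounded (range F)" by (meson bounded_subset compact_imp_bounded)
  then show ?thesis by (auto simp: bounded_pos)
qed

lemma hull_uniformly_recurrent: "finite S \<Longrightarrow> S \<subseteq> R \<Longrightarrow> uniformly_recurrent S"
proof -
  have "jointly_recurrent R" using R by (simp add: is_rec_urc_def Let_def)
  then show "finite S \<Longrightarrow> S \<subseteq> R \<Longrightarrow> uniformly_recurrent S" by (simp add: jointly_recurrent_iff)
qed

text \<open>The only use of maximality: whatever is recurrent jointly with every finite part of \<open>R\<close> is in \<open>R\<close>.\<close>

lemma hull_insert:
  assumes G: "G \<in> C_urc UNIV"
    and rec: "\<And>S. finite S \<Longrightarrow> S \<subseteq> R \<Longrightarrow> uniformly_recurrent (insert G S)"
  shows "G \<in> R"
proof -
  have cont: "continuous_on UNIV G"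
    using G C_urc_iff uniformly_continuous_imp_continuous by blast
  have "recurrent G"
    using rec[of "{}"] cont
    by (simp add: recurrent_def recurrent_dist_def uniformly_recurrent_def return_times_def)
  moreover have "restrict G UNIV = G" by (simp add: restrict_def)
  ultimately have "G \<in> REC_urc UNIV"
    using G unfolding REC_urc_def REC_def by (metis IntI imageI mem_Collect_eq)
  moreover have "jointly_recurrent (insert G R)"
    unfolding jointly_recurrent_iff
  proof (intro conjI ballI allI impI)
    show "continuous_on UNIV F" if "F \<in> insert G R" for F
      using that cont hull_uniformly_continuous uniformly_continuous_imp_continuous by blast
    fix S assume "finite S \<and> S \<subseteq> insert G R"
    then have "uniformly_recurrent (insert G (S - {G}))" by (intro rec) auto
    then show "uniformly_recurrent S" by (rule uniformly_recurrent_subset) auto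
  qed
  ultimately have "insert G R = R"
    using R unfolding is_rec_urc_def Let_def by blast
  then show ?thesis by blast
qed

lemma hull_controlled:
  assumes G: "G \<in> C_urc UNIV"
    and ctrl: "\<And>K \<epsilon>. compact K \<Longrightarrow> \<epsilon> > 0 \<Longrightarrow>
      \<exists>S K' \<epsilon>'. finite S \<and> S \<subseteq> R \<and> compact K' \<and> \<epsilon>' > 0 \<and> return_times S K' \<epsilon>' \<subseteq> return_times {G} K \<epsilon>"
  shows "G \<in> R"
proof (rule hull_insert[OF G])
  fix T assume T: "finite T" "T \<subseteq> R"
  show "uniformly_recurrent (insert G T)"
    unfolding uniformly_recurrent_def
  proof (intro allI impI)
    fix K :: "real set" and \<epsilon> :: real assume K: "compact K \<and> \<epsilon> > 0"
    obtain S K' \<epsilon>' where S: "finite S" "S \<subseteq> R" "compact K'" "\<epsilon>' > 0"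
      "return_times S K' \<epsilon>' \<subseteq> return_times {G} K \<epsilon>"
      using ctrl[OF conjunct1[OF K] conjunct2[OF K]] by (elim exE conjE) (rule that)
    have "relatively_dense (return_times (S \<union> T) (K \<union> K') (min \<epsilon> \<epsilon>'))"
      using hull_uniformly_recurrent[of "S \<union> T"] S T K
      by (auto simp: uniformly_recurrent_def compact_Un)
    moreover have "return_times (S \<union> T) (K \<union> K') (min \<epsilon> \<epsilon>') \<subseteq> return_times S K' \<epsilon>'"
      "return_times (S \<union> T) (K \<union> K') (min \<epsilon> \<epsilon>') \<subseteq> return_times T K \<epsilon>"
      by (intro return_times_mono; auto)+
    moreover have "return_times {G} K \<epsilon> \<inter> return_times T K \<epsilon> = return_times (insert G T) K \<epsilon>"
      using return_times_Un[of "{G}" T] by simp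
    ultimately show "relatively_dense (return_times (insert G T) K \<epsilon>)"
      using S(5) by (elim relatively_dense_mono) blast
  qed
qed

lemma hull_const: "(\<lambda>_. x) \<in> R"
proof (rule hull_controlled)
  show "(\<lambda>_. x) \<in> C_urc UNIV"
    by (auto simp: C_urc_iff uniformly_continuous_on_const intro!: exI[of _ "{x}"])
  show "\<exists>S K' \<epsilon>'. finite S \<and> S \<subseteq> R \<and> compact K' \<and> \<epsilon>' > 0 \<and> return_times S K' \<epsilon>' \<subseteq> return_times {\<lambda>_. x} K \<epsilon>"
    if "\<epsilon> > 0" for K \<epsilon>
    by (rule exI[of _ "{}"], rule exI[of _ "{}"], rule exI[of _ 1]) (use that in \<open>auto simp: return_times_def\<close>)
qed

lemma hull_add:
  assumes F: "F \<in> R" and G: "G \<in> R"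
  shows "(\<lambda>t. F t + G t) \<in> R"
proof (rule hull_controlled)
  obtain C D where C: "compact C" "range F \<subseteq> C" and D: "compact D" "range G \<subseteq> D"
    using hull_relatively_compact F G by meson
  have "compact {x + y |x y. x \<in> C \<and> y \<in> D}" using C D by (intro compact_sums)
  moreover have "range (\<lambda>t. F t + G t) \<subseteq> {x + y |x y. x \<in> C \<and> y \<in> D}" using C D by blast
  ultimately show "(\<lambda>t. F t + G t) \<in> C_urc UNIV"
    using F G hull_uniformly_continuous by (auto simp: C_urc_iff intro!: uniformly_continuous_on_add)
  show "\<exists>S K' \<epsilon>'. finite S \<and> S \<subseteq> R \<and> compact K' \<and> \<epsilon>' > 0 \<and> return_times S K' \<epsilon>' \<subseteq> return_times {\<lambda>t. F t + G t} K \<epsilon>"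
    if K: "compact K" "\<epsilon> > 0" for K \<epsilon>
  proof (rule exI[of _ "{F, G}"], rule exI[of _ K], rule exI[of _ "\<epsilon> / 2"], intro conjI)
    show "return_times {F, G} K (\<epsilon> / 2) \<subseteq> return_times {\<lambda>t. F t + G t} K \<epsilon>"
    proof (rule return_times_subsetI)
      fix \<tau> t assume *: "\<tau> \<in> return_times {F, G} K (\<epsilon> / 2)" "t \<in> K"
      have "norm (F (t + \<tau>) - F t) + norm (G (t + \<tau>) - G t) \<le> \<epsilon>"
        using return_timesD[OF *(1) _ *(2), of F] return_timesD[OF *(1) _ *(2), of G] by auto
      then show "norm (F (t + \<tau>) + G (t + \<tau>) - (F t + G t)) \<le> \<epsilon>"
        using norm_diff_triangle_ineq order_trans by blast
    qed
  qed (use F G K in auto)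
qed

lemma hull_bounded_linear:
  assumes F: "F \<in> R" and T: "bounded_linear T"
  shows "(\<lambda>t. T (F t)) \<in> R"
proof (rule hull_controlled)
  obtain C where C: "compact C" "range F \<subseteq> C" using hull_relatively_compact F by meson
  have "compact (T ` C)"
    using C(1) T by (intro compact_continuous_image linear_continuous_on)
  moreover have "range (\<lambda>t. T (F t)) \<subseteq> T ` C" using C(2) by blast
  moreover have "uniformly_continuous_on UNIV (\<lambda>t. T (F t))"
    using bounded_linear.uniformly_continuous_on[OF T hull_uniformly_continuous[OF F]] .
  ultimately show "(\<lambda>t. T (F t)) \<in> C_urc UNIV" by (auto simp: C_urc_iff)
  obtain B where B: "B > 0" "\<And>x. norm (T x) \<le> norm x * B"
    using bounded_linear.pos_bounded[OF T] by blast
  show "\<exists>S K' \<epsilon>'. finite S \<and> S \<subseteq> R \<and> compact K' \<and> \<epsilon>' > 0 \<and> return_times S K' \<epsilon>' \<subseteq> return_times {\<lambda>t. T (F t)} K \<epsilon>"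
    if K: "compact K" "\<epsilon> > 0" for K \<epsilon>
  proof (rule exI[of _ "{F}"], rule exI[of _ K], rule exI[of _ "\<epsilon> / B"], intro conjI)
    show "return_times {F} K (\<epsilon> / B) \<subseteq> return_times {\<lambda>t. T (F t)} K \<epsilon>"
    proof (rule return_times_subsetI)
      fix \<tau> t assume "\<tau> \<in> return_times {F} K (\<epsilon> / B)" "t \<in> K"
      then have "norm (F (t + \<tau>) - F t) \<le> \<epsilon> / B" by (simp add: return_timesD)
      then have "norm (F (t + \<tau>) - F t) * B \<le> \<epsilon>" using B(1) by (simp add: pos_le_divide_eq)
      then show "norm (T (F (t + \<tau>)) - T (F t)) \<le> \<epsilon>"
        using B(2)[of "F (t + \<tau>) - F t"] T by (simp add: linear_diff bounded_linear.linear)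
    qed
  qed (use F K B in auto)
qed

lemma hull_shift:
  assumes F: "F \<in> R"
  shows "(\<lambda>t. F (t + h)) \<in> R"
proof (rule hull_controlled)
  obtain C where C: "compact C" "range F \<subseteq> C" using hull_relatively_compact F by meson
  have "uniformly_continuous_on UNIV (\<lambda>t. F (t + h))"
    unfolding uniformly_continuous_on_def
  proof (intro allI impI)
    fix e :: real assume "e > 0"
    then obtain d where "d > 0" "\<And>x y. dist y x < d \<Longrightarrow> dist (F y) (F x) < e"
      using hull_uniformly_continuous[OF F] unfolding uniformly_continuous_on_def by (metis UNIV_I)
    then show "\<exists>d>0. \<forall>x\<in>UNIV. \<forall>x'\<in>UNIV. dist x' x < d \<longrightarrow> dist (F (x' + h)) (F (x + h)) < e"
      by (intro exI[of _ d]) (simp add: dist_norm)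
  qed
  then show "(\<lambda>t. F (t + h)) \<in> C_urc UNIV"
    using C by (auto simp: C_urc_iff)
  show "\<exists>S K' \<epsilon>'. finite S \<and> S \<subseteq> R \<and> compact K' \<and> \<epsilon>' > 0 \<and> return_times S K' \<epsilon>' \<subseteq> return_times {\<lambda>t. F (t + h)} K \<epsilon>"
    if K: "compact K" "\<epsilon> > 0" for K \<epsilon>
  proof (rule exI[of _ "{F}"], rule exI[of _ "(\<lambda>t. t + h) ` K"], rule exI[of _ \<epsilon>], intro conjI)
    show "compact ((\<lambda>t. t + h) ` K)"
      by (intro compact_continuous_image continuous_intros K)
    show "return_times {F} ((\<lambda>t. t + h) ` K) \<epsilon> \<subseteq> return_times {\<lambda>t. F (t + h)} K \<epsilon>"
      by (auto simp: return_times_def algebra_simps)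
  qed (use F K in auto)
qed

text \<open>A common return time moves any point of the line into the half line and changes both values little.\<close>

lemma hull_bound_on_half_line:
  assumes F: "F \<in> R" and G: "G \<in> R" and le: "\<And>t. t \<ge> \<alpha> \<Longrightarrow> norm (F t - G t) \<le> c"
  shows "norm (F t - G t) \<le> c"
proof (rule field_le_epsilon)
  fix e :: real assume "e > 0"
  have "relatively_dense (return_times {F, G} {t} (e / 2))"
    using hull_uniformly_recurrent[of "{F, G}"] F G \<open>e > 0\<close> by (auto simp: uniformly_recurrent_def)
  then obtain r where r: "\<And>s. \<exists>\<tau>\<in>return_times {F, G} {t} (e / 2). \<bar>\<tau> - s\<bar> \<le> r"
    unfolding relatively_dense_iff by blast
  obtain \<tau> where \<tau>: "\<tau> \<in> return_times {F, G} {t} (e / 2)" "\<bar>\<tau> - (\<alpha> - t + r)\<bar> \<le> r"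
    using r by blast
  then have "t + \<tau> \<ge> \<alpha>" by linarith
  then have "norm (F (t + \<tau>) - G (t + \<tau>)) \<le> c" by (rule le)
  moreover have "norm (F (t + \<tau>) - F t) \<le> e / 2" "norm (G (t + \<tau>) - G t) \<le> e / 2"
    using \<tau>(1) by (auto simp: return_times_def)
  ultimately show "norm (F t - G t) \<le> c + e"
    using norm_diff_le_displaced[of "F t" "G t" "F (t + \<tau>)" "G (t + \<tau>)"] by linarith
qed

lemma hull_uniform_limit:
  assumes lim: "\<And>e. e > 0 \<Longrightarrow> \<exists>F\<in>R. \<forall>t. norm (G t - F t) \<le> e"
  shows "G \<in> R"
proof (rule hull_controlled)
  show "G \<in> C_urc UNIV"
    by (rule C_urc_uniform_limit) (use lim hull_C_urc in blast)
  show "\<exists>S K' \<epsilon>'. finite S \<and> S \<subseteq> R \<and> compact K' \<and> \<epsilon>' > 0 \<and> return_times S K' \<epsilon>' \<subseteq> return_times {G} K \<epsilon>"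
    if K: "compact K" "\<epsilon> > 0" for K \<epsilon>
  proof -
    obtain F where F: "F \<in> R" "\<And>t. norm (G t - F t) \<le> \<epsilon> / 3" using lim[of "\<epsilon> / 3"] K by auto
    have "return_times {F} K (\<epsilon> / 3) \<subseteq> return_times {G} K \<epsilon>"
    proof (rule return_times_subsetI)
      fix \<tau> t assume *: "\<tau> \<in> return_times {F} K (\<epsilon> / 3)" "t \<in> K"
      have "norm (G (t + \<tau>) - G t) \<le> norm (G (t + \<tau>) - F (t + \<tau>)) + norm (F (t + \<tau>) - F t) + norm (G t - F t)"
        using norm_diff_le_displaced[of "G (t + \<tau>)" "G t" "F (t + \<tau>)" "F t"] by (simp add: norm_minus_commute)
      then show "norm (G (t + \<tau>) - G t) \<le> \<epsilon>"
        using F(2)[of t] F(2)[of "t + \<tau>"] return_timesD[OF *(1) _ *(2), of F] by simp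
    qed
    then show ?thesis using F K by (intro exI[of _ "{F}"] exI[of _ K] exI[of _ "\<epsilon> / 3"] conjI) auto
  qed
qed

text \<open>A sequence in \<open>R\<close> that converges uniformly on the half line is uniformly Cauchy on the whole line, by
\<open>hull_bound_on_half_line\<close>.\<close>

lemma hull_uniform_limit_on_half_line:
  assumes lim: "\<And>e. e > 0 \<Longrightarrow> \<exists>F\<in>R. \<forall>t\<ge>\<alpha>. norm (G t - F t) \<le> e"
  shows "\<exists>F\<in>R. \<forall>t\<ge>\<alpha>. G t = F t"
proof -
  have "\<exists>F\<in>R. \<forall>t\<ge>\<alpha>. norm (G t - F t) \<le> 1 / Suc n" for n by (rule lim) simp
  then obtain F where F: "\<And>n. F n \<in> R" "\<And>n t. t \<ge> \<alpha> \<Longrightarrow> norm (G t - F n t) \<le> 1 / Suc n"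
    by metis
  have diff: "norm (F m t - F n t) \<le> 1 / Suc m + 1 / Suc n" for m n t
  proof (rule hull_bound_on_half_line[OF F(1) F(1), where \<alpha> = \<alpha>])
    fix t assume "t \<ge> \<alpha>"
    then show "norm (F m t - F n t) \<le> 1 / Suc m + 1 / Suc n"
      using F(2)[of t m] F(2)[of t n] norm_triangle_ineq4[of "G t - F n t" "G t - F m t"] by simp
  qed
  have small: "\<exists>N. \<forall>n\<ge>N. 1 / real (Suc n) < e" if "e > 0" for e :: real
  proof -
    obtain N where N: "1 / real (Suc N) < e" by (rule nat_approx_posE[OF \<open>e > 0\<close>])
    have "1 / real (Suc n) < e" if "n \<ge> N" for n
    proof -
      have "1 / real (Suc n) \<le> 1 / Suc N" using that by (intro divide_left_mono) auto
      then show ?thesis using N by linarith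
    qed
    then show ?thesis by blast
  qed
  have "Cauchy (\<lambda>n. F n t)" for t
  proof (rule metric_CauchyI)
    fix e :: real assume "e > 0"
    then obtain N where N: "\<And>n. n \<ge> N \<Longrightarrow> 1 / real (Suc n) < e / 2" using small[of "e / 2"] by auto
    have "dist (F m t) (F n t) < e" if "m \<ge> N" "n \<ge> N" for m n
      using diff[of m t n] N[OF that(1)] N[OF that(2)] unfolding dist_norm by linarith
    then show "\<exists>M. \<forall>m\<ge>M. \<forall>n\<ge>M. dist (F m t) (F n t) < e" by blast
  qed
  then have "\<exists>l. (\<lambda>n. F n t) \<longlonglongrightarrow> l" for t using Cauchy_convergent_iff convergent_def by blast
  then obtain H where H: "\<And>t. (\<lambda>n. F n t) \<longlonglongrightarrow> H t" by metis
  have HF: "norm (H t - F n t) \<le> 2 / Suc n" for t n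
  proof (rule Lim_norm_ubound[OF sequentially_bot])
    show "(\<lambda>m. F m t - F n t) \<longlonglongrightarrow> H t - F n t" by (intro tendsto_intros H)
    have "norm (F m t - F n t) \<le> 2 / Suc n" if "m \<ge> n" for m
    proof -
      have "1 / real (Suc m) \<le> 1 / Suc n" using that by (intro divide_left_mono) auto
      then show ?thesis using diff[of m t n] by simp
    qed
    then show "\<forall>\<^sub>F m in sequentially. norm (F m t - F n t) \<le> 2 / Suc n"
      unfolding eventually_sequentially by blast
  qed
  have "H \<in> R"
  proof (rule hull_uniform_limit)
    fix e :: real assume "e > 0"
    then obtain n where "1 / real (Suc n) < e / 2" using small[of "e / 2"] by auto
    then have "norm (H t - F n t) \<le> e" for t using HF[of t n] by simp
    then show "\<exists>F\<in>R. \<forall>t. norm (H t - F t) \<le> e" using F(1) by blast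
  qed
  moreover have "G t = H t" if "t \<ge> \<alpha>" for t
  proof (rule LIMSEQ_unique[OF _ H])
    have "(\<lambda>n. F n t - G t) \<longlonglongrightarrow> 0"
    proof (rule Lim_null_comparison)
      show "(\<lambda>n. 1 / real (Suc n)) \<longlonglongrightarrow> 0" using LIMSEQ_inverse_real_of_nat by (simp add: inverse_eq_divide)
      show "\<forall>\<^sub>F n in sequentially. norm (F n t - G t) \<le> 1 / real (Suc n)"
        using F(2)[OF that] by (simp add: norm_minus_commute)
    qed
    then show "(\<lambda>n. F n t) \<longlonglongrightarrow> G t" by (simp add: LIM_zero_iff)
  qed
  ultimately show ?thesis by blast
qed

end

section \<open>Rotations and joint recurrence\<close>

lemma \<gamma>_add: "\<gamma> \<omega> (s + t) = \<gamma> \<omega> s * \<gamma> \<omega> t"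
  by (simp add: \<gamma>_def exp_add[symmetric] algebra_simps)

lemma \<gamma>_0 [simp]: "\<gamma> \<omega> 0 = 1"
  by (simp add: \<gamma>_def)

lemma norm_\<gamma> [simp]: "norm (\<gamma> \<omega> t) = 1"
  by (simp add: \<gamma>_def)

lemma \<gamma>_uminus: "\<gamma> (- \<omega>) t * \<gamma> \<omega> t = 1" "\<gamma> \<omega> t * \<gamma> (- \<omega>) t = 1"
  by (simp_all add: \<gamma>_def exp_add[symmetric])

lemma \<gamma>_has_vector_derivative: "(\<gamma> \<omega> has_vector_derivative (\<i> * of_real \<omega>) * \<gamma> \<omega> t) (at t within S)"
proof -
  have "((\<lambda>t. exp (t *\<^sub>R (\<i> * of_real \<omega>))) has_vector_derivative exp (t *\<^sub>R (\<i> * of_real \<omega>)) * (\<i> * of_real \<omega>)) (at t within S)"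
    by (rule exp_scaleR_has_vector_derivative_right)
  moreover have "(\<lambda>t. exp (t *\<^sub>R (\<i> * of_real \<omega>))) = \<gamma> \<omega>"
    by (auto simp: \<gamma>_def scaleR_conv_of_real algebra_simps)
  ultimately show ?thesis by (metis mult.commute)
qed

lemma continuous_on_\<gamma>: "continuous_on S (\<gamma> \<omega>)"
  unfolding \<gamma>_def by (intro continuous_intros)

lemma \<gamma>_Lipschitz: "norm (\<gamma> \<omega> s - \<gamma> \<omega> t) \<le> \<bar>\<omega>\<bar> * \<bar>s - t\<bar>"
proof -
  have "norm (\<gamma> \<omega> s - \<gamma> \<omega> t) \<le> \<bar>\<omega>\<bar> * norm (s - t)"
  proof (rule differentiable_bound[of UNIV "\<gamma> \<omega>" "\<lambda>u h. h *\<^sub>R ((\<i> * of_real \<omega>) * \<gamma> \<omega> u)"])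
    fix u :: real
    show "(\<gamma> \<omega> has_derivative (\<lambda>h. h *\<^sub>R ((\<i> * of_real \<omega>) * \<gamma> \<omega> u))) (at u within UNIV)"
      using \<gamma>_has_vector_derivative[of \<omega> u UNIV] by (simp add: has_vector_derivative_def)
    show "onorm (\<lambda>h. h *\<^sub>R ((\<i> * of_real \<omega>) * \<gamma> \<omega> u)) \<le> \<bar>\<omega>\<bar>"
      by (intro onorm_bound) (auto simp: norm_mult)
  qed auto
  then show ?thesis by simp
qed

text \<open>The second return must be good on the translated set: this is the non-uniformity behind every argument
that composes return times.\<close>

lemma return_times_add:
  assumes "\<tau> \<in> return_times S K \<delta>" "\<tau>' \<in> return_times S ((\<lambda>t. t + \<tau>) ` K) \<delta>'"
  shows "\<tau> + \<tau>' \<in> return_times S K (\<delta> + \<delta>')"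
  unfolding return_times_def
proof (intro CollectI ballI)
  fix F t assume F: "F \<in> S" "t \<in> K"
  have "norm (F (t + \<tau>) - F t) \<le> \<delta>" by (rule return_timesD[OF assms(1) F])
  moreover have "norm (F ((t + \<tau>) + \<tau>') - F (t + \<tau>)) \<le> \<delta>'"
    by (rule return_timesD[OF assms(2) F(1)]) (use F in blast)
  ultimately show "norm (F (t + (\<tau> + \<tau>')) - F t) \<le> \<delta> + \<delta>'"
    using norm_triangle_ineq[of "F ((t + \<tau>) + \<tau>') - F (t + \<tau>)" "F (t + \<tau>) - F t"]
    by (simp add: add.assoc)
qed

lemma compact_shift_image: "compact K \<Longrightarrow> compact ((\<lambda>t::real. t + h) ` K)"
  by (intro compact_continuous_image continuous_intros)

lemma norm_prod_diff_le:
  fixes a b c d :: complex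
  assumes "norm a \<le> 1" "norm d \<le> 1"
  shows "norm (a * b - c * d) \<le> norm (a - c) + norm (b - d)"
proof -
  have "a * b - c * d = a * (b - d) + (a - c) * d" by (simp add: algebra_simps)
  also have "norm \<dots> \<le> norm a * norm (b - d) + norm (a - c) * norm d"
    by (rule norm_triangle_le) (simp add: norm_mult)
  also have "\<dots> \<le> 1 * norm (b - d) + norm (a - c) * 1"
    using assms by (intro add_mono mult_mono) auto
  finally show ?thesis by simp
qed

text \<open>Two late members of a convergent subsequence of the powers of \<open>d\<close> differ by a factor close to 1.\<close>

lemma power_near_inverse:
  fixes d :: complex
  assumes d: "norm d = 1" and e: "e > 0"
  obtains n where "norm (d * d ^ n - 1) < e"
proof -
  have "\<forall>k. d ^ k \<in> sphere 0 1" using d by (simp add: norm_power)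
  then obtain l r where r: "strict_mono (r :: nat \<Rightarrow> nat)" "((\<lambda>k. d ^ k) \<circ> r) \<longlonglongrightarrow> l"
    using compact_sphere[of "0::complex" 1] unfolding compact_def by metis
  then have "Cauchy ((\<lambda>k. d ^ k) \<circ> r)" by (rule_tac LIMSEQ_imp_Cauchy)
  then obtain N where N: "\<And>m n. m \<ge> N \<Longrightarrow> n \<ge> N \<Longrightarrow> dist (d ^ r m) (d ^ r n) < e"
    using e unfolding Cauchy_def o_def by metis
  define k where "k = r (Suc N) - r N"
  have rr: "r N < r (Suc N)" using r(1) by (simp add: strict_mono_Suc_iff)
  then have k: "r (Suc N) = r N + k" "k > 0" by (auto simp: k_def)
  have "d ^ r (Suc N) - d ^ r N = d ^ r N * (d ^ k - 1)" by (simp add: k(1) power_add algebra_simps)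
  then have "norm (d ^ k - 1) < e"
    using N[of "Suc N" N] d by (simp add: dist_norm norm_mult norm_power)
  moreover have "d * d ^ (k - 1) = d ^ k" using k(2) by (simp add: power_eq_if)
  ultimately show ?thesis using that[of "k - 1"] by simp
qed

text \<open>Call \<open>d\<close> good if arbitrarily accurate returns with phase close to \<open>d\<close> exist. Good numbers are closed
under multiplication, so an approximate inverse of a good \<open>d\<close> is good as well. Near a good \<open>d\<close>, one fixed
additional return \<open>v\<close> therefore corrects the phase of every sufficiently accurate return; near any
other \<open>d\<close> there are no such returns. By compactness of the circle finitely many corrections suffice,
so the corrected returns are still relatively dense.\<close>

lemma return_times_with_phase:
  assumes S: "uniformly_recurrent S" and K: "compact K" and e: "\<epsilon> > 0"
  shows "relatively_dense {\<tau> \<in> return_times S K \<epsilon>. norm (\<gamma> \<omega> \<tau> - 1) \<le> \<epsilon>}"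
proof -
  define good where "good d \<longleftrightarrow> (\<forall>K \<delta>. compact K \<and> \<delta> > 0 \<longrightarrow> (\<exists>\<tau>\<in>return_times S K \<delta>. norm (\<gamma> \<omega> \<tau> - d) < \<delta>))" for d
  have good_mult: "good (d * d')" if d: "good d" "good d'" "norm d = 1" "norm d' = 1" for d d'
    unfolding good_def
  proof (intro allI impI)
    fix K :: "real set" and \<delta> :: real assume K: "compact K \<and> \<delta> > 0"
    then have \<delta>: "\<delta> / 2 > 0" by simp
    obtain \<tau> where \<tau>: "\<tau> \<in> return_times S K (\<delta> / 2)" "norm (\<gamma> \<omega> \<tau> - d) < \<delta> / 2"
      using d(1) K \<delta> unfolding good_def by blast
    obtain \<tau>' where \<tau>': "\<tau>' \<in> return_times S ((\<lambda>t. t + \<tau>) ` K) (\<delta> / 2)" "norm (\<gamma> \<omega> \<tau>' - d') < \<delta> / 2"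
      using d(2) K \<delta> compact_shift_image unfolding good_def by blast
    have "\<tau> + \<tau>' \<in> return_times S K \<delta>" using return_times_add[OF \<tau>(1) \<tau>'(1)] by simp
    moreover have "norm (\<gamma> \<omega> (\<tau> + \<tau>') - d * d') < \<delta>"
      using norm_prod_diff_le[of "\<gamma> \<omega> \<tau>" d' "\<gamma> \<omega> \<tau>'" d] d(3,4) \<tau>(2) \<tau>'(2) by (simp add: \<gamma>_add)
    ultimately show "\<exists>\<tau>\<in>return_times S K \<delta>. norm (\<gamma> \<omega> \<tau> - d * d') < \<delta>" by blast
  qed
  have good_power: "good (d ^ n)" if d: "good d" "norm d = 1" for d n
  proof (induction n)
    case 0
    show ?case
      unfolding good_def
    proof (intro allI impI)
      fix K :: "real set" and \<delta> :: real assume "compact K \<and> \<delta> > 0"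
      then show "\<exists>\<tau>\<in>return_times S K \<delta>. norm (\<gamma> \<omega> \<tau> - d ^ 0) < \<delta>"
        by (intro bexI[of _ 0]) (auto simp: return_times_def)
    qed
  next
    case (Suc n)
    then show ?case using good_mult[OF d(1) Suc d(2)] d(2) by (simp add: norm_power)
  qed
  have local: "\<exists>\<delta> K' v. \<delta> > 0 \<and> compact K' \<and> (\<forall>\<tau>\<in>return_times S K' \<delta>. norm (\<gamma> \<omega> \<tau> - d) < \<delta> \<longrightarrow>
      \<tau> + v \<in> return_times S K \<epsilon> \<and> norm (\<gamma> \<omega> (\<tau> + v) - 1) \<le> \<epsilon>)" if d: "norm d = 1" for d
  proof (cases "good d")
    case False
    then obtain K' \<delta> where K': "compact K'" "\<delta> > 0" "\<not> (\<exists>\<tau>\<in>return_times S K' \<delta>. norm (\<gamma> \<omega> \<tau> - d) < \<delta>)"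
      unfolding good_def by blast
    then show ?thesis by (intro exI[of _ \<delta>] exI[of _ K'] exI[of _ 0]) blast
  next
    case True
    have e3: "\<epsilon> / 3 > 0" using e by simp
    obtain n where n: "norm (d * d ^ n - 1) < \<epsilon> / 3" by (rule power_near_inverse[OF d e3])
    obtain v where v: "v \<in> return_times S K (\<epsilon> / 3)" "norm (\<gamma> \<omega> v - d ^ n) < \<epsilon> / 3"
      using good_power[OF True d, of n] K e3 unfolding good_def by blast
    have main: "\<tau> + v \<in> return_times S K \<epsilon> \<and> norm (\<gamma> \<omega> (\<tau> + v) - 1) \<le> \<epsilon>"
      if \<tau>: "\<tau> \<in> return_times S ((\<lambda>t. t + v) ` K) (\<epsilon> / 3)" "norm (\<gamma> \<omega> \<tau> - d) < \<epsilon> / 3" for \<tau>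
    proof
      have "v + \<tau> \<in> return_times S K (\<epsilon> / 3 + \<epsilon> / 3)" by (rule return_times_add[OF v(1) \<tau>(1)])
      moreover have "return_times S K (\<epsilon> / 3 + \<epsilon> / 3) \<subseteq> return_times S K \<epsilon>"
        using e by (intro return_times_mono) auto
      ultimately show "\<tau> + v \<in> return_times S K \<epsilon>" by (auto simp: add.commute)
      have "norm (\<gamma> \<omega> (\<tau> + v) - d * d ^ n) \<le> norm (\<gamma> \<omega> \<tau> - d) + norm (\<gamma> \<omega> v - d ^ n)"
        unfolding \<gamma>_add by (rule norm_prod_diff_le) (use d in \<open>auto simp: norm_power\<close>)
      then show "norm (\<gamma> \<omega> (\<tau> + v) - 1) \<le> \<epsilon>"
        using norm_triangle_ineq[of "\<gamma> \<omega> (\<tau> + v) - d * d ^ n" "d * d ^ n - 1"] n v(2) \<tau>(2) by simp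
    qed
    show ?thesis
      by (intro exI[of _ "\<epsilon> / 3"] exI[of _ "(\<lambda>t. t + v) ` K"] exI[of _ v]
          conjI[OF e3] conjI[OF compact_shift_image[OF K, of v]] ballI impI main)
  qed
  then obtain \<delta> K' v where loc: "\<And>d. norm d = 1 \<Longrightarrow> \<delta> d > 0" "\<And>d. norm d = 1 \<Longrightarrow> compact (K' d)"
    "\<And>d \<tau>. norm d = 1 \<Longrightarrow> \<tau> \<in> return_times S (K' d) (\<delta> d) \<Longrightarrow> norm (\<gamma> \<omega> \<tau> - d) < \<delta> d \<Longrightarrow>
      \<tau> + v d \<in> return_times S K \<epsilon> \<and> norm (\<gamma> \<omega> (\<tau> + v d) - 1) \<le> \<epsilon>"
    by metis
  have "sphere 0 1 \<subseteq> (\<Union>d\<in>sphere 0 1. ball d (\<delta> d))"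
    using loc(1) by (auto intro!: bexI)
  then obtain D where D: "finite D" "D \<subseteq> sphere 0 1" "sphere 0 1 \<subseteq> (\<Union>d\<in>D. ball d (\<delta> d))"
    using compactE_image[OF compact_sphere, of "sphere 0 1" "\<lambda>d. ball d (\<delta> d)" "0::complex" 1]
    by (metis open_ball)
  have "D \<noteq> {}" using D(3) by (metis UN_empty empty_iff mem_sphere_0 norm_one subset_empty)
  define \<delta>0 where "\<delta>0 = Min (\<delta> ` D)"
  define K0 where "K0 = (\<Union>d\<in>D. K' d)"
  have \<delta>0: "\<delta>0 > 0" unfolding \<delta>0_def using D loc(1) \<open>D \<noteq> {}\<close> by (subst Min_gr_iff) auto
  have K0: "compact K0" unfolding K0_def using D loc(2) by (intro compact_UN) auto
  obtain r where r: "\<And>s. \<exists>\<tau>\<in>return_times S K0 \<delta>0. \<bar>\<tau> - s\<bar> \<le> r"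
    using S K0 \<delta>0 unfolding uniformly_recurrent_def relatively_dense_iff by blast
  obtain M where M: "\<And>d. d \<in> D \<Longrightarrow> \<bar>v d\<bar> \<le> M"
    using finite_imp_bounded[of "v ` D"] D(1) by (auto simp: bounded_iff)
  show ?thesis
    unfolding relatively_dense_iff
  proof (intro exI allI)
    fix s
    obtain \<tau> where \<tau>: "\<tau> \<in> return_times S K0 \<delta>0" "\<bar>\<tau> - s\<bar> \<le> r" using r by blast
    have "\<gamma> \<omega> \<tau> \<in> (\<Union>d\<in>D. ball d (\<delta> d))" by (rule subsetD[OF D(3)]) simp
    then obtain d where d: "d \<in> D" "norm (\<gamma> \<omega> \<tau> - d) < \<delta> d"
      by (auto simp: dist_norm norm_minus_commute)
    have nd: "norm d = 1" using d(1) D(2) by auto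
    have "return_times S K0 \<delta>0 \<subseteq> return_times S (K' d) (\<delta> d)"
      using d(1) D(1) by (intro return_times_mono) (auto simp: K0_def \<delta>0_def)
    then have "\<tau> + v d \<in> {\<tau> \<in> return_times S K \<epsilon>. norm (\<gamma> \<omega> \<tau> - 1) \<le> \<epsilon>}"
      using loc(3)[OF nd subsetD[OF _ \<tau>(1)] d(2)] by simp
    moreover have "\<bar>\<tau> + v d - s\<bar> \<le> r + M" using \<tau>(2) M[OF d(1)] by linarith
    ultimately show "\<exists>\<tau>\<in>{\<tau> \<in> return_times S K \<epsilon>. norm (\<gamma> \<omega> \<tau> - 1) \<le> \<epsilon>}. \<bar>\<tau> - s\<bar> \<le> r + M" by blast
  qed
qed

lemma hull_\<gamma>:
  fixes V R :: "(real \<Rightarrow> 'a::complex_banach) set"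
  assumes R: "is_rec_urc V R" and F: "F \<in> R"
  shows "(\<lambda>t. \<gamma> \<omega> t *\<^sub>C F t) \<in> R"
proof (rule hull_insert[OF R])
  obtain B where B: "B > 0" "\<And>t. norm (F t) \<le> B" using hull_bounded[OF R F] by blast
  obtain C where C: "compact C" "range F \<subseteq> C" using hull_relatively_compact[OF R F] by blast
  have "compact ((\<lambda>z. fst z *\<^sub>C snd z) ` (sphere 0 1 \<times> C))"
    by (intro compact_continuous_image compact_Times compact_sphere C scaleC.continuous_on continuous_intros)
  moreover have "range (\<lambda>t. \<gamma> \<omega> t *\<^sub>C F t) \<subseteq> (\<lambda>z. fst z *\<^sub>C snd z) ` (sphere 0 1 \<times> C)"
  proof (rule image_subsetI)
    fix t show "\<gamma> \<omega> t *\<^sub>C F t \<in> (\<lambda>z. fst z *\<^sub>C snd z) ` (sphere 0 1 \<times> C)"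
      using C(2) by (intro image_eqI[of _ _ "(\<gamma> \<omega> t, F t)"]) auto
  qed
  moreover have "uniformly_continuous_on UNIV (\<lambda>t. \<gamma> \<omega> t *\<^sub>C F t)"
    unfolding uniformly_continuous_on_def
  proof (intro allI impI)
    fix e :: real assume e: "e > 0"
    obtain d where d: "d > 0" "\<And>x y. dist y x < d \<Longrightarrow> dist (F y) (F x) < e / 2"
      using hull_uniformly_continuous[OF R F] e unfolding uniformly_continuous_on_def
      by (metis UNIV_I half_gt_zero)
    define w where "w = B * (\<bar>\<omega>\<bar> + 1)"
    have w: "w > 0" using B(1) by (simp add: w_def add_nonneg_pos)
    define d' where "d' = min d (e / 2 / w)"
    have d': "d' > 0" using d e w by (simp add: d'_def)
    have "dist (\<gamma> \<omega> y *\<^sub>C F y) (\<gamma> \<omega> x *\<^sub>C F x) < e" if xy: "dist y x < d'" for x y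
    proof -
      have "\<gamma> \<omega> y *\<^sub>C F y - \<gamma> \<omega> x *\<^sub>C F x = \<gamma> \<omega> y *\<^sub>C (F y - F x) + (\<gamma> \<omega> y - \<gamma> \<omega> x) *\<^sub>C F x"
        by (simp add: scaleC.diff_left scaleC.diff_right)
      then have "norm (\<gamma> \<omega> y *\<^sub>C F y - \<gamma> \<omega> x *\<^sub>C F x) \<le> norm (F y - F x) + norm (\<gamma> \<omega> y - \<gamma> \<omega> x) * norm (F x)"
        using norm_triangle_ineq[of "\<gamma> \<omega> y *\<^sub>C (F y - F x)" "(\<gamma> \<omega> y - \<gamma> \<omega> x) *\<^sub>C F x"]
        by (simp add: norm_scaleC)
      also have "norm (F y - F x) < e / 2" using d(2)[of y x] xy by (simp add: d'_def dist_norm)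
      also have "norm (\<gamma> \<omega> y - \<gamma> \<omega> x) * norm (F x) \<le> ((\<bar>\<omega>\<bar> + 1) * \<bar>y - x\<bar>) * B"
        using \<gamma>_Lipschitz[of \<omega> y x] B by (intro mult_mono) (auto intro: order_trans mult_right_mono simp: algebra_simps)
      also have "\<dots> = w * \<bar>y - x\<bar>" by (simp add: w_def)
      also have "\<dots> \<le> w * (e / 2 / w)"
        using xy w by (intro mult_left_mono) (auto simp: d'_def dist_real_def)
      also have "\<dots> = e / 2" using w by simp
      finally show ?thesis by (simp add: dist_norm)
    qed
    then show "\<exists>d>0. \<forall>x\<in>UNIV. \<forall>x'\<in>UNIV. dist x' x < d \<longrightarrow> dist (\<gamma> \<omega> x' *\<^sub>C F x') (\<gamma> \<omega> x *\<^sub>C F x) < e"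
      using d' by blast
  qed
  ultimately show "(\<lambda>t. \<gamma> \<omega> t *\<^sub>C F t) \<in> C_urc UNIV" by (auto simp: C_urc_iff)
  fix S assume S: "finite S" "S \<subseteq> R"
  show "uniformly_recurrent (insert (\<lambda>t. \<gamma> \<omega> t *\<^sub>C F t) S)"
    unfolding uniformly_recurrent_def
  proof (intro allI impI)
    fix K :: "real set" and \<epsilon> :: real assume K: "compact K \<and> \<epsilon> > 0"
    define \<delta> where "\<delta> = \<epsilon> / (B + 1)"
    have \<delta>: "\<delta> > 0" "\<delta> \<le> \<epsilon>"
      using K B(1) by (auto simp: \<delta>_def field_simps)
    have "\<delta> * (B + 1) = \<epsilon>" using B(1) by (simp add: \<delta>_def)
    then have \<delta>B: "\<delta> * B + \<delta> \<le> \<epsilon>" by (simp add: algebra_simps)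
    have "uniformly_recurrent (insert F S)"
      using F S by (intro hull_uniformly_recurrent[OF R]) auto
    then have "relatively_dense {\<tau> \<in> return_times (insert F S) K \<delta>. norm (\<gamma> \<omega> \<tau> - 1) \<le> \<delta>}"
      using K \<delta>(1) by (intro return_times_with_phase) auto
    moreover have "{\<tau> \<in> return_times (insert F S) K \<delta>. norm (\<gamma> \<omega> \<tau> - 1) \<le> \<delta>}
      \<subseteq> return_times (insert (\<lambda>t. \<gamma> \<omega> t *\<^sub>C F t) S) K \<epsilon>"
    proof
      fix \<tau> assume "\<tau> \<in> {\<tau> \<in> return_times (insert F S) K \<delta>. norm (\<gamma> \<omega> \<tau> - 1) \<le> \<delta>}"
      then have \<tau>: "\<tau> \<in> return_times (insert F S) K \<delta>" "norm (\<gamma> \<omega> \<tau> - 1) \<le> \<delta>" by auto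
      have "norm (G (t + \<tau>) - G t) \<le> \<epsilon>" if "G \<in> S" "t \<in> K" for G t
        using return_timesD[OF \<tau>(1), of G t] that \<delta>(2) by auto
      moreover have "norm (\<gamma> \<omega> (t + \<tau>) *\<^sub>C F (t + \<tau>) - \<gamma> \<omega> t *\<^sub>C F t) \<le> \<epsilon>" if t: "t \<in> K" for t
      proof -
        have "\<gamma> \<omega> (t + \<tau>) *\<^sub>C F (t + \<tau>) - \<gamma> \<omega> t *\<^sub>C F t =
            \<gamma> \<omega> t *\<^sub>C ((\<gamma> \<omega> \<tau> - 1) *\<^sub>C F (t + \<tau>) + (F (t + \<tau>) - F t))"
          by (simp add: \<gamma>_add scaleC.diff_left scaleC.diff_right scaleC.add_right scaleC_scaleC)
        also have "norm \<dots> \<le> norm (\<gamma> \<omega> \<tau> - 1) * norm (F (t + \<tau>)) + norm (F (t + \<tau>) - F t)"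
          using norm_triangle_ineq[of "(\<gamma> \<omega> \<tau> - 1) *\<^sub>C F (t + \<tau>)" "F (t + \<tau>) - F t"] by (simp add: norm_scaleC)
        also have "\<dots> \<le> \<delta> * B + \<delta>"
          using \<tau>(2) B \<delta>(1) return_timesD[OF \<tau>(1), of F t] t by (intro add_mono mult_mono) auto
        finally show ?thesis using \<delta>B by simp
      qed
      ultimately show "\<tau> \<in> return_times (insert (\<lambda>t. \<gamma> \<omega> t *\<^sub>C F t) S) K \<epsilon>"
        by (auto simp: return_times_def)
    qed
    ultimately show "relatively_dense (return_times (insert (\<lambda>t. \<gamma> \<omega> t *\<^sub>C F t) S) K \<epsilon>)"
      by (rule relatively_dense_mono)
  qed
qed

section \<open>Classes of functions on a half line\<close>

text \<open>The properties of \<open>\<A>\<close> on which the analysis rests. Here \<open>A f\<close> expresses that \<open>f\<close> agrees with a member of \<open>\<A>\<close>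
to the right of \<open>\<alpha>\<close>; its values elsewhere are irrelevant, which avoids restrictions in terms.\<close>

locale half_line_class =
  fixes \<alpha> :: real and A :: "(real \<Rightarrow> 'a::complex_banach) \<Rightarrow> bool"
  assumes cong: "A f \<Longrightarrow> (\<And>t. t \<ge> \<alpha> \<Longrightarrow> f t = g t) \<Longrightarrow> A g"
    and const: "A (\<lambda>_. x)"
    and add: "A f \<Longrightarrow> A g \<Longrightarrow> A (\<lambda>t. f t + g t)"
    and scaleC: "A f \<Longrightarrow> A (\<lambda>t. c *\<^sub>C f t)"
    and shift: "A f \<Longrightarrow> h \<ge> 0 \<Longrightarrow> A (\<lambda>t. f (t + h))"
    and rotate: "A f \<Longrightarrow> A (\<lambda>t. \<gamma> \<omega> t *\<^sub>C f t)"
    and limit: "(\<And>e. e > 0 \<Longrightarrow> \<exists>g. A g \<and> (\<forall>t\<ge>\<alpha>. norm (f t - g t) \<le> e)) \<Longrightarrow> A f"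
    and uniformly_continuous: "A f \<Longrightarrow> uniformly_continuous_on {\<alpha>..} f"
    and bounded: "A f \<Longrightarrow> \<exists>B. \<forall>t\<ge>\<alpha>. norm (f t) \<le> B"
begin

lemma scaleR: "A f \<Longrightarrow> A (\<lambda>t. c *\<^sub>R f t)"
  using scaleC[of f "of_real c"] by (simp add: scaleC_of_real)

lemma sum: "(\<And>i. i \<in> I \<Longrightarrow> A (f i)) \<Longrightarrow> A (\<lambda>t. \<Sum>i\<in>I. f i t)"
  by (induction I rule: infinite_finite_induct) (simp_all add: const add)

text \<open>Riemann sums in the parameter are members, and by equicontinuity they converge uniformly on the half
line.\<close>

lemma integral_of_members:
  fixes h :: real and \<Phi> :: "real \<Rightarrow> real \<Rightarrow> 'a"
  assumes h: "h \<ge> 0" and mem: "\<And>s. 0 \<le> s \<Longrightarrow> s \<le> h \<Longrightarrow> A (\<Phi> s)"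
    and equi: "\<And>e. e > 0 \<Longrightarrow> \<exists>d>0. \<forall>s s'. 0 \<le> s \<and> s \<le> h \<and> 0 \<le> s' \<and> s' \<le> h \<and> \<bar>s - s'\<bar> < d \<longrightarrow>
      (\<forall>t\<ge>\<alpha>. norm (\<Phi> s t - \<Phi> s' t) \<le> e)"
  shows "A (\<lambda>t. integral {0..h} (\<lambda>s. \<Phi> s t))"
proof (rule limit)
  fix e :: real assume e: "e > 0"
  define e' where "e' = e / (h + 1)"
  have e': "e' > 0" "h * e' \<le> e" using e h by (auto simp: e'_def field_simps)
  obtain d where d: "d > 0" "\<And>s s' t. \<lbrakk>0 \<le> s; s \<le> h; 0 \<le> s'; s' \<le> h; \<bar>s - s'\<bar> < d; t \<ge> \<alpha>\<rbrakk> \<Longrightarrow>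
      norm (\<Phi> s t - \<Phi> s' t) \<le> e'"
    using equi[OF e'(1)] by metis
  have cont: "continuous_on {0..h} (\<lambda>s. \<Phi> s t)" if t: "t \<ge> \<alpha>" for t
    unfolding continuous_on_iff
  proof (intro ballI allI impI)
    fix s and r :: real assume s: "s \<in> {0..h}" and r: "r > 0"
    then have "r / 2 > 0" by simp
    from equi[OF this] obtain d where "d > 0"
      "\<forall>s s'. 0 \<le> s \<and> s \<le> h \<and> 0 \<le> s' \<and> s' \<le> h \<and> \<bar>s - s'\<bar> < d \<longrightarrow> (\<forall>t\<ge>\<alpha>. norm (\<Phi> s t - \<Phi> s' t) \<le> r / 2)"
      by blast
    then show "\<exists>d>0. \<forall>s'\<in>{0..h}. dist s' s < d \<longrightarrow> dist (\<Phi> s' t) (\<Phi> s t) < r"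
      using s t r by (intro exI[of _ d]) (fastforce simp: dist_norm)
  qed
  obtain N :: nat where N: "h / d < N" using reals_Archimedean2 by blast
  define \<delta> where "\<delta> = h / Suc N"
  have "h < d * N" using N d(1) by (simp add: field_simps)
  also have "\<dots> \<le> d * Suc N" using d(1) by simp
  finally have \<delta>: "0 \<le> \<delta>" "\<delta> < d" "Suc N * \<delta> = h" using h by (auto simp: \<delta>_def field_simps)
  define g where "g t = (\<Sum>j<Suc N. \<delta> *\<^sub>R \<Phi> (j * \<delta>) t)" for t
  have le_h: "j * \<delta> \<le> h" if "j \<le> Suc N" for j :: nat
    unfolding \<delta>(3)[symmetric] using that \<delta>(1) by (intro mult_right_mono) auto
  have err: "norm (integral {0..k * \<delta>} (\<lambda>s. \<Phi> s t) - (\<Sum>j<k. \<delta> *\<^sub>R \<Phi> (j * \<delta>) t)) \<le> k * (\<delta> * e')"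
    if "k \<le> Suc N" "t \<ge> \<alpha>" for k :: nat and t
    using that(1)
  proof (induction k)
    case (Suc k)
    let ?f = "\<lambda>s. \<Phi> s t"
    have k: "k * \<delta> \<le> Suc k * \<delta>" "0 \<le> k * \<delta>" using \<delta>(1) by (auto intro!: mult_right_mono)
    have int: "?f integrable_on {a..b}" if "0 \<le> a" "b \<le> h" for a b
      by (intro integrable_continuous_real continuous_on_subset[OF cont[OF \<open>t \<ge> \<alpha>\<close>]]) (use that in auto)
    have split: "integral {0..Suc k * \<delta>} ?f = integral {0..k * \<delta>} ?f + integral {k * \<delta>..Suc k * \<delta>} ?f"
      using Henstock_Kurzweil_Integration.integral_combine[OF k(2,1) int] le_h[OF Suc.prems] by simp
    have "norm (integral {k * \<delta>..Suc k * \<delta>} (\<lambda>s. \<Phi> s t - \<Phi> (k * \<delta>) t)) \<le> e' * (Suc k * \<delta> - k * \<delta>)"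
    proof (rule integral_bound)
      show "continuous_on {k * \<delta>..Suc k * \<delta>} (\<lambda>s. \<Phi> s t - \<Phi> (k * \<delta>) t)"
        using k(2) le_h[OF Suc.prems]
        by (intro continuous_intros continuous_on_subset[OF cont[OF \<open>t \<ge> \<alpha>\<close>]]) auto
      fix s assume s: "s \<in> {k * \<delta>..Suc k * \<delta>}"
      have "\<bar>s - k * \<delta>\<bar> < d" using s \<delta>(2) by (auto simp: algebra_simps)
      then show "norm (\<Phi> s t - \<Phi> (k * \<delta>) t) \<le> e'"
        using s k le_h[OF Suc.prems] le_h[of k] Suc.prems \<open>t \<ge> \<alpha>\<close> by (intro d(2)) auto
    qed (rule k)
    also have "integral {k * \<delta>..Suc k * \<delta>} (\<lambda>s. \<Phi> s t - \<Phi> (k * \<delta>) t) =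
        integral {k * \<delta>..Suc k * \<delta>} ?f - \<delta> *\<^sub>R \<Phi> (k * \<delta>) t"
      using int[of "k * \<delta>" "Suc k * \<delta>"] k le_h[OF Suc.prems]
      by (subst Henstock_Kurzweil_Integration.integral_diff) (auto simp: algebra_simps)
    also have "e' * (Suc k * \<delta> - k * \<delta>) = \<delta> * e'" by (simp add: algebra_simps)
    finally have 1: "norm (integral {k * \<delta>..Suc k * \<delta>} ?f - \<delta> *\<^sub>R \<Phi> (k * \<delta>) t) \<le> \<delta> * e'" .
    have 2: "norm (integral {0..k * \<delta>} ?f - (\<Sum>j<k. \<delta> *\<^sub>R \<Phi> (j * \<delta>) t)) \<le> k * (\<delta> * e')"
      using Suc by simp
    have "integral {0..Suc k * \<delta>} ?f - (\<Sum>j<Suc k. \<delta> *\<^sub>R \<Phi> (j * \<delta>) t) =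
      (integral {0..k * \<delta>} ?f - (\<Sum>j<k. \<delta> *\<^sub>R \<Phi> (j * \<delta>) t)) + (integral {k * \<delta>..Suc k * \<delta>} ?f - \<delta> *\<^sub>R \<Phi> (k * \<delta>) t)"
      unfolding split by simp
    also have "norm \<dots> \<le> k * (\<delta> * e') + \<delta> * e'"
      by (rule order_trans[OF norm_triangle_ineq add_mono[OF 2 1]])
    finally show ?case by (simp add: algebra_simps)
  qed simp
  have "A g"
    unfolding g_def by (intro sum scaleR mem) (use \<delta>(1) le_h in auto)
  moreover have "norm (integral {0..h} (\<lambda>s. \<Phi> s t) - g t) \<le> e" if "t \<ge> \<alpha>" for t
    using err[OF order_refl that] \<delta>(3) e'(2) unfolding g_def by (simp add: mult.assoc[symmetric])
  ultimately show "\<exists>g. A g \<and> (\<forall>t\<ge>\<alpha>. norm (integral {0..h} (\<lambda>s. \<Phi> s t) - g t) \<le> e)" by blast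
qed

text \<open>The class \<open>\<M>\<A>\<close> for functions given by unrestricted terms; the means are multiplied by their length.\<close>

definition mean_member :: "(real \<Rightarrow> 'a) \<Rightarrow> bool" where
  "mean_member g \<longleftrightarrow> locally_L1 \<alpha> g \<and> (\<forall>h>0. A (\<lambda>t. integral {\<alpha>..t + h} g - integral {\<alpha>..t} g))"

lemma mean_member_increment:
  assumes "mean_member g" "h \<ge> 0"
  shows "A (\<lambda>t. integral {\<alpha>..t + h} g - integral {\<alpha>..t} g)"
proof (cases "h = 0")
  case True
  then show ?thesis using const[of 0] by simp
next
  case False
  then show ?thesis using assms by (simp add: mean_member_def)
qed

lemma mean_member_add:
  assumes f: "mean_member f" and g: "mean_member g"
  shows "mean_member (\<lambda>t. f t + g t)"
  unfolding mean_member_def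
proof (intro conjI allI impI)
  have L: "locally_L1 \<alpha> f" "locally_L1 \<alpha> g" using f g by (auto simp: mean_member_def)
  then show "locally_L1 \<alpha> (\<lambda>t. f t + g t)" by (rule locally_L1_add)
  fix h :: real assume "h > 0"
  then have "A (\<lambda>t. (integral {\<alpha>..t + h} f - integral {\<alpha>..t} f) + (integral {\<alpha>..t + h} g - integral {\<alpha>..t} g))"
    by (intro add mean_member_increment f g) simp_all
  moreover have "integral {\<alpha>..b} (\<lambda>t. f t + g t) = integral {\<alpha>..b} f + integral {\<alpha>..b} g" for b
    by (intro Henstock_Kurzweil_Integration.integral_add locally_L1_integrable[OF L(1)] locally_L1_integrable[OF L(2)]) simp_all
  ultimately show "A (\<lambda>t. integral {\<alpha>..t + h} (\<lambda>t. f t + g t) - integral {\<alpha>..t} (\<lambda>t. f t + g t))"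
    by (simp add: algebra_simps)
qed

lemma mean_member_scaleC:
  assumes f: "mean_member f"
  shows "mean_member (\<lambda>t. c *\<^sub>C f t)"
  unfolding mean_member_def
proof (intro conjI allI impI)
  have L: "locally_L1 \<alpha> f" using f by (auto simp: mean_member_def)
  then show "locally_L1 \<alpha> (\<lambda>t. c *\<^sub>C f t)" by (rule locally_L1_scaleC[rotated]) simp
  fix h :: real assume "h > 0"
  then have "A (\<lambda>t. c *\<^sub>C (integral {\<alpha>..t + h} f - integral {\<alpha>..t} f))"
    by (intro scaleC mean_member_increment f) simp_all
  moreover have "integral {\<alpha>..b} (\<lambda>t. c *\<^sub>C f t) = c *\<^sub>C integral {\<alpha>..b} f" for b
    using integral_linear[OF locally_L1_integrable[OF L order_refl] scaleC.bounded_linear_right[of c]] by (simp add: o_def)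
  ultimately show "A (\<lambda>t. integral {\<alpha>..t + h} (\<lambda>t. c *\<^sub>C f t) - integral {\<alpha>..t} (\<lambda>t. c *\<^sub>C f t))"
    by (simp add: scaleC.diff_right)
qed

lemma continuous: "A f \<Longrightarrow> continuous_on {\<alpha>..} f"
  by (rule uniformly_continuous_imp_continuous[OF uniformly_continuous])

lemma member_imp_mean_member:
  assumes f: "A f"
  shows "mean_member f"
  unfolding mean_member_def
proof (intro conjI allI impI)
  show L: "locally_L1 \<alpha> f" by (rule locally_L1_continuous[OF continuous[OF f]])
  fix h :: real assume h: "h > 0"
  have "A (\<lambda>t. integral {0..h} (\<lambda>s. f (t + s)))"
  proof (rule integral_of_members)
    show "A (\<lambda>t. f (t + s))" if "0 \<le> s" for s by (rule shift[OF f that])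
    fix e :: real assume "e > 0"
    then obtain d where d: "d > 0" "\<And>x y. x \<ge> \<alpha> \<Longrightarrow> y \<ge> \<alpha> \<Longrightarrow> dist y x < d \<Longrightarrow> dist (f y) (f x) < e"
      using uniformly_continuous[OF f] unfolding uniformly_continuous_on_def by (metis atLeast_iff)
    then have "norm (f (t + s) - f (t + s')) \<le> e" if "0 \<le> s" "0 \<le> s'" "\<bar>s - s'\<bar> < d" "t \<ge> \<alpha>" for s s' t
    proof -
      have "dist (f (t + s)) (f (t + s')) < e" by (rule d(2)) (use that in \<open>auto simp: dist_real_def\<close>)
      then show ?thesis by (simp add: dist_norm)
    qed
    then show "\<exists>d>0. \<forall>s s'. 0 \<le> s \<and> s \<le> h \<and> 0 \<le> s' \<and> s' \<le> h \<and> \<bar>s - s'\<bar> < d \<longrightarrow>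
      (\<forall>t\<ge>\<alpha>. norm (f (t + s) - f (t + s')) \<le> e)" using d(1) by blast
  qed (use h in auto)
  then show "A (\<lambda>t. integral {\<alpha>..t + h} f - integral {\<alpha>..t} f)"
  proof (rule cong)
    fix t assume "t \<ge> \<alpha>"
    then show "integral {0..h} (\<lambda>s. f (t + s)) = integral {\<alpha>..t + h} f - integral {\<alpha>..t} f"
      using locally_L1_integral_diff[OF L, of t "t + h"] h integral_shift_Icc_real[of 0 h f t]
      by (simp add: o_def add.commute)
  qed
qed

lemma primitive_uniformly_continuous:
  assumes g: "mean_member g"
  shows "uniformly_continuous_on {\<alpha>..} (\<lambda>t. integral {\<alpha>..t} g)"
proof (rule uniformly_continuous_if_differences)
  show "continuous_on {\<alpha>..} (\<lambda>t. integral {\<alpha>..t} g)"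
    using g by (intro continuous_on_locally_L1_integral) (simp add: mean_member_def)
  fix h :: real assume "h > 0"
  then have *: "A (\<lambda>t. integral {\<alpha>..t + h} g - integral {\<alpha>..t} g)" using mean_member_increment[OF g] by simp
  show "bounded ((\<lambda>t. integral {\<alpha>..t + h} g - integral {\<alpha>..t} g) ` {\<alpha>..})"
    using bounded[OF *] by (auto simp: bounded_iff)
  show "uniformly_continuous_on {\<alpha>..} (\<lambda>t. integral {\<alpha>..t + h} g - integral {\<alpha>..t} g)"
    by (rule uniformly_continuous[OF *])
qed

text \<open>An increment over a length at most \<open>h\<close> is a sum of boundedly many increments over short lengths.\<close>

lemma uniformly_continuous_increments_bounded:
  fixes \<phi> :: "real \<Rightarrow> 'a"
  assumes uc: "uniformly_continuous_on {\<alpha>..} \<phi>"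
  shows "\<exists>M>0. \<forall>s t. 0 \<le> s \<and> s \<le> h \<and> t \<ge> \<alpha> \<longrightarrow> norm (\<phi> (t + s) - \<phi> t) \<le> M"
proof -
  obtain d where d: "d > 0" "\<And>x y. x \<ge> \<alpha> \<Longrightarrow> y \<ge> \<alpha> \<Longrightarrow> dist y x < d \<Longrightarrow> dist (\<phi> y) (\<phi> x) < 1"
    using uc unfolding uniformly_continuous_on_def by (metis atLeast_iff zero_less_one)
  obtain N0 :: nat where N0: "h / d < N0" using reals_Archimedean2 by blast
  define N where "N = Suc N0"
  have N: "h < d * N" "N > 0" using N0 d(1) by (auto simp: N_def field_simps)
  have "norm (\<phi> (t + s) - \<phi> t) \<le> N" if s: "0 \<le> s" "s \<le> h" "t \<ge> \<alpha>" for s t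
  proof -
    define r where "r = s / N"
    have r: "0 \<le> r" "r < d" "N * r = s" using s N by (auto simp: r_def field_simps)
    have "\<phi> (t + s) - \<phi> t = (\<Sum>j<N. \<phi> (t + Suc j * r) - \<phi> (t + j * r))"
      using sum_lessThan_telescope[of "\<lambda>j. \<phi> (t + real j * r)" N] r(3) by simp
    also have "norm \<dots> \<le> (\<Sum>j<N. 1)"
    proof (rule sum_norm_le)
      fix j :: nat
      have nn: "0 \<le> j * r" using r(1) by simp
      have le: "\<alpha> \<le> t + j * r" "\<alpha> \<le> t + Suc j * r"
        unfolding of_nat_Suc distrib_right using s(3) nn r(1) by linarith+
      have "dist (\<phi> (t + Suc j * r)) (\<phi> (t + j * r)) < 1"
        using r(1,2) by (intro d(2)[OF le]) (simp add: dist_real_def distrib_right)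
      then show "norm (\<phi> (t + Suc j * r) - \<phi> (t + j * r)) \<le> 1" by (simp add: dist_norm)
    qed
    finally show ?thesis by simp
  qed
  then show ?thesis using N(2) by (intro exI[of _ "real N"]) auto
qed

lemma integral_of_increments:
  assumes g: "mean_member g" and h: "h \<ge> 0" and k: "continuous_on {0..h} k"
  shows "A (\<lambda>t. integral {0..h} (\<lambda>s. k s *\<^sub>C (integral {\<alpha>..t + s} g - integral {\<alpha>..t} g)))"
proof (rule integral_of_members[OF h])
  define \<phi> where "\<phi> t = integral {\<alpha>..t} g" for t
  show "A (\<lambda>t. k s *\<^sub>C (integral {\<alpha>..t + s} g - integral {\<alpha>..t} g))" if "0 \<le> s" for s
    by (intro scaleC mean_member_increment g that)
  have uc: "uniformly_continuous_on {\<alpha>..} \<phi>"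
    using primitive_uniformly_continuous[OF g] by (simp add: \<phi>_def[abs_def])
  obtain M where M: "M > 0" "\<And>s t. 0 \<le> s \<Longrightarrow> s \<le> h \<Longrightarrow> t \<ge> \<alpha> \<Longrightarrow> norm (\<phi> (t + s) - \<phi> t) \<le> M"
    using uniformly_continuous_increments_bounded[OF uc] by metis
  obtain L where L: "L > 0" "\<And>s. s \<in> {0..h} \<Longrightarrow> norm (k s) \<le> L"
    using compact_imp_bounded[OF compact_continuous_image[OF k compact_Icc]] by (auto simp: bounded_pos)
  fix e :: real assume e: "e > 0"
  have "e / 2 / M > 0" "e / 2 / L > 0" using e M(1) L(1) by simp_all
  then obtain d1 d2 where d1: "d1 > 0" "\<And>x y. x \<in> {0..h} \<Longrightarrow> y \<in> {0..h} \<Longrightarrow> dist y x < d1 \<Longrightarrow> dist (k y) (k x) < e / 2 / M"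
    and d2: "d2 > 0" "\<And>x y. x \<in> {\<alpha>..} \<Longrightarrow> y \<in> {\<alpha>..} \<Longrightarrow> dist y x < d2 \<Longrightarrow> dist (\<phi> y) (\<phi> x) < e / 2 / L"
    using compact_uniformly_continuous[OF k compact_Icc] uc unfolding uniformly_continuous_on_def by metis
  have "norm (k s *\<^sub>C (\<phi> (t + s) - \<phi> t) - k s' *\<^sub>C (\<phi> (t + s') - \<phi> t)) \<le> e"
    if s: "0 \<le> s" "s \<le> h" "0 \<le> s'" "s' \<le> h" "\<bar>s - s'\<bar> < min d1 d2" "t \<ge> \<alpha>" for s s' t
  proof -
    have "k s *\<^sub>C (\<phi> (t + s) - \<phi> t) - k s' *\<^sub>C (\<phi> (t + s') - \<phi> t) =
        (k s - k s') *\<^sub>C (\<phi> (t + s) - \<phi> t) + k s' *\<^sub>C (\<phi> (t + s) - \<phi> (t + s'))"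
      by (simp add: scaleC.diff_left scaleC.diff_right)
    also have "norm \<dots> \<le> norm (k s - k s') * norm (\<phi> (t + s) - \<phi> t) + norm (k s') * norm (\<phi> (t + s) - \<phi> (t + s'))"
      by (rule norm_triangle_le) (simp add: norm_scaleC)
    also have "\<dots> \<le> e / 2 / M * M + L * (e / 2 / L)"
      using d1(2)[of s' s] d2(2)[of "t + s'" "t + s"] M L s e
      by (intro add_mono mult_mono) (auto simp: dist_norm)
    also have "\<dots> = e" using M(1) L(1) by simp
    finally show ?thesis .
  qed
  then show "\<exists>d>0. \<forall>s s'. 0 \<le> s \<and> s \<le> h \<and> 0 \<le> s' \<and> s' \<le> h \<and> \<bar>s - s'\<bar> < d \<longrightarrow>
      (\<forall>t\<ge>\<alpha>. norm (k s *\<^sub>C (integral {\<alpha>..t + s} g - integral {\<alpha>..t} g)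
        - k s' *\<^sub>C (integral {\<alpha>..t + s'} g - integral {\<alpha>..t} g)) \<le> e)"
    using d1(1) d2(1) unfolding \<phi>_def by (intro exI[of _ "min d1 d2"]) auto
qed

end

section \<open>Scalar linear equations of first order\<close>

lemma exp_decay_has_vector_derivative:
  "((\<lambda>t. exp (- l * of_real t)) has_vector_derivative - l * exp (- l * of_real t)) (at t within S)"
  for l :: complex
proof -
  have "((\<lambda>t. exp (t *\<^sub>R (- l))) has_vector_derivative exp (t *\<^sub>R (- l)) * (- l)) (at t within S)"
    by (rule exp_scaleR_has_vector_derivative_right)
  then show ?thesis by (simp add: scaleR_conv_of_real mult.commute)
qed

text \<open>The function \<open>z - \<phi>\<close> is classically differentiable with derivative \<open>l z\<close>, although \<open>g\<close> is only locally
integrable; the integrating factor is applied to it instead of \<open>z\<close>.\<close>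

lemma linear_equation_increment:
  fixes z g :: "real \<Rightarrow> 'a::complex_banach" and l :: complex
  assumes g: "locally_L1 \<alpha> g" and z: "continuous_on {\<alpha>..} z"
    and eq: "\<And>t. t \<ge> \<alpha> \<Longrightarrow> z t = z \<alpha> + integral {\<alpha>..t} g + integral {\<alpha>..t} (\<lambda>s. l *\<^sub>C z s)"
    and t: "\<alpha> \<le> t" "t \<le> u"
  defines "\<phi> \<equiv> \<lambda>t. integral {\<alpha>..t} g"
  defines "k \<equiv> \<lambda>t. exp (- l * of_real t)"
  shows "((\<lambda>s. (l * k s) *\<^sub>C \<phi> s) has_integral (k u *\<^sub>C (z u - \<phi> u) - k t *\<^sub>C (z t - \<phi> t))) {t..u}"
proof (rule fundamental_theorem_of_calculus[OF t(2)])
  fix s assume s: "s \<in> {t..u}"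
  define v where "v s = z s - \<phi> s" for s
  have v: "v s = z \<alpha> + integral {\<alpha>..s} (\<lambda>s. l *\<^sub>C z s)" if "s \<ge> \<alpha>" for s
    using eq[OF that] by (simp add: v_def \<phi>_def)
  have "continuous_on {\<alpha>..u} (\<lambda>s. l *\<^sub>C z s)"
    by (intro scaleC.continuous_on continuous_on_const continuous_on_subset[OF z]) auto
  then have "((\<lambda>s. integral {\<alpha>..s} (\<lambda>s. l *\<^sub>C z s)) has_vector_derivative l *\<^sub>C z s) (at s within {\<alpha>..u})"
    using s t by (intro integral_has_vector_derivative) auto
  then have "((\<lambda>s. z \<alpha> + integral {\<alpha>..s} (\<lambda>s. l *\<^sub>C z s)) has_vector_derivative 0 + l *\<^sub>C z s) (at s within {\<alpha>..u})"
    by (intro has_vector_derivative_add has_vector_derivative_const)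
  then have "(v has_vector_derivative 0 + l *\<^sub>C z s) (at s within {\<alpha>..u})"
    by (rule has_vector_derivative_transform[rotated 2]) (use s t v in auto)
  then have dv: "(v has_vector_derivative l *\<^sub>C z s) (at s within {t..u})"
    using t by (auto intro: has_vector_derivative_within_subset)
  have "((\<lambda>s. k s *\<^sub>C v s) has_vector_derivative k s *\<^sub>C (l *\<^sub>C z s) + (- l * k s) *\<^sub>C v s) (at s within {t..u})"
    unfolding k_def by (rule scaleC.has_vector_derivative[OF exp_decay_has_vector_derivative dv])
  moreover have "k s *\<^sub>C (l *\<^sub>C z s) + (- l * k s) *\<^sub>C v s = (l * k s) *\<^sub>C \<phi> s"
    by (simp add: v_def scaleC_scaleC scaleC.minus_left scaleC.diff_right mult.commute)
  ultimately show "((\<lambda>u. k u *\<^sub>C (z u - \<phi> u)) has_vector_derivative (l * k s) *\<^sub>C \<phi> s) (at s within {t..u})"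
    by (simp add: v_def)
qed

text \<open>Variation of constants in a form that contains \<open>g\<close> only through increments of its primitive.\<close>

lemma linear_equation_one_step:
  fixes z g :: "real \<Rightarrow> 'a::complex_banach" and l :: complex
  assumes g: "locally_L1 \<alpha> g" and z: "continuous_on {\<alpha>..} z"
    and eq: "\<And>t. t \<ge> \<alpha> \<Longrightarrow> z t = z \<alpha> + integral {\<alpha>..t} g + integral {\<alpha>..t} (\<lambda>s. l *\<^sub>C z s)"
    and t: "\<alpha> \<le> t" and h: "0 \<le> h"
  defines "k \<equiv> \<lambda>t. exp (- l * of_real t)"
  shows "k h *\<^sub>C z (t + h) - z t = k h *\<^sub>C (integral {\<alpha>..t + h} g - integral {\<alpha>..t} g) +
    integral {0..h} (\<lambda>s. (l * k s) *\<^sub>C (integral {\<alpha>..t + s} g - integral {\<alpha>..t} g))"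
proof -
  define \<phi> where "\<phi> t = integral {\<alpha>..t} g" for t
  have kadd: "k (s + r) = k s * k r" for s r by (simp add: k_def exp_add[symmetric] algebra_simps)
  have k0: "k 0 = 1" by (simp add: k_def)
  have kinv: "k (- t) * k t = 1" using kadd[of "- t" t] k0 by simp
  have kd: "(k has_vector_derivative - l * k s) (at s within S)" for s S
    unfolding k_def by (rule exp_decay_has_vector_derivative)
  have "((\<lambda>s. (l * k s) *\<^sub>C \<phi> s) has_integral (k (t + h) *\<^sub>C (z (t + h) - \<phi> (t + h)) - k t *\<^sub>C (z t - \<phi> t))) {0 + t..h + t}"
    using linear_equation_increment[OF g z eq t, of "t + h"] h unfolding \<phi>_def k_def by (simp add: add.commute)
  then have "((\<lambda>s. (l * k (t + s)) *\<^sub>C \<phi> (t + s)) has_integral (k (t + h) *\<^sub>C (z (t + h) - \<phi> (t + h)) - k t *\<^sub>C (z t - \<phi> t))) {0..h}"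
    unfolding has_integral_shift_Icc_real[symmetric] by (simp add: o_def)
  moreover have e1: "k (- t) * (l * k (t + s)) = l * k s" for s
  proof -
    have "k (- t) * (l * k (t + s)) = (k (- t) * k t) * (l * k s)" by (simp add: kadd)
    then show ?thesis using kinv by simp
  qed
  moreover have e2: "k (- t) * k (t + h) = k h"
    using kinv by (simp add: kadd mult.assoc[symmetric])
  ultimately have base: "((\<lambda>s. (l * k (t + s)) *\<^sub>C \<phi> (t + s)) has_integral (k (t + h) *\<^sub>C (z (t + h) - \<phi> (t + h)) - k t *\<^sub>C (z t - \<phi> t))) {0..h}"
    by simp
  from has_integral_linear[OF base scaleC.bounded_linear_right[of "k (- t)"]]
  have 1: "((\<lambda>s. (l * k s) *\<^sub>C \<phi> (t + s)) has_integral (k h *\<^sub>C (z (t + h) - \<phi> (t + h)) - (z t - \<phi> t))) {0..h}"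
    by (simp add: o_def scaleC_scaleC scaleC.diff_right e1 e2 kinv)
  have "((\<lambda>s. - k s) has_vector_derivative l * k s) (at s within {0..h})" for s
    using has_vector_derivative_minus[OF kd[of s "{0..h}"]] by simp
  then have "((\<lambda>s. l * k s) has_integral (- k h - - k 0)) {0..h}"
    by (intro fundamental_theorem_of_calculus h) simp
  from has_integral_linear[OF this scaleC.bounded_linear_left[of "\<phi> t"]]
  have 2: "((\<lambda>s. (l * k s) *\<^sub>C \<phi> t) has_integral (1 - k h) *\<^sub>C \<phi> t) {0..h}"
    by (simp add: o_def k0)
  have "((\<lambda>s. (l * k s) *\<^sub>C (\<phi> (t + s) - \<phi> t)) has_integral
      (k h *\<^sub>C (z (t + h) - \<phi> (t + h)) - (z t - \<phi> t)) - (1 - k h) *\<^sub>C \<phi> t) {0..h}"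
    using has_integral_diff[OF 1 2] by (simp add: scaleC.diff_right)
  then have "integral {0..h} (\<lambda>s. (l * k s) *\<^sub>C (\<phi> (t + s) - \<phi> t)) =
      (k h *\<^sub>C (z (t + h) - \<phi> (t + h)) - (z t - \<phi> t)) - (1 - k h) *\<^sub>C \<phi> t"
    by (rule integral_unique)
  then show ?thesis
    unfolding \<phi>_def[symmetric] by (simp add: scaleC.diff_right scaleC.diff_left)
qed

text \<open>Identifies the primitive of \<open>\<gamma>\<^bsub>-\<omega>\<^esub> g\<close>, to which the property \<open>(P'\<^sub>U)\<close> is applied.\<close>

lemma linear_equation_integrating_factor:
  fixes z g :: "real \<Rightarrow> 'a::complex_banach"
  assumes g: "locally_L1 \<alpha> g" and z: "continuous_on {\<alpha>..} z"
    and eq: "\<And>t. t \<ge> \<alpha> \<Longrightarrow> z t = z \<alpha> + integral {\<alpha>..t} g + integral {\<alpha>..t} (\<lambda>s. (\<i> * of_real \<omega>) *\<^sub>C z s)"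
    and t: "\<alpha> \<le> t"
  shows "integral {\<alpha>..t} (\<lambda>s. \<gamma> (- \<omega>) s *\<^sub>C g s) = \<gamma> (- \<omega>) t *\<^sub>C z t - \<gamma> (- \<omega>) \<alpha> *\<^sub>C z \<alpha>"
proof -
  have k: "exp (- (\<i> * complex_of_real \<omega>) * complex_of_real s) = \<gamma> (- \<omega>) s" for s
    by (simp add: \<gamma>_def mult.assoc)
  have "integral {\<alpha>..t} (\<lambda>s. (\<i> * of_real \<omega> * \<gamma> (- \<omega>) s) *\<^sub>C integral {\<alpha>..s} g) =
      \<gamma> (- \<omega>) t *\<^sub>C (z t - integral {\<alpha>..t} g) - \<gamma> (- \<omega>) \<alpha> *\<^sub>C z \<alpha>"
    using linear_equation_increment[OF g z eq order_refl t] unfolding k by (simp add: integral_unique)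
  moreover have "integral {\<alpha>..t} (\<lambda>s. \<gamma> (- \<omega>) s *\<^sub>C g s) = \<gamma> (- \<omega>) t *\<^sub>C integral {\<alpha>..t} g -
      integral {\<alpha>..t} (\<lambda>s. (\<i> * of_real (- \<omega>) * \<gamma> (- \<omega>) s) *\<^sub>C integral {\<alpha>..s} g)"
    by (rule integral_by_parts_locally_L1[OF g \<gamma>_has_vector_derivative _ t])
      (intro continuous_intros continuous_on_\<gamma>)
  ultimately show ?thesis
    by (simp add: scaleC.minus_left scaleC.diff_right)
qed

definition poly_bounded :: "real \<Rightarrow> (real \<Rightarrow> 'b::real_normed_vector) \<Rightarrow> bool" where
  "poly_bounded \<alpha> z \<longleftrightarrow> (\<exists>C q. \<forall>t\<ge>\<alpha>. norm (z t) \<le> C * (1 + \<bar>t\<bar>) ^ q)"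

text \<open>With \<open>s\<close> the root of order \<open>q + 1\<close> of \<open>r\<close>, the sequence is dominated by a power of
\<open>(1 + c + n) s\<^sup>n\<close>.\<close>

lemma geometric_times_poly_tendsto_0:
  fixes r c :: real
  assumes r: "0 \<le> r" "r < 1" and c: "c \<ge> 0"
  shows "(\<lambda>n. r ^ n * (c + real n) ^ q) \<longlonglongrightarrow> 0"
proof -
  define q' where "q' = Suc q"
  define s where "s = root q' r"
  have s: "0 \<le> s" "s < 1" using r by (auto simp: s_def q'_def)
  have sq: "s ^ q' = r" unfolding s_def by (rule real_root_pow_pos2) (use r in \<open>auto simp: q'_def\<close>)
  have l1: "(\<lambda>n. real n * s ^ n) \<longlonglongrightarrow> 0" using s by (intro powser_times_n_limit_0) auto
  have l2: "(\<lambda>n. s ^ n) \<longlonglongrightarrow> 0" using s by (intro LIMSEQ_power_zero) auto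
  have "(\<lambda>n. ((1 + c) * s ^ n + real n * s ^ n) ^ q') \<longlonglongrightarrow> ((1 + c) * 0 + 0) ^ q'"
    by (intro tendsto_power tendsto_add tendsto_mult tendsto_const l1 l2)
  moreover have "((1 + c) * s ^ n + real n * s ^ n) ^ q' = r ^ n * (1 + c + real n) ^ q'" for n
  proof -
    have "((1 + c) * s ^ n + real n * s ^ n) ^ q' = (s ^ n) ^ q' * (1 + c + real n) ^ q'"
      by (simp only: distrib_right[symmetric] power_mult_distrib mult.commute)
    also have "(s ^ n) ^ q' = (s ^ q') ^ n" by (simp only: power_mult[symmetric] mult.commute)
    finally show ?thesis by (simp only: sq)
  qed
  ultimately have lim: "(\<lambda>n. r ^ n * (1 + c + real n) ^ q') \<longlonglongrightarrow> 0"
    by (simp add: q'_def)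
  show ?thesis
  proof (rule Lim_null_comparison[OF _ lim], intro always_eventually allI)
    fix n
    have "(c + real n) ^ q \<le> (1 + c + real n) ^ q" using c by (intro power_mono) auto
    also have "\<dots> \<le> (1 + c + real n) ^ q'" unfolding q'_def using c by (intro power_increasing) auto
    finally have "r ^ n * (c + real n) ^ q \<le> r ^ n * (1 + c + real n) ^ q'"
      using r by (intro mult_left_mono) auto
    moreover have "0 \<le> r ^ n * (c + real n) ^ q" using r c by simp
    ultimately show "norm (r ^ n * (c + real n) ^ q) \<le> r ^ n * (1 + c + real n) ^ q'" by simp
  qed
qed

context half_line_class
begin

text \<open>Iteration gives \<open>z t = \<rho>\<^sup>N z(t + N) + S N t\<close> with members \<open>S N\<close> that are bounded uniformly in \<open>N\<close>. Polynomial
growth first yields that \<open>z\<close> is bounded, by letting \<open>N\<close> tend to infinity at a fixed point; then the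
remainder tends to zero uniformly.\<close>

lemma backward_contraction:
  assumes b: "A b" and \<rho>: "norm \<rho> < 1" and z: "poly_bounded \<alpha> z"
    and step: "\<And>t. t \<ge> \<alpha> \<Longrightarrow> z t = \<rho> *\<^sub>C z (t + 1) + b t"
  shows "A z"
proof -
  obtain B0 where B0: "\<And>t. t \<ge> \<alpha> \<Longrightarrow> norm (b t) \<le> B0" using bounded[OF b] by blast
  define B where "B = \<bar>B0\<bar>"
  have B: "B \<ge> 0" "\<And>t. t \<ge> \<alpha> \<Longrightarrow> norm (b t) \<le> B"
    using order_trans[OF B0 abs_ge_self] by (auto simp: B_def)
  obtain C0 q where C0: "\<And>t. t \<ge> \<alpha> \<Longrightarrow> norm (z t) \<le> C0 * (1 + \<bar>t\<bar>) ^ q"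
    using z by (auto simp: poly_bounded_def)
  define C where "C = \<bar>C0\<bar>"
  have C: "C \<ge> 0" "\<And>t. t \<ge> \<alpha> \<Longrightarrow> norm (z t) \<le> C * (1 + \<bar>t\<bar>) ^ q"
    using order_trans[OF C0 mult_right_mono[OF abs_ge_self]] by (auto simp: C_def)
  define S where "S N t = (\<Sum>j<N. (\<rho> ^ j) *\<^sub>C b (t + real j))" for N t
  have iter: "z t = \<rho> ^ N *\<^sub>C z (t + real N) + S N t" if "t \<ge> \<alpha>" for N t
  proof (induction N)
    case (Suc N)
    have "z (t + real N) = \<rho> *\<^sub>C z (t + real (Suc N)) + b (t + real N)"
      using step[of "t + real N"] that by (simp add: algebra_simps)
    then show ?case
      using Suc by (simp add: S_def scaleC.add_right scaleC_scaleC mult.commute)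
  qed (simp add: S_def)
  have SB: "norm (S N t) \<le> B / (1 - norm \<rho>)" if "t \<ge> \<alpha>" for N t
  proof -
    have "norm (S N t) \<le> (\<Sum>j<N. norm \<rho> ^ j * B)"
      unfolding S_def using that B(2)
      by (intro sum_norm_le) (auto simp: norm_scaleC norm_power intro!: mult_left_mono)
    also have "\<dots> = (\<Sum>j<N. norm \<rho> ^ j) * B" by (simp add: sum_distrib_right)
    also have "\<dots> \<le> (1 / (1 - norm \<rho>)) * B"
    proof (rule mult_right_mono[OF _ B(1)])
      have "(\<Sum>j<N. norm \<rho> ^ j) \<le> (\<Sum>j. norm \<rho> ^ j)"
        using \<rho> by (intro sum_le_suminf summable_geometric) auto
      then show "(\<Sum>j<N. norm \<rho> ^ j) \<le> 1 / (1 - norm \<rho>)" using \<rho> by (simp add: suminf_geometric)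
    qed
    finally show ?thesis by simp
  qed
  have zB: "norm (z t) \<le> B / (1 - norm \<rho>)" if t: "t \<ge> \<alpha>" for t
  proof (rule LIMSEQ_le_const)
    have "(\<lambda>N. C * (norm \<rho> ^ N * ((1 + \<bar>t\<bar>) + real N) ^ q) + B / (1 - norm \<rho>)) \<longlonglongrightarrow> C * 0 + B / (1 - norm \<rho>)"
      by (intro tendsto_intros geometric_times_poly_tendsto_0) (use \<rho> in auto)
    then show "(\<lambda>N. C * (norm \<rho> ^ N * ((1 + \<bar>t\<bar>) + real N) ^ q) + B / (1 - norm \<rho>)) \<longlonglongrightarrow> B / (1 - norm \<rho>)"
      by simp
    have "norm (z t) \<le> C * (norm \<rho> ^ N * ((1 + \<bar>t\<bar>) + real N) ^ q) + B / (1 - norm \<rho>)" for N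
    proof -
      have "norm (z (t + real N)) \<le> C * (1 + \<bar>t + real N\<bar>) ^ q" using t by (intro C(2)) auto
      also have "\<dots> \<le> C * ((1 + \<bar>t\<bar>) + real N) ^ q" using C(1) by (intro mult_left_mono power_mono) auto
      finally have "norm \<rho> ^ N * norm (z (t + real N)) \<le> norm \<rho> ^ N * (C * ((1 + \<bar>t\<bar>) + real N) ^ q)"
        by (intro mult_left_mono) auto
      moreover have "norm (z t) \<le> norm \<rho> ^ N * norm (z (t + real N)) + norm (S N t)"
        using norm_triangle_ineq[of "\<rho> ^ N *\<^sub>C z (t + real N)" "S N t"] iter[OF t, of N]
        by (simp add: norm_scaleC norm_power)
      ultimately show ?thesis using SB[OF t, of N] by (simp add: mult_ac)
    qed
    then show "\<exists>N. \<forall>n\<ge>N. norm (z t) \<le> C * (norm \<rho> ^ n * ((1 + \<bar>t\<bar>) + real n) ^ q) + B / (1 - norm \<rho>)" by blast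
  qed
  show ?thesis
  proof (rule limit)
    fix e :: real assume "e > 0"
    \<comment> \<open>adding 1 only makes the bound positive\<close>
    define M where "M = B / (1 - norm \<rho>) + 1"
    have M: "M > 0" using B(1) \<rho> by (simp add: M_def add_nonneg_pos)
    have "(\<lambda>N. norm \<rho> ^ N) \<longlonglongrightarrow> 0" using \<rho> by (intro LIMSEQ_power_zero) auto
    then have "\<forall>\<^sub>F N in sequentially. norm \<rho> ^ N < e / M"
      using M \<open>e > 0\<close> by (intro order_tendstoD) auto
    from eventually_happens'[OF sequentially_bot this] obtain N where N: "norm \<rho> ^ N < e / M" by blast
    have "A (S N)" unfolding S_def by (intro sum scaleC shift[OF b]) auto
    moreover have "norm (z t - S N t) \<le> e" if t: "t \<ge> \<alpha>" for t
    proof -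
      have zM: "norm (z (t + real N)) \<le> M" using zB[of "t + real N"] t by (simp add: M_def)
      have "norm (z t - S N t) = norm \<rho> ^ N * norm (z (t + real N))"
        using iter[OF t, of N] by (simp add: norm_scaleC norm_power)
      also have "\<dots> \<le> e / M * M"
        using N zM M \<open>e > 0\<close> by (intro mult_mono) auto
      finally show ?thesis using M by simp
    qed
    ultimately show "\<exists>g. A g \<and> (\<forall>t\<ge>\<alpha>. norm (z t - g t) \<le> e)" by blast
  qed
qed

lemma linear_equation_one_step_member:
  assumes g: "mean_member g" and z: "continuous_on {\<alpha>..} z"
    and eq: "\<And>t. t \<ge> \<alpha> \<Longrightarrow> z t = z \<alpha> + integral {\<alpha>..t} g + integral {\<alpha>..t} (\<lambda>s. l *\<^sub>C z s)"
    and h: "h \<ge> 0"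
  shows "A (\<lambda>t. exp (- l * of_real h) *\<^sub>C z (t + h) - z t)"
proof (rule cong)
  show "A (\<lambda>t. exp (- l * of_real h) *\<^sub>C (integral {\<alpha>..t + h} g - integral {\<alpha>..t} g) +
    integral {0..h} (\<lambda>s. (l * exp (- l * of_real s)) *\<^sub>C (integral {\<alpha>..t + s} g - integral {\<alpha>..t} g)))"
    by (intro add scaleC mean_member_increment integral_of_increments g h continuous_intros)
  fix t assume "t \<ge> \<alpha>"
  then show "exp (- l * of_real h) *\<^sub>C (integral {\<alpha>..t + h} g - integral {\<alpha>..t} g) +
    integral {0..h} (\<lambda>s. (l * exp (- l * of_real s)) *\<^sub>C (integral {\<alpha>..t + s} g - integral {\<alpha>..t} g))
    = exp (- l * of_real h) *\<^sub>C z (t + h) - z t"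
    using linear_equation_one_step[OF conjunct1[OF g[unfolded mean_member_def]] z eq _ h, of t] by simp
qed

lemma linear_equation_unstable:
  assumes g: "mean_member g" and z: "continuous_on {\<alpha>..} z"
    and eq: "\<And>t. t \<ge> \<alpha> \<Longrightarrow> z t = z \<alpha> + integral {\<alpha>..t} g + integral {\<alpha>..t} (\<lambda>s. l *\<^sub>C z s)"
    and l: "Re l > 0" and pb: "poly_bounded \<alpha> z"
  shows "A z"
proof (rule backward_contraction[OF _ _ pb])
  show "A (\<lambda>t. (- 1) *\<^sub>C (exp (- l * of_real 1) *\<^sub>C z (t + 1) - z t))"
    by (intro scaleC linear_equation_one_step_member[OF g z eq] zero_le_one)
  show "norm (exp (- l)) < 1" using l by simp
  show "z t = exp (- l) *\<^sub>C z (t + 1) + (- 1) *\<^sub>C (exp (- l * of_real 1) *\<^sub>C z (t + 1) - z t)" for t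
    by (simp add: scaleC.minus_left)
qed

lemma linear_equation_rotated_mean_member:
  assumes g: "mean_member g" and z: "continuous_on {\<alpha>..} z"
    and eq: "\<And>t. t \<ge> \<alpha> \<Longrightarrow> z t = z \<alpha> + integral {\<alpha>..t} g + integral {\<alpha>..t} (\<lambda>s. (\<i> * of_real \<omega>) *\<^sub>C z s)"
  shows "mean_member (\<lambda>t. \<gamma> (- \<omega>) t *\<^sub>C g t)"
  unfolding mean_member_def
proof (intro conjI allI impI)
  have L: "locally_L1 \<alpha> g" using g by (simp add: mean_member_def)
  then show "locally_L1 \<alpha> (\<lambda>t. \<gamma> (- \<omega>) t *\<^sub>C g t)"
    by (rule locally_L1_scaleC[OF continuous_on_\<gamma>])
  fix h :: real assume h: "h > 0"
  have "A (\<lambda>t. \<gamma> (- \<omega>) t *\<^sub>C (exp (- (\<i> * of_real \<omega>) * of_real h) *\<^sub>C z (t + h) - z t))"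
    by (intro rotate linear_equation_one_step_member[OF g z eq]) (use h in auto)
  then show "A (\<lambda>t. integral {\<alpha>..t + h} (\<lambda>t. \<gamma> (- \<omega>) t *\<^sub>C g t) - integral {\<alpha>..t} (\<lambda>t. \<gamma> (- \<omega>) t *\<^sub>C g t))"
  proof (rule cong)
    fix t assume t: "t \<ge> \<alpha>"
    have "exp (- (\<i> * of_real \<omega>) * of_real h) = \<gamma> (- \<omega>) h" by (simp add: \<gamma>_def mult.assoc)
    then show "\<gamma> (- \<omega>) t *\<^sub>C (exp (- (\<i> * of_real \<omega>) * of_real h) *\<^sub>C z (t + h) - z t) =
       integral {\<alpha>..t + h} (\<lambda>t. \<gamma> (- \<omega>) t *\<^sub>C g t) - integral {\<alpha>..t} (\<lambda>t. \<gamma> (- \<omega>) t *\<^sub>C g t)"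
      using linear_equation_integrating_factor[OF L z eq, of t] linear_equation_integrating_factor[OF L z eq, of "t + h"] t h
      by (simp add: \<gamma>_add scaleC.diff_right scaleC_scaleC)
  qed
qed

end

text \<open>The last assumption is the property \<open>(P'\<^sub>U)\<close>.\<close>

locale primitive_closed_class = half_line_class \<alpha> A for \<alpha> and A :: "(real \<Rightarrow> 'a::complex_banach) \<Rightarrow> bool" +
  fixes U :: "(real \<Rightarrow> 'a) \<Rightarrow> bool"
  assumes U_cong: "U f \<Longrightarrow> (\<And>t. t \<ge> \<alpha> \<Longrightarrow> f t = g t) \<Longrightarrow> U g"
    and U_const: "U (\<lambda>_. x)"
    and U_add: "U f \<Longrightarrow> U g \<Longrightarrow> U (\<lambda>t. f t + g t)"
    and U_scaleC: "U f \<Longrightarrow> U (\<lambda>t. c *\<^sub>C f t)"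
    and U_rotate: "U f \<Longrightarrow> U (\<lambda>t. \<gamma> \<omega> t *\<^sub>C f t)"
    and primitive: "mean_member g \<Longrightarrow> U (\<lambda>t. integral {\<alpha>..t} g) \<Longrightarrow> A (\<lambda>t. integral {\<alpha>..t} g)"
begin

lemma U_sum: "(\<And>i. i \<in> I \<Longrightarrow> U (f i)) \<Longrightarrow> U (\<lambda>t. \<Sum>i\<in>I. f i t)"
  by (induction I rule: infinite_finite_induct) (simp_all add: U_const U_add)

lemma linear_equation_neutral:
  assumes g: "mean_member g" and z: "continuous_on {\<alpha>..} z"
    and eq: "\<And>t. t \<ge> \<alpha> \<Longrightarrow> z t = z \<alpha> + integral {\<alpha>..t} g + integral {\<alpha>..t} (\<lambda>s. (\<i> * of_real \<omega>) *\<^sub>C z s)"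
    and U: "U z"
  shows "A z"
proof -
  let ?P = "\<lambda>t. integral {\<alpha>..t} (\<lambda>t. \<gamma> (- \<omega>) t *\<^sub>C g t)"
  have L: "locally_L1 \<alpha> g" using g by (simp add: mean_member_def)
  have P: "?P t = \<gamma> (- \<omega>) t *\<^sub>C z t + - (\<gamma> (- \<omega>) \<alpha> *\<^sub>C z \<alpha>)" if "t \<ge> \<alpha>" for t
    using linear_equation_integrating_factor[OF L z eq that] by simp
  have "U (\<lambda>t. \<gamma> (- \<omega>) t *\<^sub>C z t + - (\<gamma> (- \<omega>) \<alpha> *\<^sub>C z \<alpha>))"
    by (intro U_add U_rotate U U_const)
  then have "U ?P" by (rule U_cong) (simp add: P)
  moreover have "mean_member (\<lambda>t. \<gamma> (- \<omega>) t *\<^sub>C g t)"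
    by (rule linear_equation_rotated_mean_member[OF g z eq])
  ultimately have "A ?P" by (intro primitive)
  then have "A (\<lambda>t. \<gamma> \<omega> t *\<^sub>C (?P t + \<gamma> (- \<omega>) \<alpha> *\<^sub>C z \<alpha>))"
    by (intro rotate add const)
  then show ?thesis
  proof (rule cong)
    fix t assume "t \<ge> \<alpha>"
    then show "\<gamma> \<omega> t *\<^sub>C (?P t + \<gamma> (- \<omega>) \<alpha> *\<^sub>C z \<alpha>) = z t"
      by (simp add: P scaleC_scaleC \<gamma>_uminus)
  qed
qed

lemma linear_equation_member:
  assumes g: "mean_member g" and z: "continuous_on {\<alpha>..} z"
    and eq: "\<And>t. t \<ge> \<alpha> \<Longrightarrow> z t = z \<alpha> + integral {\<alpha>..t} g + integral {\<alpha>..t} (\<lambda>s. l *\<^sub>C z s)"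
    and l: "Re l \<ge> 0" and U: "U z" and pb: "poly_bounded \<alpha> z"
  shows "A z"
proof (cases "Re l = 0")
  case True
  then have "l = \<i> * of_real (Im l)" by (simp add: complex_eq_iff)
  then show ?thesis using linear_equation_neutral[OF g z _ U, of "Im l"] eq by metis
next
  case False
  then show ?thesis using linear_equation_unstable[OF g z eq _ pb] l by simp
qed

end

section \<open>Polynomial growth of means\<close>

lemma poly_boundedI: "(\<And>t. t \<ge> \<alpha> \<Longrightarrow> norm (z t) \<le> C * (1 + \<bar>t\<bar>) ^ q) \<Longrightarrow> poly_bounded \<alpha> z"
  by (auto simp: poly_bounded_def)

lemma poly_boundedE:
  assumes "poly_bounded \<alpha> z"
  obtains C q where "C \<ge> 0" "\<And>t. t \<ge> \<alpha> \<Longrightarrow> norm (z t) \<le> C * (1 + \<bar>t\<bar>) ^ q"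
proof -
  obtain C q where C: "\<And>t. t \<ge> \<alpha> \<Longrightarrow> norm (z t) \<le> C * (1 + \<bar>t\<bar>) ^ q"
    using assms by (auto simp: poly_bounded_def)
  have "norm (z t) \<le> \<bar>C\<bar> * (1 + \<bar>t\<bar>) ^ q" if "t \<ge> \<alpha>" for t
    by (rule order_trans[OF C[OF that] mult_right_mono[OF abs_ge_self]]) simp
  then show ?thesis using that[of "\<bar>C\<bar>" q] by simp
qed

lemma poly_bounded_cong:
  "poly_bounded \<alpha> u \<Longrightarrow> (\<And>t. t \<ge> \<alpha> \<Longrightarrow> u t = v t) \<Longrightarrow> poly_bounded \<alpha> v"
  unfolding poly_bounded_def by simp

lemma poly_bounded_add:
  assumes "poly_bounded \<alpha> u" "poly_bounded \<alpha> v"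
  shows "poly_bounded \<alpha> (\<lambda>t. u t + v t)"
proof -
  obtain C p where C: "C \<ge> 0" "\<And>t. t \<ge> \<alpha> \<Longrightarrow> norm (u t) \<le> C * (1 + \<bar>t\<bar>) ^ p"
    using assms(1) by (rule poly_boundedE) blast
  obtain D q where D: "D \<ge> 0" "\<And>t. t \<ge> \<alpha> \<Longrightarrow> norm (v t) \<le> D * (1 + \<bar>t\<bar>) ^ q"
    using assms(2) by (rule poly_boundedE) blast
  show ?thesis
  proof (rule poly_boundedI)
    fix t assume t: "t \<ge> \<alpha>"
    have "norm (u t + v t) \<le> C * (1 + \<bar>t\<bar>) ^ p + D * (1 + \<bar>t\<bar>) ^ q"
      by (rule order_trans[OF norm_triangle_ineq add_mono[OF C(2)[OF t] D(2)[OF t]]])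
    also have "\<dots> \<le> C * (1 + \<bar>t\<bar>) ^ (p + q) + D * (1 + \<bar>t\<bar>) ^ (p + q)"
      using C(1) D(1) by (intro add_mono mult_left_mono power_increasing) auto
    finally show "norm (u t + v t) \<le> (C + D) * (1 + \<bar>t\<bar>) ^ (p + q)" by (simp add: distrib_right)
  qed
qed

lemma poly_bounded_bounded_linear:
  assumes u: "poly_bounded \<alpha> u" and T: "bounded_linear T"
  shows "poly_bounded \<alpha> (\<lambda>t. T (u t))"
proof -
  obtain C p where C: "C \<ge> 0" "\<And>t. t \<ge> \<alpha> \<Longrightarrow> norm (u t) \<le> C * (1 + \<bar>t\<bar>) ^ p"
    using u by (rule poly_boundedE) blast
  obtain K where K: "K > 0" "\<And>x. norm (T x) \<le> norm x * K"
    using bounded_linear.pos_bounded[OF T] by blast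
  show ?thesis
  proof (rule poly_boundedI)
    fix t assume t: "t \<ge> \<alpha>"
    have "norm (T (u t)) \<le> (C * (1 + \<bar>t\<bar>) ^ p) * K"
      by (rule order_trans[OF K(2) mult_right_mono[OF C(2)[OF t]]]) (use K(1) in simp)
    then show "norm (T (u t)) \<le> (C * K) * (1 + \<bar>t\<bar>) ^ p" by (simp add: mult_ac)
  qed
qed

lemma affine_power_le: "(K + \<bar>t\<bar>) ^ q \<le> K ^ q * (1 + \<bar>t\<bar>) ^ q" if "K \<ge> 1" for K t :: real
proof -
  have "\<bar>t\<bar> \<le> K * \<bar>t\<bar>" using that mult_right_mono[of 1 K "\<bar>t\<bar>"] by simp
  then have "(K + \<bar>t\<bar>) ^ q \<le> (K * (1 + \<bar>t\<bar>)) ^ q"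
    using that by (intro power_mono) (auto simp: distrib_left)
  then show ?thesis by (simp add: power_mult_distrib)
qed

lemma poly_bounded_shift:
  assumes u: "poly_bounded \<alpha> u"
  shows "poly_bounded \<alpha> (\<lambda>t. u (t + 1))"
proof -
  obtain C p where C: "C \<ge> 0" "\<And>t. t \<ge> \<alpha> \<Longrightarrow> norm (u t) \<le> C * (1 + \<bar>t\<bar>) ^ p"
    using u by (rule poly_boundedE) blast
  show ?thesis
  proof (rule poly_boundedI)
    fix t assume t: "t \<ge> \<alpha>"
    have "norm (u (t + 1)) \<le> C * (1 + \<bar>t + 1\<bar>) ^ p" using t by (intro C(2)) simp
    also have "\<dots> \<le> C * (2 + \<bar>t\<bar>) ^ p" using C(1) by (intro mult_left_mono power_mono) auto
    also have "\<dots> \<le> C * (2 ^ p * (1 + \<bar>t\<bar>) ^ p)" using C(1) by (intro mult_left_mono affine_power_le) auto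
    finally show "norm (u (t + 1)) \<le> (C * 2 ^ p) * (1 + \<bar>t\<bar>) ^ p" by (simp add: mult_ac)
  qed
qed

text \<open>A point \<open>t\<close> is reached from \<open>{\<alpha>..\<alpha> + 1}\<close> by at most \<open>t - \<alpha>\<close> unit steps, so the degree grows by one.\<close>

lemma poly_bounded_if_increments:
  fixes z :: "real \<Rightarrow> 'b::real_normed_vector"
  assumes z: "continuous_on {\<alpha>..} z" and inc: "poly_bounded \<alpha> (\<lambda>t. z (t + 1) - z t)"
  shows "poly_bounded \<alpha> z"
proof -
  obtain C q where C: "C \<ge> 0" "\<And>t. t \<ge> \<alpha> \<Longrightarrow> norm (z (t + 1) - z t) \<le> C * (1 + \<bar>t\<bar>) ^ q"
    using inc by (rule poly_boundedE) blast
  obtain M where M: "M > 0" "\<And>t. t \<in> {\<alpha>..\<alpha> + 1} \<Longrightarrow> norm (z t) \<le> M"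
    using compact_imp_bounded[OF compact_continuous_image[OF continuous_on_subset[OF z] compact_Icc[of \<alpha> "\<alpha> + 1"]]]
    by (auto simp: bounded_pos)
  \<comment> \<open>the constant absorbs \<open>\<alpha>\<close>, the summand 1 of the bound and the last unit step\<close>
  define K where "K = 2 + \<bar>\<alpha>\<bar>"
  show ?thesis
  proof (rule poly_boundedI)
    fix t assume t: "t \<ge> \<alpha>"
    define n where "n = nat \<lfloor>t - \<alpha>\<rfloor>"
    define u where "u = t - real n"
    have n: "real n \<le> t - \<alpha>" "t - \<alpha> < real n + 1" using t by (auto simp: n_def)
    then have u: "u \<in> {\<alpha>..\<alpha> + 1}" by (auto simp: u_def)
    have "z (u + real n) - z u = (\<Sum>j<n. z (u + real j + 1) - z (u + real j))"
      using sum_lessThan_telescope[of "\<lambda>j. z (u + real j)" n] by (simp add: algebra_simps)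
    also have "norm \<dots> \<le> (\<Sum>j<n. C * (K + \<bar>t\<bar>) ^ q)"
    proof (rule sum_norm_le)
      fix j assume j: "j \<in> {..<n}"
      have "norm (z (u + real j + 1) - z (u + real j)) \<le> C * (1 + \<bar>u + real j\<bar>) ^ q"
        using u by (intro C(2)) auto
      also have "\<dots> \<le> C * (K + \<bar>t\<bar>) ^ q"
        using u j C(1) by (intro mult_left_mono power_mono) (auto simp: K_def u_def abs_if)
      finally show "norm (z (u + real j + 1) - z (u + real j)) \<le> C * (K + \<bar>t\<bar>) ^ q" .
    qed
    also have "\<dots> = n * (C * (K + \<bar>t\<bar>) ^ q)" by simp
    also have "\<dots> \<le> (K + \<bar>t\<bar>) * (C * (K + \<bar>t\<bar>) ^ q)"
      using n C(1) by (intro mult_right_mono) (auto simp: K_def)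
    finally have "norm (z t - z u) \<le> C * (K + \<bar>t\<bar>) ^ Suc q" by (simp add: u_def mult_ac)
    also have "\<dots> \<le> C * (K ^ Suc q * (1 + \<bar>t\<bar>) ^ Suc q)"
      using C(1) by (intro mult_left_mono affine_power_le) (auto simp: K_def)
    finally have 1: "norm (z t - z u) \<le> C * (K ^ Suc q * (1 + \<bar>t\<bar>) ^ Suc q)" .
    have "M * 1 \<le> M * (1 + \<bar>t\<bar>) ^ Suc q" using M(1) by (intro mult_left_mono one_le_power) auto
    then have 2: "norm (z u) \<le> M * (1 + \<bar>t\<bar>) ^ Suc q" using M(2)[OF u] by simp
    have "norm (z t) \<le> norm (z u) + norm (z t - z u)" by (rule norm_triangle_sub)
    then show "norm (z t) \<le> (M + C * K ^ Suc q) * (1 + \<bar>t\<bar>) ^ Suc q"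
      using 1 2 by (simp add: distrib_right mult_ac)
  qed
qed

definition unit_mean :: "(real \<Rightarrow> 'b::banach) \<Rightarrow> real \<Rightarrow> 'b" where
  "unit_mean v t = integral {t..t + 1} v"

lemma unit_mean_eq:
  assumes "continuous_on {\<alpha>..} v" "t \<ge> \<alpha>"
  shows "unit_mean v t = integral {\<alpha>..t + 1} v - integral {\<alpha>..t} v"
  unfolding unit_mean_def
  by (rule locally_L1_integral_diff[OF locally_L1_continuous[OF assms(1)] assms(2)]) simp

lemma unit_mean_cong:
  "(\<And>t. t \<ge> \<alpha> \<Longrightarrow> u t = v t) \<Longrightarrow> t \<ge> \<alpha> \<Longrightarrow> unit_mean u t = unit_mean v t"
  unfolding unit_mean_def by (rule integral_cong) simp

lemma integrable_continuous_half_line: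
  fixes v :: "real \<Rightarrow> 'b::banach"
  shows "continuous_on {\<alpha>..} v \<Longrightarrow> a \<ge> \<alpha> \<Longrightarrow> v integrable_on {a..b}"
  by (intro integrable_continuous_real) (rule continuous_on_subset, auto)

lemma unit_mean_add:
  assumes "continuous_on {\<alpha>..} u" "continuous_on {\<alpha>..} v" "t \<ge> \<alpha>"
  shows "unit_mean (\<lambda>t. u t + v t) t = unit_mean u t + unit_mean v t"
  unfolding unit_mean_def
  by (intro Henstock_Kurzweil_Integration.integral_add integrable_continuous_half_line[of \<alpha>] assms)

lemma unit_mean_bounded_linear:
  assumes T: "bounded_linear T" and v: "continuous_on {\<alpha>..} v" and t: "t \<ge> \<alpha>"
  shows "unit_mean (\<lambda>t. T (v t)) t = T (unit_mean v t)"
  unfolding unit_mean_def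
  using integral_linear[OF integrable_continuous_half_line[OF v t] T] by (simp add: o_def)

lemma unit_mean_shift: "unit_mean (\<lambda>t. v (t + 1)) t = unit_mean v (t + 1)"
  unfolding unit_mean_def
  using integral_shift_Icc_real[of t "t + 1" v 1] by (simp add: o_def add.commute)

lemma continuous_on_shift: "continuous_on {\<alpha>..} v \<Longrightarrow> h \<ge> 0 \<Longrightarrow> continuous_on {\<alpha>..} (\<lambda>t::real. v (t + h))"
  by (rule continuous_on_compose2[of "{\<alpha>..}" v]) (auto intro!: continuous_intros)

lemma continuous_on_unit_mean:
  assumes v: "continuous_on {\<alpha>..} v"
  shows "continuous_on {\<alpha>..} (unit_mean v)"
proof (subst continuous_on_cong[OF refl unit_mean_eq[OF v]])
  have "continuous_on {\<alpha>..} (\<lambda>t. integral {\<alpha>..t} v)"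
    by (rule continuous_on_locally_L1_integral[OF locally_L1_continuous[OF v]])
  then show "continuous_on {\<alpha>..} (\<lambda>t. integral {\<alpha>..t + 1} v - integral {\<alpha>..t} v)"
    by (intro continuous_on_diff continuous_on_shift[where v="\<lambda>t. integral {\<alpha>..t} v"]) auto
qed auto

lemma poly_bounded_unit_mean:
  assumes v: "continuous_on {\<alpha>..} v" and pb: "poly_bounded \<alpha> v"
  shows "poly_bounded \<alpha> (unit_mean v)"
proof -
  obtain C q where C: "C \<ge> 0" "\<And>t. t \<ge> \<alpha> \<Longrightarrow> norm (v t) \<le> C * (1 + \<bar>t\<bar>) ^ q"
    using pb by (rule poly_boundedE) blast
  show ?thesis
  proof (rule poly_boundedI)
    fix t assume t: "t \<ge> \<alpha>"
    have "norm (integral {t..t + 1} v) \<le> (C * (2 ^ q * (1 + \<bar>t\<bar>) ^ q)) * (t + 1 - t)"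
    proof (rule integral_bound)
      show "continuous_on {t..t + 1} v" by (rule continuous_on_subset[OF v]) (use t in auto)
      fix s assume s: "s \<in> {t..t + 1}"
      have "norm (v s) \<le> C * (1 + \<bar>s\<bar>) ^ q" using s t by (intro C(2)) auto
      also have "\<dots> \<le> C * (2 + \<bar>t\<bar>) ^ q" using C(1) s by (intro mult_left_mono power_mono) auto
      also have "\<dots> \<le> C * (2 ^ q * (1 + \<bar>t\<bar>) ^ q)" using C(1) by (intro mult_left_mono affine_power_le) auto
      finally show "norm (v s) \<le> C * (2 ^ q * (1 + \<bar>t\<bar>) ^ q)" .
    qed simp
    then show "norm (unit_mean v t) \<le> (C * 2 ^ q) * (1 + \<bar>t\<bar>) ^ q" by (simp add: unit_mean_def mult_ac)
  qed
qed

text \<open>Some iterated unit mean of the continuous function \<open>v\<close> grows at most polynomially. The inductive form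
avoids bookkeeping of the number of means, which differs from function to function.\<close>

inductive mean_poly_bounded :: "real \<Rightarrow> (real \<Rightarrow> 'b::banach) \<Rightarrow> bool" for \<alpha> where
  base: "continuous_on {\<alpha>..} v \<Longrightarrow> poly_bounded \<alpha> v \<Longrightarrow> mean_poly_bounded \<alpha> v"
| step: "continuous_on {\<alpha>..} v \<Longrightarrow> mean_poly_bounded \<alpha> (unit_mean v) \<Longrightarrow> mean_poly_bounded \<alpha> v"

lemma mean_poly_bounded_continuous: "mean_poly_bounded \<alpha> v \<Longrightarrow> continuous_on {\<alpha>..} v"
  by (induction rule: mean_poly_bounded.induct) auto

lemma mean_poly_bounded_cong:
  assumes "mean_poly_bounded \<alpha> u" "\<And>t. t \<ge> \<alpha> \<Longrightarrow> u t = v t"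
  shows "mean_poly_bounded \<alpha> v"
  using assms
proof (induction arbitrary: v rule: mean_poly_bounded.induct)
  case (base u)
  have "continuous_on {\<alpha>..} v" using base(1) by (rule continuous_on_eq) (use base(3) in auto)
  then show ?case using poly_bounded_cong[OF base(2,3)] by (intro mean_poly_bounded.base) auto
next
  case (step u)
  show ?case
  proof (rule mean_poly_bounded.step)
    show "continuous_on {\<alpha>..} v" using step(1) by (rule continuous_on_eq) (use step(4) in auto)
    show "mean_poly_bounded \<alpha> (unit_mean v)" by (rule step.IH) (rule unit_mean_cong[OF step(4)])
  qed
qed

lemma mean_poly_bounded_unit_mean:
  assumes "mean_poly_bounded \<alpha> v"
  shows "mean_poly_bounded \<alpha> (unit_mean v)"
  using assms
proof cases
  case base
  then show ?thesis by (intro mean_poly_bounded.base continuous_on_unit_mean poly_bounded_unit_mean)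
qed

lemma mean_poly_bounded_add_base:
  assumes "mean_poly_bounded \<alpha> v" "continuous_on {\<alpha>..} u" "poly_bounded \<alpha> u"
  shows "mean_poly_bounded \<alpha> (\<lambda>t. u t + v t)"
  using assms
proof (induction arbitrary: u rule: mean_poly_bounded.induct)
  case (base v)
  then show ?case by (intro mean_poly_bounded.base continuous_on_add poly_bounded_add)
next
  case (step v)
  show ?case
  proof (rule mean_poly_bounded.step)
    show "continuous_on {\<alpha>..} (\<lambda>t. u t + v t)" by (intro continuous_on_add step)
    have "mean_poly_bounded \<alpha> (\<lambda>t. unit_mean u t + unit_mean v t)"
      by (intro step.IH continuous_on_unit_mean poly_bounded_unit_mean step)
    then show "mean_poly_bounded \<alpha> (unit_mean (\<lambda>t. u t + v t))"
      by (rule mean_poly_bounded_cong) (simp add: unit_mean_add[OF step(4,1)])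
  qed
qed

lemma mean_poly_bounded_add:
  assumes "mean_poly_bounded \<alpha> u" "mean_poly_bounded \<alpha> v"
  shows "mean_poly_bounded \<alpha> (\<lambda>t. u t + v t)"
  using assms
proof (induction arbitrary: v rule: mean_poly_bounded.induct)
  case (base u)
  then show ?case by (intro mean_poly_bounded_add_base)
next
  case (step u)
  have v: "continuous_on {\<alpha>..} v" by (rule mean_poly_bounded_continuous[OF step(4)])
  show ?case
  proof (rule mean_poly_bounded.step)
    show "continuous_on {\<alpha>..} (\<lambda>t. u t + v t)" by (intro continuous_on_add step v)
    have "mean_poly_bounded \<alpha> (\<lambda>t. unit_mean u t + unit_mean v t)"
      by (intro step.IH mean_poly_bounded_unit_mean step)
    then show "mean_poly_bounded \<alpha> (unit_mean (\<lambda>t. u t + v t))"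
      by (rule mean_poly_bounded_cong) (simp add: unit_mean_add[OF step(1) v])
  qed
qed

lemma mean_poly_bounded_bounded_linear:
  assumes "mean_poly_bounded \<alpha> v" and T: "bounded_linear T"
  shows "mean_poly_bounded \<alpha> (\<lambda>t. T (v t))"
  using assms(1)
proof (induction rule: mean_poly_bounded.induct)
  case (base v)
  then show ?case
    by (intro mean_poly_bounded.base bounded_linear.continuous_on[OF T] poly_bounded_bounded_linear[OF _ T])
next
  case (step v)
  show ?case
  proof (rule mean_poly_bounded.step)
    show "continuous_on {\<alpha>..} (\<lambda>t. T (v t))" by (intro bounded_linear.continuous_on[OF T] step)
    show "mean_poly_bounded \<alpha> (unit_mean (\<lambda>t. T (v t)))"
      using step.IH by (rule mean_poly_bounded_cong) (simp add: unit_mean_bounded_linear[OF T step(1)])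
  qed
qed

lemma mean_poly_bounded_shift:
  assumes "mean_poly_bounded \<alpha> v"
  shows "mean_poly_bounded \<alpha> (\<lambda>t. v (t + 1))"
  using assms
proof (induction rule: mean_poly_bounded.induct)
  case (base v)
  then show ?case by (intro mean_poly_bounded.base continuous_on_shift poly_bounded_shift) auto
next
  case (step v)
  show ?case
  proof (rule mean_poly_bounded.step)
    show "continuous_on {\<alpha>..} (\<lambda>t. v (t + 1))" by (intro continuous_on_shift step) simp
    show "mean_poly_bounded \<alpha> (unit_mean (\<lambda>t. v (t + 1)))"
      using step.IH by (rule mean_poly_bounded_cong) (simp add: unit_mean_shift)
  qed
qed

lemma mean_poly_bounded_sum:
  "(\<And>i. i \<in> I \<Longrightarrow> mean_poly_bounded \<alpha> (f i)) \<Longrightarrow> mean_poly_bounded \<alpha> (\<lambda>t. \<Sum>i\<in>I. f i t)"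
proof (induction I rule: infinite_finite_induct)
  case (insert x F)
  then show ?case by (simp add: mean_poly_bounded_add)
qed (auto intro!: mean_poly_bounded.base poly_boundedI[where C=0])

text \<open>The unit mean of the derivative is the unit increment of \<open>v\<close>.\<close>

lemma mean_poly_bounded_derivative:
  assumes v: "mean_poly_bounded \<alpha> v" and w: "continuous_on {\<alpha>..} w"
    and deriv: "\<And>t. t \<ge> \<alpha> \<Longrightarrow> (v has_vector_derivative w t) (at t within {\<alpha>..})"
  shows "mean_poly_bounded \<alpha> w"
proof (rule mean_poly_bounded.step[OF w])
  have "mean_poly_bounded \<alpha> (\<lambda>t. v (t + 1) + - v t)"
    by (intro mean_poly_bounded_add mean_poly_bounded_shift mean_poly_bounded_bounded_linear[OF v] v
        bounded_linear_minus bounded_linear_ident)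
  then show "mean_poly_bounded \<alpha> (unit_mean w)"
  proof (rule mean_poly_bounded_cong)
    fix t assume t: "t \<ge> \<alpha>"
    have "(w has_integral (v (t + 1) - v t)) {t..t + 1}"
      using t by (intro fundamental_theorem_of_calculus)
        (auto intro!: has_vector_derivative_within_subset[OF deriv])
    then show "v (t + 1) + - v t = unit_mean w t" by (simp add: unit_mean_def integral_unique)
  qed
qed

lemma mean_poly_bounded_M_iter:
  assumes "v \<in> M_iter s {\<alpha>..} (O_cls q {\<alpha>..})" "continuous_on {\<alpha>..} v"
  shows "mean_poly_bounded \<alpha> v"
  using assms
proof (induction s arbitrary: v)
  case 0
  then obtain C where C: "\<And>t. t \<ge> \<alpha> \<Longrightarrow> norm (v t /\<^sub>R (1 + \<bar>t\<bar>) ^ q) \<le> C"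
    by (auto simp: O_cls_def bdd_above_def)
  have "norm (v t) \<le> C * (1 + \<bar>t\<bar>) ^ q" if "t \<ge> \<alpha>" for t
  proof -
    have p: "(1 + \<bar>t\<bar>) ^ q > 0" by (intro zero_less_power) simp
    have "norm (v t) / (1 + \<bar>t\<bar>) ^ q \<le> C" using C[OF that] p by (simp add: divide_inverse mult.commute)
    then show ?thesis using p by (simp add: pos_divide_le_eq)
  qed
  then show ?case using 0 by (intro mean_poly_bounded.base poly_boundedI)
next
  case (Suc s)
  have "v \<in> M_cls {\<alpha>..} (M_iter s {\<alpha>..} (O_cls q {\<alpha>..}))" using Suc.prems by simp
  then have "mean {\<alpha>..} 1 v \<in> M_iter s {\<alpha>..} (O_cls q {\<alpha>..})" by (simp add: M_cls_def)
  moreover have "mean {\<alpha>..} 1 v = restrict (unit_mean v) {\<alpha>..}"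
    using mean_eq[OF locally_L1_continuous[OF Suc.prems(2)], of 1] by (simp add: unit_mean_def[abs_def])
  ultimately have "restrict (unit_mean v) {\<alpha>..} \<in> M_iter s {\<alpha>..} (O_cls q {\<alpha>..})" by simp
  moreover have "continuous_on {\<alpha>..} (restrict (unit_mean v) {\<alpha>..})"
    by (rule continuous_on_eq[OF continuous_on_unit_mean[OF Suc.prems(2)]]) simp
  ultimately have "mean_poly_bounded \<alpha> (restrict (unit_mean v) {\<alpha>..})" by (rule Suc.IH)
  then have "mean_poly_bounded \<alpha> (unit_mean v)" by (rule mean_poly_bounded_cong) simp
  then show ?case by (rule mean_poly_bounded.step[OF Suc.prems(2)])
qed

text \<open>The equation is preserved under taking unit means. So if \<open>unit_mean z\<close> is polynomially bounded, the
increments of \<open>z\<close> are, and then \<open>z\<close> is; this removes one mean from the hypothesis.\<close>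

lemma poly_bounded_if_unit_increment:
  fixes z G :: "real \<Rightarrow> 'b::banach" and T :: "'b \<Rightarrow> 'b"
  assumes "mean_poly_bounded \<alpha> z" and T: "bounded_linear T"
    and "continuous_on {\<alpha>..} G" "poly_bounded \<alpha> G"
    and "\<And>t. t \<ge> \<alpha> \<Longrightarrow> z (t + 1) - z t = T (unit_mean z t) + G t"
  shows "poly_bounded \<alpha> z"
  using assms(1,3-)
proof (induction arbitrary: G rule: mean_poly_bounded.induct)
  case (step z)
  have m: "continuous_on {\<alpha>..} (unit_mean z)" by (rule continuous_on_unit_mean[OF step(1)])
  have pm: "poly_bounded \<alpha> (unit_mean z)"
  proof (rule step.IH[of "unit_mean G"])
    show "continuous_on {\<alpha>..} (unit_mean G)" by (rule continuous_on_unit_mean[OF step(4)])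
    show "poly_bounded \<alpha> (unit_mean G)" by (rule poly_bounded_unit_mean[OF step(4,5)])
    fix t assume t: "t \<ge> \<alpha>"
    have "unit_mean z (t + 1) = unit_mean (\<lambda>t. z (t + 1)) t" by (simp add: unit_mean_shift)
    also have "\<dots> = unit_mean (\<lambda>t. z t + (T (unit_mean z t) + G t)) t"
    proof (rule unit_mean_cong[OF _ t])
      show "z (t + 1) = z t + (T (unit_mean z t) + G t)" if "t \<ge> \<alpha>" for t
        using step(6)[OF that] by (metis add.commute diff_add_cancel)
    qed
    also have "\<dots> = unit_mean z t + (T (unit_mean (unit_mean z) t) + unit_mean G t)"
      using t step(1,4) m
      by (simp add: unit_mean_add[of \<alpha>] continuous_on_add bounded_linear.continuous_on[OF T]
          unit_mean_bounded_linear[OF T, of \<alpha>])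
    finally show "unit_mean z (t + 1) - unit_mean z t = T (unit_mean (unit_mean z) t) + unit_mean G t" by simp
  qed
  have "poly_bounded \<alpha> (\<lambda>t. T (unit_mean z t) + G t)"
    by (intro poly_bounded_add poly_bounded_bounded_linear[OF pm T] step(5))
  then have "poly_bounded \<alpha> (\<lambda>t. z (t + 1) - z t)"
    by (rule poly_bounded_cong) (simp add: step(6))
  then show ?case by (rule poly_bounded_if_increments[OF step(1)])
qed

lemma (in half_line_class) linear_equation_poly_bounded:
  assumes g: "mean_member g" and z: "mean_poly_bounded \<alpha> z"
    and eq: "\<And>t. t \<ge> \<alpha> \<Longrightarrow> z t = z \<alpha> + integral {\<alpha>..t} g + integral {\<alpha>..t} (\<lambda>s. l *\<^sub>C z s)"
  shows "poly_bounded \<alpha> z"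
proof (rule poly_bounded_if_unit_increment[OF z scaleC.bounded_linear_right[of l]])
  let ?G = "\<lambda>t. integral {\<alpha>..t + 1} g - integral {\<alpha>..t} g"
  have G: "A ?G" by (rule mean_member_increment[OF g]) simp
  show "continuous_on {\<alpha>..} ?G" by (rule continuous[OF G])
  obtain B where "\<And>t. t \<ge> \<alpha> \<Longrightarrow> norm (?G t) \<le> B" using bounded[OF G] by blast
  then show "poly_bounded \<alpha> ?G" by (intro poly_boundedI[where C=B and q=0]) simp
  have zc: "continuous_on {\<alpha>..} z" by (rule mean_poly_bounded_continuous[OF z])
  fix t assume t: "t \<ge> \<alpha>"
  have lz: "continuous_on {\<alpha>..} (\<lambda>s. l *\<^sub>C z s)" by (intro scaleC.continuous_on continuous_on_const zc)
  have "z (t + 1) - z t = ?G t + (integral {\<alpha>..t + 1} (\<lambda>s. l *\<^sub>C z s) - integral {\<alpha>..t} (\<lambda>s. l *\<^sub>C z s))"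
    using eq[of t] eq[of "t + 1"] t by simp
  also have "integral {\<alpha>..t + 1} (\<lambda>s. l *\<^sub>C z s) - integral {\<alpha>..t} (\<lambda>s. l *\<^sub>C z s) = unit_mean (\<lambda>s. l *\<^sub>C z s) t"
    by (rule unit_mean_eq[OF lz t, symmetric])
  also have "\<dots> = l *\<^sub>C unit_mean z t" by (rule unit_mean_bounded_linear[OF scaleC.bounded_linear_right zc t])
  finally show "z (t + 1) - z t = l *\<^sub>C unit_mean z t + ?G t" by simp
qed

section \<open>An induction along the eigenvalues of a linear operator\<close>

text \<open>Gaussian elimination of one index at a time.\<close>

lemma linear_dependence:
  fixes v :: "'j \<Rightarrow> 'i \<Rightarrow> complex"
  assumes "finite I" "finite J" "card I < card J"
  shows "\<exists>c. (\<exists>j\<in>J. c j \<noteq> 0) \<and> (\<forall>i\<in>I. (\<Sum>j\<in>J. c j * v j i) = 0)"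
  using assms
proof (induction I arbitrary: J v rule: finite_induct)
  case empty
  then have "J \<noteq> {}" by auto
  then show ?case by (intro exI[of _ "\<lambda>_. 1"]) auto
next
  case (insert i0 I)
  show ?case
  proof (cases "\<exists>j\<in>J. v j i0 \<noteq> 0")
    case False
    obtain c where "\<exists>j\<in>J. c j \<noteq> 0" "\<forall>i\<in>I. (\<Sum>j\<in>J. c j * v j i) = 0"
      using insert.IH[of J v] insert.prems insert.hyps by auto
    then show ?thesis using False by (intro exI[of _ c]) auto
  next
    case True
    then obtain j0 where j0: "j0 \<in> J" "v j0 i0 \<noteq> 0" by blast
    define w where "w j i = v j i - v j i0 / v j0 i0 * v j0 i" for j i
    have "card I < card (J - {j0})" using insert.prems insert.hyps j0 by simp
    then obtain c where c: "\<exists>j\<in>J - {j0}. c j \<noteq> 0" "\<forall>i\<in>I. (\<Sum>j\<in>J - {j0}. c j * w j i) = 0"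
      using insert.IH[of "J - {j0}" w] insert.prems by auto
    \<comment> \<open>the coefficient of the pivot cancels the subtracted multiples of \<open>v j0\<close>\<close>
    define c' where "c' = c(j0 := - (\<Sum>j\<in>J - {j0}. c j * v j i0 / v j0 i0))"
    have sum: "(\<Sum>j\<in>J. c' j * v j i) = (\<Sum>j\<in>J - {j0}. c j * w j i)" for i
    proof -
      have "(\<Sum>j\<in>J. c' j * v j i) = c' j0 * v j0 i + (\<Sum>j\<in>J - {j0}. c' j * v j i)"
        using insert.prems(1) j0(1) by (rule sum.remove)
      also have "(\<Sum>j\<in>J - {j0}. c' j * v j i) = (\<Sum>j\<in>J - {j0}. c j * v j i)"
        by (intro sum.cong) (auto simp: c'_def)
      also have "c' j0 * v j0 i = - (\<Sum>j\<in>J - {j0}. c j * v j i0 / v j0 i0 * v j0 i)"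
        by (simp add: c'_def sum_distrib_right)
      finally show ?thesis by (simp add: w_def right_diff_distrib sum_subtractf mult.assoc)
    qed
    have "w j i0 = 0" for j using j0(2) by (simp add: w_def)
    then have "(\<Sum>j\<in>J. c' j * v j i) = 0" if "i \<in> insert i0 I" for i
      using that c(2) unfolding sum by auto
    moreover have "\<exists>j\<in>J. c' j \<noteq> 0" using c(1) by (auto simp: c'_def)
    ultimately show ?thesis by blast
  qed
qed

text \<open>Some nonzero polynomial in \<open>B\<close> annihilates \<open>\<xi>\<close>, by linear dependence of the iterates \<open>B\<^sup>j \<xi>\<close>. Let \<open>l\<close> be a root
and \<open>q'\<close> the cofactor. If \<open>S l\<close>, then \<open>q'\<close> annihilates \<open>(B - l) \<xi>\<close>, and the property of this vector is
pulled back to \<open>\<xi>\<close>. Otherwise \<open>B - l\<close> is injective and \<open>q'\<close> already annihilates \<open>\<xi>\<close>. In both cases the degree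
drops.\<close>

lemma operator_eigenvalue_induct:
  fixes B :: "('i \<Rightarrow> complex) \<Rightarrow> 'i \<Rightarrow> complex"
  assumes I: "finite I"
    and lin: "\<And>c d \<xi> \<eta>. B (\<lambda>i. c * \<xi> i + d * \<eta> i) = (\<lambda>i. c * B \<xi> i + d * B \<eta> i)"
    and range: "\<And>\<xi> i. i \<notin> I \<Longrightarrow> B \<xi> i = 0"
    and zero: "P (\<lambda>_. 0)"
    and pull: "\<And>\<xi> l. S l \<Longrightarrow> P (\<lambda>i. B \<xi> i - l * \<xi> i) \<Longrightarrow> P \<xi>"
    and inj: "\<And>\<xi> l. \<not> S l \<Longrightarrow> (\<And>i. i \<notin> I \<Longrightarrow> \<xi> i = 0) \<Longrightarrow> (\<And>i. B \<xi> i = l * \<xi> i) \<Longrightarrow> \<xi> = (\<lambda>_. 0)"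
    and \<xi>: "\<And>i. i \<notin> I \<Longrightarrow> \<xi> i = 0"
  shows "P \<xi>"
proof -
  define ap where "ap N q \<xi> i = (\<Sum>j\<le>N. coeff q j * (B ^^ j) \<xi> i)" for N :: nat and q \<xi> i
  have linB: "B (\<lambda>i. c * \<xi> i) = (\<lambda>i. c * B \<xi> i)" for c \<xi>
    using lin[of c \<xi> 0 \<xi>] by simp
  have B0: "B (\<lambda>_. 0) = (\<lambda>_. 0)" using linB[of 0 "\<lambda>_. 0"] by simp
  have sumB: "B (\<lambda>i. \<Sum>j\<in>J. f j i) = (\<lambda>i. \<Sum>j\<in>J. B (f j) i)" if "finite J" for J :: "nat set" and f
    using that
  proof (induction J rule: finite_induct)
    case (insert x F)
    then show ?case using lin[of 1 "f x" 1 "\<lambda>i. \<Sum>j\<in>F. f j i"] by simp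
  qed (simp add: B0)
  have powlin: "(B ^^ j) (\<lambda>i. c * \<xi> i + d * \<eta> i) = (\<lambda>i. c * (B ^^ j) \<xi> i + d * (B ^^ j) \<eta> i)" for j c d \<xi> \<eta>
    by (induction j) (simp_all add: lin)
  have factor: "ap (Suc N) ([:- l, 1:] * q) \<xi> i = (\<Sum>j\<le>N. coeff q j * (B ^^ j) (B \<xi>) i) - l * ap N q \<xi> i"
    if "degree q \<le> N" for N q l \<xi> i
  proof -
    have c: "coeff ([:- l, 1:] * q) j = (case j of 0 \<Rightarrow> 0 | Suc k \<Rightarrow> coeff q k) - l * coeff q j" for j
      by (cases j) (simp_all add: coeff_pCons)
    have "ap (Suc N) ([:- l, 1:] * q) \<xi> i =
      (\<Sum>j\<le>Suc N. (case j of 0 \<Rightarrow> 0 | Suc k \<Rightarrow> coeff q k) * (B ^^ j) \<xi> i) - l * (\<Sum>j\<le>Suc N. coeff q j * (B ^^ j) \<xi> i)"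
      by (simp only: ap_def c left_diff_distrib sum_subtractf sum_distrib_left mult.assoc)
    also have "(\<Sum>j\<le>Suc N. (case j of 0 \<Rightarrow> 0 | Suc k \<Rightarrow> coeff q k) * (B ^^ j) \<xi> i) =
        (\<Sum>j\<le>N. coeff q j * (B ^^ j) (B \<xi>) i)"
      by (subst sum.atMost_Suc_shift) (simp add: funpow_swap1)
    also have "(\<Sum>j\<le>Suc N. coeff q j * (B ^^ j) \<xi> i) = ap N q \<xi> i"
      using that by (simp add: ap_def coeff_eq_0)
    finally show ?thesis .
  qed
  have main: "P \<xi>" if "q \<noteq> 0" "degree q \<le> N" "\<And>i. ap N q \<xi> i = 0" "\<And>i. i \<notin> I \<Longrightarrow> \<xi> i = 0" for q N \<xi>
    using that
  proof (induction N arbitrary: q \<xi>)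
    case 0
    then have "coeff q 0 \<noteq> 0" by (metis le_zero_eq leading_coeff_0_iff)
    then have "\<xi> i = 0" for i using 0(3)[of i] by (simp add: ap_def)
    then have "\<xi> = (\<lambda>_. 0)" by auto
    then show ?case using zero by simp
  next
    case (Suc N)
    show ?case
    proof (cases "degree q = 0")
      case True
      then have c0: "coeff q 0 \<noteq> 0" using Suc.prems(1) by (metis leading_coeff_0_iff)
      have "(\<Sum>j\<le>Suc N. coeff q j * (B ^^ j) \<xi> i) = coeff q 0 * \<xi> i" for i
        using True by (subst sum.atMost_Suc_shift) (simp add: coeff_eq_0)
      then have "\<xi> i = 0" for i using Suc.prems(3)[of i] c0 by (simp add: ap_def)
      then have "\<xi> = (\<lambda>_. 0)" by auto
      then show ?thesis using zero by simp
    next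
      case False
      then obtain l where "poly q l = 0"
        using fundamental_theorem_of_algebra[of q] constant_degree[of q] by auto
      then obtain q' where q': "q = [:- l, 1:] * q'" by (metis dvdE poly_eq_0_iff_dvd)
      have nz: "q' \<noteq> 0" using Suc.prems(1) q' by auto
      have "degree q = Suc (degree q')" unfolding q' using nz by (subst degree_mult_eq) auto
      then have deg: "degree q' \<le> N" using Suc.prems(2) by simp
      have ann: "(\<Sum>j\<le>N. coeff q' j * (B ^^ j) (B \<xi>) i) - l * ap N q' \<xi> i = 0" for i
        using Suc.prems(3)[of i] factor[OF deg, of l \<xi> i] unfolding q' by simp
      show ?thesis
      proof (cases "S l")
        case True
        show ?thesis
        proof (rule pull[OF True], rule Suc.IH[OF nz deg])
          fix i
          have "(B ^^ j) (\<lambda>i. B \<xi> i - l * \<xi> i) i = (B ^^ j) (B \<xi>) i - l * (B ^^ j) \<xi> i" for j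
            using fun_cong[OF powlin[of j 1 "B \<xi>" "- l" \<xi>], of i] by simp
          then show "ap N q' (\<lambda>i. B \<xi> i - l * \<xi> i) i = 0"
            using ann[of i] by (simp add: ap_def right_diff_distrib sum_subtractf sum_distrib_left mult.left_commute)
        next
          fix i assume "i \<notin> I"
          then show "B \<xi> i - l * \<xi> i = 0" using range Suc.prems(4) by simp
        qed
      next
        case False
        have supp: "(B ^^ j) \<xi> i = 0" if "i \<notin> I" for i j
          using that Suc.prems(4) range by (cases j) auto
        have "ap N q' \<xi> = (\<lambda>_. 0)"
        proof (rule inj[OF False])
          show "ap N q' \<xi> i = 0" if "i \<notin> I" for i using supp[OF that] by (simp add: ap_def)
          fix i
          have "B (ap N q' \<xi>) i = (\<Sum>j\<le>N. coeff q' j * (B ^^ j) (B \<xi>) i)"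
            unfolding ap_def[abs_def] by (simp add: sumB linB funpow_swap1)
          then show "B (ap N q' \<xi>) i = l * ap N q' \<xi> i" using ann[of i] by simp
        qed
        then show ?thesis using Suc.prems(4) by (intro Suc.IH[OF nz deg]) (simp_all add: fun_eq_iff)
      qed
    qed
  qed
  obtain c where c: "\<exists>j\<in>{..card I}. c j \<noteq> 0" "\<forall>i\<in>I. (\<Sum>j\<le>card I. c j * (B ^^ j) \<xi> i) = 0"
    using linear_dependence[OF I, of "{..card I}" "\<lambda>j. (B ^^ j) \<xi>"] by auto
  define q where "q = (\<Sum>j\<le>card I. monom (c j) j)"
  have cq: "coeff q j = (if j \<le> card I then c j else 0)" for j
    by (simp add: q_def coeff_sum sum.delta)
  show ?thesis
  proof (rule main)
    show "q \<noteq> 0" using c(1) cq by (metis atMost_iff coeff_0)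
    show "degree q \<le> card I" by (rule degree_le) (simp add: cq)
    fix i
    show "ap (card I) q \<xi> i = 0"
    proof (cases "i \<in> I")
      case True
      then show ?thesis using c(2) by (simp add: ap_def cq)
    next
      case False
      have "(B ^^ j) \<xi> i = 0" for j using False \<xi> range by (cases j) auto
      then show ?thesis by (simp add: ap_def)
    qed
  qed (rule \<xi>)
qed

section \<open>Reduction of the system to its companion operator\<close>

lemma integral_vec_nth:
  fixes f :: "real \<Rightarrow> 'b::banach ^ 'r::finite"
  assumes "f integrable_on S"
  shows "integral S (\<lambda>t. f t $ i) = integral S f $ i"
  using integral_linear[OF assms bounded_linear_vec_nth[of i]] by (simp add: o_def)

text \<open>Collects the closure properties that follow from maximality. A function belongs to the class if it
agrees on the half line with a member of \<open>R\<close>, whatever its values elsewhere.\<close>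

lemma half_line_class_hull:
  fixes V R :: "(real \<Rightarrow> 'a::complex_banach) set"
  assumes R: "is_rec_urc V R"
  shows "half_line_class \<alpha> (\<lambda>f. \<exists>F\<in>R. \<forall>t\<ge>\<alpha>. f t = F t)"
proof
  fix f g :: "real \<Rightarrow> 'a" and c :: complex and x :: 'a and h \<omega> :: real
  show "\<exists>F\<in>R. \<forall>t\<ge>\<alpha>. x = F t" by (rule bexI[OF _ hull_const[OF R, of x]]) simp
  show "\<exists>F\<in>R. \<forall>t\<ge>\<alpha>. g t = F t" if *: "\<exists>F\<in>R. \<forall>t\<ge>\<alpha>. f t = F t" "\<And>t. t \<ge> \<alpha> \<Longrightarrow> f t = g t"
    using * by metis
  show "\<exists>F\<in>R. \<forall>t\<ge>\<alpha>. f t + g t = F t" if *: "\<exists>F\<in>R. \<forall>t\<ge>\<alpha>. f t = F t" "\<exists>F\<in>R. \<forall>t\<ge>\<alpha>. g t = F t"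
  proof -
    obtain F G where "F \<in> R" "G \<in> R" "\<forall>t\<ge>\<alpha>. f t = F t" "\<forall>t\<ge>\<alpha>. g t = G t" using * by blast
    then show ?thesis by (intro bexI[of _ "\<lambda>t. F t + G t"] hull_add[OF R]) auto
  qed
  show "\<exists>F\<in>R. \<forall>t\<ge>\<alpha>. c *\<^sub>C f t = F t" if *: "\<exists>F\<in>R. \<forall>t\<ge>\<alpha>. f t = F t"
  proof -
    obtain F where F: "F \<in> R" "\<forall>t\<ge>\<alpha>. f t = F t" using * by blast
    show ?thesis
      by (rule bexI[OF _ hull_bounded_linear[OF R F(1) scaleC.bounded_linear_right[of c]]]) (simp add: F(2))
  qed
  show "\<exists>F\<in>R. \<forall>t\<ge>\<alpha>. f (t + h) = F t" if *: "\<exists>F\<in>R. \<forall>t\<ge>\<alpha>. f t = F t" "h \<ge> 0"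
  proof -
    obtain F where F: "F \<in> R" "\<forall>t\<ge>\<alpha>. f t = F t" using * by blast
    show ?thesis by (rule bexI[OF _ hull_shift[OF R F(1), of h]]) (use F(2) *(2) in simp)
  qed
  show "\<exists>F\<in>R. \<forall>t\<ge>\<alpha>. \<gamma> \<omega> t *\<^sub>C f t = F t" if *: "\<exists>F\<in>R. \<forall>t\<ge>\<alpha>. f t = F t"
  proof -
    obtain F where F: "F \<in> R" "\<forall>t\<ge>\<alpha>. f t = F t" using * by blast
    show ?thesis by (rule bexI[OF _ hull_\<gamma>[OF R F(1), of \<omega>]]) (simp add: F(2))
  qed
  show "\<exists>F\<in>R. \<forall>t\<ge>\<alpha>. f t = F t"
    if *: "\<And>e. e > 0 \<Longrightarrow> \<exists>g. (\<exists>F\<in>R. \<forall>t\<ge>\<alpha>. g t = F t) \<and> (\<forall>t\<ge>\<alpha>. norm (f t - g t) \<le> e)"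
  proof (rule hull_uniform_limit_on_half_line[OF R])
    fix e :: real assume "e > 0"
    from *[OF this] show "\<exists>F\<in>R. \<forall>t\<ge>\<alpha>. norm (f t - F t) \<le> e" by metis
  qed
  show "uniformly_continuous_on {\<alpha>..} f" if *: "\<exists>F\<in>R. \<forall>t\<ge>\<alpha>. f t = F t"
  proof -
    obtain F where F: "F \<in> R" "\<forall>t\<ge>\<alpha>. f t = F t" using * by blast
    then show ?thesis
      using hull_uniformly_continuous[OF R F(1)] unfolding uniformly_continuous_on_def by (metis UNIV_I atLeast_iff)
  qed
  show "\<exists>B. \<forall>t\<ge>\<alpha>. norm (f t) \<le> B" if *: "\<exists>F\<in>R. \<forall>t\<ge>\<alpha>. f t = F t"
    using * hull_bounded[OF R] by metis
qed

text \<open>The transposed block companion operator: it acts on the coefficients of a linear combination of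
\<open>y, y', \<dots>, y\<^bsup>(n-1)\<^esup>\<close> as differentiation acts on the combination, up to the inhomogeneity. Coefficients of
index at least \<open>n\<close> are set to zero, so that the operator maps into a finite-dimensional space.\<close>

definition companion :: "nat \<Rightarrow> (nat \<Rightarrow> complex^'r^'r) \<Rightarrow> (nat \<times> 'r::finite \<Rightarrow> complex) \<Rightarrow> nat \<times> 'r \<Rightarrow> complex" where
  "companion n a \<xi> = (\<lambda>(k, j). if k < n then
     (if k = 0 then 0 else \<xi> (k - 1, j)) - (\<Sum>i\<in>UNIV. \<xi> (n - 1, i) * a k $ i $ j) else 0)"

lemma companion_linear:
  "companion n a (\<lambda>i. c * \<xi> i + d * \<eta> i) = (\<lambda>i. c * companion n a \<xi> i + d * companion n a \<eta> i)"
  by (auto simp: companion_def fun_eq_iff sum.distrib sum_distrib_left algebra_simps)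

text \<open>The last block \<open>\<eta>\<close> of an eigenvector satisfies \<open>\<eta> L(l) = 0\<close>, as the sum of its block equations weighted with
the powers of \<open>l\<close> telescopes. If \<open>L(l)\<close> is invertible, \<open>\<eta>\<close> vanishes, and the block equations then force the
other blocks to vanish, from the last to the first.\<close>

lemma companion_eigenvector_imp_\<sigma>_L:
  fixes a :: "nat \<Rightarrow> complex^'r::finite^'r"
  assumes n: "n \<ge> 1" and l: "l \<notin> \<sigma>_L n a"
    and supp: "\<And>k i. k \<ge> n \<Longrightarrow> \<xi> (k, i) = 0"
    and eig: "\<And>k i. companion n a \<xi> (k, i) = l * \<xi> (k, i)"
  shows "\<xi> = (\<lambda>_. 0)"
proof -
  obtain p where p: "n = Suc p" using n by (cases n) auto
  define L where "L = mat (l ^ n) + (\<Sum>k<n. (\<chi> i j. l ^ k * a k $ i $ j))"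
  define \<eta> :: "complex^'r" where "\<eta> = (\<chi> i. \<xi> (p, i))"
  have entry: "L $ i $ j = (if i = j then l ^ n else 0) + (\<Sum>k<n. l ^ k * a k $ i $ j)" for i j
    by (simp add: L_def mat_def sum_component)
  have c: "(if k = 0 then 0 else \<xi> (k - 1, j)) - (\<Sum>i\<in>UNIV. \<eta> $ i * a k $ i $ j) = l * \<xi> (k, j)" if "k < n" for k j
    using eig[of k j] that by (simp add: companion_def \<eta>_def p)
  have "\<eta> v* L = 0"
  proof (simp only: vec_eq_iff, rule allI)
    fix j
    have "(\<Sum>k<n. l ^ k * ((if k = 0 then 0 else \<xi> (k - 1, j)) - (\<Sum>i\<in>UNIV. \<eta> $ i * a k $ i $ j)))
        = (\<Sum>k<n. l ^ k * (l * \<xi> (k, j)))"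
      using c by (intro sum.cong) auto
    moreover have "(\<Sum>k<n. l ^ k * (if k = 0 then 0 else \<xi> (k - 1, j))) = (\<Sum>k<p. l ^ k * (l * \<xi> (k, j)))"
      unfolding p by (subst sum.lessThan_Suc_shift) (simp add: mult_ac)
    moreover have "(\<Sum>k<n. l ^ k * (l * \<xi> (k, j))) = (\<Sum>k<p. l ^ k * (l * \<xi> (k, j))) + l ^ n * \<eta> $ j"
      unfolding p by (simp add: \<eta>_def mult_ac)
    ultimately have "l ^ n * \<eta> $ j = - (\<Sum>k<n. l ^ k * (\<Sum>i\<in>UNIV. \<eta> $ i * a k $ i $ j))"
      by (simp add: right_diff_distrib sum_subtractf)
    then have "l ^ n * \<eta> $ j + (\<Sum>k<n. l ^ k * (\<Sum>i\<in>UNIV. \<eta> $ i * a k $ i $ j)) = 0"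
      by simp
    moreover have "(\<eta> v* L) $ j = l ^ n * \<eta> $ j + (\<Sum>k<n. l ^ k * (\<Sum>i\<in>UNIV. \<eta> $ i * a k $ i $ j))"
    proof -
      have "(\<eta> v* L) $ j = (\<Sum>i\<in>UNIV. (if i = j then l ^ n * \<eta> $ i else 0) + (\<Sum>k<n. l ^ k * a k $ i $ j) * \<eta> $ i)"
        unfolding vector_matrix_mult_def vec_lambda_beta
        by (rule sum.cong) (auto simp: entry distrib_right distrib_left mult.commute)
      also have "\<dots> = l ^ n * \<eta> $ j + (\<Sum>i\<in>UNIV. \<Sum>k<n. l ^ k * (\<eta> $ i * a k $ i $ j))"
        by (simp add: sum.distrib sum_distrib_left mult_ac)
      also have "(\<Sum>i\<in>UNIV. \<Sum>k<n. l ^ k * (\<eta> $ i * a k $ i $ j)) = (\<Sum>k<n. l ^ k * (\<Sum>i\<in>UNIV. \<eta> $ i * a k $ i $ j))"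
        by (subst sum.swap) (simp add: sum_distrib_left)
      finally show ?thesis .
    qed
    ultimately show "(\<eta> v* L) $ j = 0 $ j" by simp
  qed
  moreover have "invertible L"
    using l by (simp add: invertible_det_nz \<sigma>_L_def L_def)
  then obtain L' where "L ** L' = mat 1" by (auto simp: invertible_def)
  then have "\<eta> = (\<eta> v* L) v* L'" by (simp add: vector_matrix_mul_assoc)
  ultimately have \<eta>0: "\<eta> = 0" by (simp add: vector_matrix_mult_0)
  have "\<xi> (p - d, j) = 0" if "d \<le> p" for d j
    using that
  proof (induction d)
    case 0
    then show ?case using \<eta>0 by (metis \<eta>_def diff_zero vec_lambda_beta zero_index)
  next
    case (Suc d)
    then have "\<xi> (p - d, j) = 0" by simp
    moreover have "p - d \<noteq> 0" "p - d < n" "p - d - 1 = p - Suc d" using Suc.prems p by auto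
    ultimately show ?case using c[of "p - d" j] \<eta>0 by simp
  qed
  then have "\<xi> (k, j) = 0" if "k \<le> p" for k j using that diff_diff_cancel[of k p] by (metis diff_le_self)
  then have "\<xi> (k, j) = 0" for k j using supp[of k j] p by (cases "k \<le> p") auto
  then show ?thesis by auto
qed

definition combination :: "nat \<Rightarrow> (nat \<Rightarrow> real \<Rightarrow> 'a::complex_banach^'r::finite) \<Rightarrow> (nat \<times> 'r \<Rightarrow> complex) \<Rightarrow> real \<Rightarrow> 'a" where
  "combination n D \<xi> t = (\<Sum>k<n. \<Sum>i\<in>UNIV. \<xi> (k, i) *\<^sub>C (D k t $ i))"

lemma combination_linear:
  "combination n D (\<lambda>i. c * \<xi> i + d * \<eta> i) t = c *\<^sub>C combination n D \<xi> t + d *\<^sub>C combination n D \<eta> t"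
  by (simp add: combination_def scaleC_add_left scaleC_scaleC[symmetric] sum.distrib scaleC.sum_right)

lemma combination_companion:
  fixes D :: "nat \<Rightarrow> real \<Rightarrow> 'a::complex_banach^'r::finite"
    and f :: "real \<Rightarrow> 'a^'r" and a :: "nat \<Rightarrow> complex^'r^'r"
  assumes n: "n \<ge> 1"
  defines "E \<equiv> \<lambda>k s. if k < n - 1 then D (Suc k) s else f s - (\<Sum>k<n. matC (a k) (D k s))"
  shows "(\<Sum>k<n. \<Sum>i\<in>UNIV. \<xi> (k, i) *\<^sub>C (E k s $ i)) =
    (\<Sum>i\<in>UNIV. \<xi> (n - 1, i) *\<^sub>C (f s $ i)) + combination n D (companion n a \<xi>) s"
proof -
  obtain p where p: "n = Suc p" using n by (cases n) auto
  have mat: "(\<Sum>i\<in>UNIV. \<xi> (p, i) *\<^sub>C (matC (a k) (D k s) $ i)) =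
      (\<Sum>j\<in>UNIV. (\<Sum>i\<in>UNIV. \<xi> (p, i) * a k $ i $ j) *\<^sub>C (D k s $ j))" for k
    unfolding matC_def vec_lambda_beta scaleC.sum_right scaleC.sum_left scaleC_scaleC by (rule sum.swap)
  have "(\<Sum>k<n. \<Sum>i\<in>UNIV. \<xi> (k, i) *\<^sub>C (E k s $ i)) =
      (\<Sum>k<p. \<Sum>i\<in>UNIV. \<xi> (k, i) *\<^sub>C (D (Suc k) s $ i)) +
      (\<Sum>i\<in>UNIV. \<xi> (p, i) *\<^sub>C ((f s - (\<Sum>k<n. matC (a k) (D k s))) $ i))"
    by (simp add: p E_def)
  also have "(\<Sum>k<p. \<Sum>i\<in>UNIV. \<xi> (k, i) *\<^sub>C (D (Suc k) s $ i)) =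
      (\<Sum>k<n. \<Sum>i\<in>UNIV. (if k = 0 then 0 else \<xi> (k - 1, i)) *\<^sub>C (D k s $ i))"
    unfolding p by (subst sum.lessThan_Suc_shift) (simp add: scaleC.zero_left)
  also have "(\<Sum>i\<in>UNIV. \<xi> (p, i) *\<^sub>C ((f s - (\<Sum>k<n. matC (a k) (D k s))) $ i)) =
      (\<Sum>i\<in>UNIV. \<xi> (p, i) *\<^sub>C (f s $ i)) - (\<Sum>k<n. \<Sum>i\<in>UNIV. \<xi> (p, i) *\<^sub>C (matC (a k) (D k s) $ i))"
    by (simp add: sum.swap[of _ UNIV] sum_component scaleC.diff_right sum_subtractf scaleC.sum_right)
  finally show ?thesis
    unfolding combination_def companion_def mat
    by (simp add: p scaleC.diff_left sum_subtractf)
qed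

lemma recurrent_vec:
  fixes F :: "'r::finite \<Rightarrow> real \<Rightarrow> 'a::banach"
  assumes W: "jointly_recurrent W" and F: "\<And>i. F i \<in> W"
  shows "recurrent (\<lambda>t. \<chi> i. F i t)"
proof -
  have c: "continuous_on UNIV (F i)" for i using W F by (simp add: jointly_recurrent_iff)
  have ur: "uniformly_recurrent (range F)"
    using W F unfolding jointly_recurrent_iff by (metis finite finite_imageI image_subset_iff)
  show ?thesis
    unfolding recurrent_def recurrent_dist_def
  proof (intro conjI allI impI)
    show "continuous_on UNIV (\<lambda>t. \<chi> i. F i t)" by (intro continuous_on_vec_lambda c)
    fix K :: "real set" and \<epsilon> :: real assume K: "compact K \<and> \<epsilon> > 0"
    define \<delta> where "\<delta> = \<epsilon> / CARD('r)"
    have \<delta>: "\<delta> > 0" "CARD('r) * \<delta> = \<epsilon>" using K by (simp_all add: \<delta>_def)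
    have "return_times (range F) K \<delta> \<subseteq> {\<tau>. \<forall>t\<in>K. norm ((\<chi> i. F i (t + \<tau>)) - (\<chi> i. F i t)) \<le> \<epsilon>}"
    proof (intro subsetI CollectI ballI)
      fix \<tau> t assume \<tau>: "\<tau> \<in> return_times (range F) K \<delta>" and t: "t \<in> K"
      have "norm ((\<chi> i. F i (t + \<tau>)) - (\<chi> i. F i t)) \<le> (\<Sum>i\<in>UNIV. norm (F i (t + \<tau>) - F i t))"
        unfolding norm_vec_def using L2_set_le_sum[of UNIV "\<lambda>i. norm (F i (t + \<tau>) - F i t)"] by simp
      also have "\<dots> \<le> CARD('r) * \<delta>"
        using sum_bounded_above[of UNIV "\<lambda>i. norm (F i (t + \<tau>) - F i t)" \<delta>] return_timesD[OF \<tau> _ t] by auto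
      finally show "norm ((\<chi> i. F i (t + \<tau>)) - (\<chi> i. F i t)) \<le> \<epsilon>" using \<delta>(2) by simp
    qed
    moreover have "relatively_dense (return_times (range F) K \<delta>)"
      using ur K \<delta>(1) by (simp add: uniformly_recurrent_def)
    ultimately show "relatively_dense {\<tau>. \<forall>t\<in>K. norm ((\<chi> i. F i (t + \<tau>)) - (\<chi> i. F i t)) \<le> \<epsilon>}"
      by (rule relatively_dense_mono[rotated])
  qed
qed

lemma bounded_linear_axis: "bounded_linear (axis i :: 'b::real_normed_vector \<Rightarrow> 'b ^ 'r::finite)"
  by (rule bounded_linear_intro[where K=1])
    (auto simp: axis_def vec_eq_iff norm_vec_def L2_set_def if_distrib if_distribR sum.delta cong: if_cong)

lemma vec_eq_sum_axis: "(x :: 'b::real_normed_vector ^ 'r::finite) = (\<Sum>i\<in>UNIV. axis i (x $ i))"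
  by (simp add: vec_eq_iff axis_def sum_component if_distrib if_distribR sum.delta cong: if_cong)

lemma uniformly_continuous_on_sum:
  fixes f :: "'i \<Rightarrow> 'c::metric_space \<Rightarrow> 'b::real_normed_vector"
  shows "(\<And>i. i \<in> I \<Longrightarrow> uniformly_continuous_on S (f i)) \<Longrightarrow> uniformly_continuous_on S (\<lambda>t. \<Sum>i\<in>I. f i t)"
  by (induction I rule: infinite_finite_induct)
    (simp_all add: uniformly_continuous_on_const uniformly_continuous_on_add)

lemma relatively_compact_sum:
  fixes f :: "'i \<Rightarrow> 'c \<Rightarrow> 'b::real_normed_vector"
  assumes "finite I" "\<And>i. i \<in> I \<Longrightarrow> \<exists>C. compact C \<and> f i ` S \<subseteq> C"
  shows "\<exists>C. compact C \<and> (\<lambda>t. \<Sum>i\<in>I. f i t) ` S \<subseteq> C"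
  using assms
proof (induction I rule: finite_induct)
  case empty
  then show ?case by (intro exI[of _ "{0}"]) auto
next
  case (insert x I)
  obtain C where C: "compact C" "(\<lambda>t. \<Sum>i\<in>I. f i t) ` S \<subseteq> C" using insert by auto
  obtain D where D: "compact D" "f x ` S \<subseteq> D" using insert.prems[of x] by auto
  have "compact {u + v |u v. u \<in> D \<and> v \<in> C}" by (rule compact_sums[OF D(1) C(1)])
  moreover have "(\<lambda>t. \<Sum>i\<in>insert x I. f i t) ` S \<subseteq> {u + v |u v. u \<in> D \<and> v \<in> C}"
  proof (rule image_subsetI)
    fix t assume "t \<in> S"
    then have "f x t \<in> D" "(\<Sum>i\<in>I. f i t) \<in> C" using C(2) D(2) by auto
    then show "(\<Sum>i\<in>insert x I. f i t) \<in> {u + v |u v. u \<in> D \<and> v \<in> C}"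
      using insert.hyps by auto
  qed
  ultimately show ?case by blast
qed

text \<open>The components are restrictions of jointly recurrent functions on the line, so the function that they
form on the line is recurrent.\<close>

lemma pow_cls_subset_REC_urc:
  fixes V R :: "(real \<Rightarrow> 'a::complex_banach) set"
  assumes R: "is_rec_urc V R"
  shows "(pow_cls J ((\<lambda>g. restrict g J) ` R) :: (real \<Rightarrow> 'a^'r::finite) set) \<subseteq> REC_urc J"
proof
  fix f :: "real \<Rightarrow> 'a^'r" assume "f \<in> pow_cls J ((\<lambda>g. restrict g J) ` R)"
  then have fe: "f \<in> extensional J" and fi: "\<And>i. (\<lambda>t\<in>J. f t $ i) \<in> (\<lambda>g. restrict g J) ` R"
    by (auto simp: pow_cls_def)
  from fi have "\<exists>F\<in>R. (\<lambda>t\<in>J. f t $ i) = restrict F J" for i by blast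
  then obtain F where F: "\<And>i. F i \<in> R" "\<And>i. (\<lambda>t\<in>J. f t $ i) = restrict (F i) J" by metis
  have eq: "f t $ i = F i t" if "t \<in> J" for t i
    using fun_cong[OF F(2)[of i], of t] that by simp
  have f_eq: "f = restrict (\<lambda>t. \<chi> i. F i t) J"
  proof (rule extensionalityI[OF fe])
    show "f t = restrict (\<lambda>t. \<chi> i. F i t) J t" if "t \<in> J" for t using eq that by (simp add: vec_eq_iff)
  qed simp
  have "jointly_recurrent R" using R by (simp add: is_rec_urc_def Let_def)
  then have "recurrent (\<lambda>t. \<chi> i. F i t)" using F(1) by (rule recurrent_vec)
  then have "f \<in> REC J" unfolding REC_def f_eq by blast
  moreover have "f \<in> C_urc J"
    unfolding C_urc_iff
  proof (intro conjI fe)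
    have sum: "(\<Sum>i\<in>UNIV. axis i (F i t)) = f t" if "t \<in> J" for t
      using vec_eq_sum_axis[of "f t"] eq[OF that] by simp
    have "uniformly_continuous_on J (\<lambda>t. \<Sum>i\<in>UNIV. axis i (F i t))"
    proof (rule uniformly_continuous_on_sum)
      fix i
      have "uniformly_continuous_on UNIV (\<lambda>t. axis i (F i t))"
        by (rule bounded_linear.uniformly_continuous_on[OF bounded_linear_axis hull_uniformly_continuous[OF R F(1)]])
      then show "uniformly_continuous_on J (\<lambda>t. axis i (F i t))"
        unfolding uniformly_continuous_on_def by (meson UNIV_I)
    qed
    then show "uniformly_continuous_on J f"
      unfolding uniformly_continuous_on_def by (simp add: sum)
    have "\<exists>C. compact C \<and> (\<lambda>t. \<Sum>i\<in>UNIV. axis i (F i t)) ` J \<subseteq> C"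
    proof (rule relatively_compact_sum)
      fix i
      obtain C where C: "compact C" "range (F i) \<subseteq> C" using hull_relatively_compact[OF R F(1)] by blast
      have "compact (axis i ` C)"
        by (intro compact_continuous_image linear_continuous_on bounded_linear_axis C)
      then show "\<exists>C. compact C \<and> (\<lambda>t. axis i (F i t)) ` J \<subseteq> C"
        using C(2) by (intro exI[of _ "axis i ` C"]) auto
    qed simp
    then show "\<exists>C. compact C \<and> f ` J \<subseteq> C" by (simp add: sum image_def cong: bex_cong)
  qed
  ultimately show "f \<in> REC_urc J" by (simp add: REC_urc_def)
qed

section \<open>The solution belongs to the class\<close>

lemma solution_derivs_continuous:
  fixes D :: "nat \<Rightarrow> real \<Rightarrow> 'a::complex_banach^'r::finite"
  assumes sol: "solution_derivs \<alpha> n a f y D" and k: "k < n"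
  shows "continuous_on {\<alpha>..} (D k)"
proof (cases "k = n - 1")
  case True
  then show ?thesis using sol by (simp add: solution_derivs_def W1_loc_derivs_def)
next
  case False
  then have "(D k has_vector_derivative D (Suc k) t) (at t within {\<alpha>..})" if "t \<ge> \<alpha>" for t
    using sol k that by (simp add: solution_derivs_def W1_loc_derivs_def)
  then show ?thesis by (meson atLeast_iff continuous_on_vector_derivative)
qed

text \<open>Each component of each \<open>D k\<close> is integrated separately: for \<open>k < n - 1\<close> this is the fundamental theorem of
calculus, for \<open>k = n - 1\<close> it is the definition of a solution, where \<open>D n\<close> may be replaced by the right-hand
side because both agree almost everywhere.\<close>

lemma combination_equation:
  fixes D :: "nat \<Rightarrow> real \<Rightarrow> 'a::complex_banach^'r::finite"
  assumes n: "n \<ge> 1" and sol: "solution_derivs \<alpha> n a f y D" and f: "locally_L1 \<alpha> f" and t: "t \<ge> \<alpha>"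
  shows "combination n D \<xi> t = combination n D \<xi> \<alpha> +
    integral {\<alpha>..t} (\<lambda>s. \<Sum>i\<in>UNIV. \<xi> (n - 1, i) *\<^sub>C (f s $ i)) +
    integral {\<alpha>..t} (combination n D (companion n a \<xi>))"
proof -
  define E where "E k s = (if k < n - 1 then D (Suc k) s else f s - (\<Sum>k<n. matC (a k) (D k s)))" for k s
  have W: "W1_loc_derivs \<alpha> n y D" and ae: "AE t in lebesgue_on {\<alpha>..}. D n t + (\<Sum>k<n. matC (a k) (D k t)) = f t"
    using sol by (auto simp: solution_derivs_def)
  have cD: "continuous_on {\<alpha>..} (D k)" if "k < n" for k by (rule solution_derivs_continuous[OF sol that])
  have cM: "continuous_on {\<alpha>..} (\<lambda>s. \<Sum>k<n. matC (a k) (D k s))"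
    unfolding matC_def
    by (intro continuous_on_sum continuous_on_vec_lambda scaleC.continuous_on continuous_on_const
        bounded_linear.continuous_on[OF bounded_linear_vec_nth] cD) simp
  have E: "locally_L1 \<alpha> (E k) \<and> integral {\<alpha>..t} (E k) = D k t - D k \<alpha>" if k: "k < n" for k
  proof (cases "k < n - 1")
    case True
    then have Ek: "E k = D (Suc k)" by (simp add: E_def[abs_def])
    have "(D (Suc k) has_integral (D k t - D k \<alpha>)) {\<alpha>..t}"
    proof (rule fundamental_theorem_of_calculus[OF t])
      fix s assume "s \<in> {\<alpha>..t}"
      then have "(D k has_vector_derivative D (Suc k) s) (at s within {\<alpha>..})"
        using W True by (simp add: W1_loc_derivs_def)
      then show "(D k has_vector_derivative D (Suc k) s) (at s within {\<alpha>..t})"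
        by (rule has_vector_derivative_within_subset) auto
    qed
    moreover have "locally_L1 \<alpha> (D (Suc k))" using True by (intro locally_L1_continuous cD) simp
    ultimately show ?thesis by (simp add: Ek integral_unique)
  next
    case False
    then have k': "k = n - 1" using k by simp
    have Ek: "E k = (\<lambda>s. f s + - (\<Sum>k<n. matC (a k) (D k s)))" using False by (simp add: E_def[abs_def])
    have "locally_L1 \<alpha> (E k)"
      unfolding Ek by (intro locally_L1_add f locally_L1_continuous continuous_on_minus cM)
    moreover have "integral {\<alpha>..t} (E k) = D k t - D k \<alpha>"
    proof -
      obtain N where N: "N \<in> null_sets (lebesgue_on {\<alpha>..})"
        "{s \<in> {\<alpha>..}. D n s + (\<Sum>k<n. matC (a k) (D k s)) \<noteq> f s} \<subseteq> N"
        using ae by (auto elim!: AE_E3 simp: eventually_ae_filter)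
      have "negligible N"
        using N(1) by (simp add: negligible_iff_null_sets null_sets_restrict_space)
      moreover have "E k s = D n s" if "s \<in> {\<alpha>..t} - N" for s
      proof -
        have "f s = D n s + (\<Sum>k<n. matC (a k) (D k s))" using N(2) that by auto
        then show ?thesis by (simp add: Ek)
      qed
      ultimately have "integral {\<alpha>..t} (D n) = integral {\<alpha>..t} (E k)" by (rule integral_spike) auto
      moreover have "D (n - 1) t = D (n - 1) \<alpha> + Bochner_integral {\<alpha>..t} (D n)" "D n \<in> L1_loc {\<alpha>..}"
        using W t unfolding W1_loc_derivs_def by blast+
      moreover from this(2) have "Bochner_integral {\<alpha>..t} (D n) = integral {\<alpha>..t} (D n)"
        by (intro Bochner_integral_eq_integral) (auto simp: L1_loc_iff locally_L1_def)
      ultimately show ?thesis unfolding k' by simp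
    qed
    ultimately show ?thesis by simp
  qed
  have Ei: "(\<lambda>s. \<xi> (k, i) *\<^sub>C (E k s $ i)) integrable_on {\<alpha>..t}"
    and Ev: "integral {\<alpha>..t} (\<lambda>s. \<xi> (k, i) *\<^sub>C (E k s $ i)) = \<xi> (k, i) *\<^sub>C ((D k t - D k \<alpha>) $ i)" if k: "k < n" for k i
  proof -
    have i: "E k integrable_on {\<alpha>..t}" using E[OF k] by (intro locally_L1_integrable) auto
    have bl: "bounded_linear (\<lambda>x. \<xi> (k, i) *\<^sub>C ((x :: 'a^'r) $ i))"
      by (rule bounded_linear_compose[OF scaleC.bounded_linear_right bounded_linear_vec_nth])
    show "(\<lambda>s. \<xi> (k, i) *\<^sub>C (E k s $ i)) integrable_on {\<alpha>..t}"
      using integrable_linear[OF i bl] by (simp add: o_def)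
    show "integral {\<alpha>..t} (\<lambda>s. \<xi> (k, i) *\<^sub>C (E k s $ i)) = \<xi> (k, i) *\<^sub>C ((D k t - D k \<alpha>) $ i)"
      using integral_linear[OF i bl] E[OF k] by (simp add: o_def)
  qed
  have "combination n D \<xi> t - combination n D \<xi> \<alpha> = (\<Sum>k<n. \<Sum>i\<in>UNIV. \<xi> (k, i) *\<^sub>C ((D k t - D k \<alpha>) $ i))"
    by (simp add: combination_def scaleC.diff_right sum_subtractf)
  also have "\<dots> = (\<Sum>k<n. \<Sum>i\<in>UNIV. integral {\<alpha>..t} (\<lambda>s. \<xi> (k, i) *\<^sub>C (E k s $ i)))"
    by (simp add: Ev)
  also have "\<dots> = (\<Sum>k<n. integral {\<alpha>..t} (\<lambda>s. \<Sum>i\<in>UNIV. \<xi> (k, i) *\<^sub>C (E k s $ i)))"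
    by (intro sum.cong refl Henstock_Kurzweil_Integration.integral_sum[symmetric]) (auto intro: Ei)
  also have "\<dots> = integral {\<alpha>..t} (\<lambda>s. \<Sum>k<n. \<Sum>i\<in>UNIV. \<xi> (k, i) *\<^sub>C (E k s $ i))"
    by (intro Henstock_Kurzweil_Integration.integral_sum[symmetric] integrable_sum) (auto intro: Ei)
  also have "\<dots> = integral {\<alpha>..t} (\<lambda>s. (\<Sum>i\<in>UNIV. \<xi> (n - 1, i) *\<^sub>C (f s $ i)) + combination n D (companion n a \<xi>) s)"
    by (rule integral_cong, unfold E_def, rule combination_companion[OF n])
  also have "\<dots> = integral {\<alpha>..t} (\<lambda>s. \<Sum>i\<in>UNIV. \<xi> (n - 1, i) *\<^sub>C (f s $ i)) +
      integral {\<alpha>..t} (combination n D (companion n a \<xi>))"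
  proof (rule Henstock_Kurzweil_Integration.integral_add)
    show "(\<lambda>s. \<Sum>i\<in>UNIV. \<xi> (n - 1, i) *\<^sub>C (f s $ i)) integrable_on {\<alpha>..t}"
      by (intro locally_L1_integrable[of \<alpha>] locally_L1_sum locally_L1_scaleC locally_L1_component f continuous_on_const order_refl)
    have "continuous_on {\<alpha>..} (combination n D (companion n a \<xi>))"
      unfolding combination_def[abs_def]
      by (intro continuous_on_sum scaleC.continuous_on continuous_on_const
          bounded_linear.continuous_on[OF bounded_linear_vec_nth] cD) simp
    then show "combination n D (companion n a \<xi>) integrable_on {\<alpha>..t}"
      by (intro locally_L1_integrable[of \<alpha>] locally_L1_continuous order_refl)
  qed
  finally show ?thesis by (simp add: algebra_simps)
qed

lemma solution_derivs_mean_poly_bounded: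
  fixes D :: "nat \<Rightarrow> real \<Rightarrow> 'a::complex_banach^'r::finite"
  assumes sol: "solution_derivs \<alpha> n a f y D" and n: "n \<ge> 1"
    and y: "y \<in> M_iter s {\<alpha>..} (O_cls q {\<alpha>..})" and k: "k < n"
  shows "mean_poly_bounded \<alpha> (D k)"
  using k
proof (induction k)
  case 0
  have "D 0 = y" using sol by (simp add: solution_derivs_def W1_loc_derivs_def)
  then show ?case
    using y solution_derivs_continuous[OF sol 0] by (auto intro: mean_poly_bounded_M_iter)
next
  case (Suc k)
  show ?case
  proof (rule mean_poly_bounded_derivative)
    show "mean_poly_bounded \<alpha> (D k)" using Suc by simp
    show "continuous_on {\<alpha>..} (D (Suc k))" by (rule solution_derivs_continuous[OF sol Suc.prems])
    show "(D k has_vector_derivative D (Suc k) t) (at t within {\<alpha>..})" if "t \<ge> \<alpha>" for t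
      using sol Suc.prems that by (simp add: solution_derivs_def W1_loc_derivs_def)
  qed
qed

theorem proposition5p9:
  fixes \<alpha> :: real and n s q :: nat
    and J :: "real set"
    and a :: "nat \<Rightarrow> complex^'r::finite^'r"
    and V R U A :: "(real \<Rightarrow> 'a::complex_banach) set"
    and f y :: "real \<Rightarrow> 'a^'r"
    and D :: "nat \<Rightarrow> real \<Rightarrow> 'a^'r"
  assumes J: "J = {\<alpha>..}"
    and n: "n \<ge> 1"
    and V: "V \<noteq> {}" "V \<subseteq> REC_urc UNIV" "jointly_recurrent V"
    and R: "is_rec_urc V R"
    and A: "A = (\<lambda>g. restrict g J) ` R"
    and U_linear: "linear_space_on J U"
    and U_const: "\<And>x. (\<lambda>t\<in>J. x) \<in> U"
    and U_L1: "U \<subseteq> L1_loc J"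
    and U_gamma: "\<And>g \<omega>. g \<in> U \<Longrightarrow> (\<lambda>t\<in>J. \<gamma> \<omega> t *\<^sub>C g t) \<in> U"
    and P': "P'_prop \<alpha> U A"
    and sigma: "\<sigma>_L n a \<subseteq> {z. Re z \<ge> 0}"
    and sol: "solution_derivs \<alpha> n a f y D"
    and f: "f \<in> M_cls J (pow_cls J A)"
    and y_O: "y \<in> M_iter s J (O_cls q J)"
    and y_U: "\<And>k. k \<le> n - 1 \<Longrightarrow> D k \<in> pow_cls J U"
  shows "y \<in> pow_cls J A \<and> (pow_cls J A :: (real \<Rightarrow> 'a^'r) set) \<subseteq> REC_urc J"
proof
  show "(pow_cls J A :: (real \<Rightarrow> 'a^'r) set) \<subseteq> REC_urc J"
    unfolding A by (rule pow_cls_subset_REC_urc[OF R])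
  define Ap where "Ap g \<longleftrightarrow> (\<exists>F\<in>R. \<forall>t\<ge>\<alpha>. g t = F t)" for g
  define Up where "Up g \<longleftrightarrow> restrict g J \<in> U" for g
  have Ap_iff: "Ap g \<longleftrightarrow> restrict g J \<in> A" for g
  proof
    assume "Ap g"
    then obtain F where F: "F \<in> R" "\<forall>t\<ge>\<alpha>. g t = F t" by (auto simp: Ap_def)
    then have "restrict g J = restrict F J" by (intro restrict_ext) (simp add: J)
    then show "restrict g J \<in> A" using F(1) A by simp
  next
    assume "restrict g J \<in> A"
    then obtain F where F: "F \<in> R" "restrict g J = restrict F J" using A by auto
    have "g t = F t" if "t \<ge> \<alpha>" for t
      using fun_cong[OF F(2), of t] that by (simp add: J)
    then show "Ap g" using F(1) by (auto simp: Ap_def)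
  qed
  interpret half_line_class \<alpha> Ap
    unfolding Ap_def[abs_def] by (rule half_line_class_hull[OF R])
  have U_cong: "Up h" if "Up g" "\<And>t. t \<ge> \<alpha> \<Longrightarrow> g t = h t" for g h
  proof -
    have "restrict g J = restrict h J" using that(2) by (intro restrict_ext) (simp add: J)
    then show ?thesis using that(1) by (simp add: Up_def)
  qed
  interpret primitive_closed_class \<alpha> Ap Up
  proof
    fix g h :: "real \<Rightarrow> 'a" and c :: complex and \<omega> :: real and x :: 'a
    show "Up g \<Longrightarrow> (\<And>t. t \<ge> \<alpha> \<Longrightarrow> g t = h t) \<Longrightarrow> Up h" by (rule U_cong)
    show "Up (\<lambda>_. x)" unfolding Up_def by (rule U_const)
    have eqs: "(\<lambda>t\<in>J. restrict g J t + restrict h J t) = (\<lambda>t\<in>J. g t + h t)"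
      "(\<lambda>t\<in>J. c *\<^sub>C restrict g J t) = (\<lambda>t\<in>J. c *\<^sub>C g t)"
      "(\<lambda>t\<in>J. \<gamma> \<omega> t *\<^sub>C restrict g J t) = (\<lambda>t\<in>J. \<gamma> \<omega> t *\<^sub>C g t)"
      by (auto simp: restrict_def fun_eq_iff)
    show "Up (\<lambda>t. g t + h t)" if "Up g" "Up h"
      using U_linear that unfolding linear_space_on_def Up_def eqs(1)[symmetric] by blast
    show "Up (\<lambda>t. c *\<^sub>C g t)" if "Up g"
      using U_linear that unfolding linear_space_on_def Up_def eqs(2)[symmetric] by blast
    show "Up (\<lambda>t. \<gamma> \<omega> t *\<^sub>C g t)" if "Up g"
      using U_gamma that unfolding Up_def eqs(3)[symmetric] by blast
    show "Ap (\<lambda>t. integral {\<alpha>..t} g)" if g: "mean_member g" and Ug: "Up (\<lambda>t. integral {\<alpha>..t} g)"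
    proof -
      have L: "locally_L1 \<alpha> g" using g by (simp add: mean_member_def)
      have "restrict g J \<in> M_cls J A"
        unfolding M_cls_def
      proof (intro CollectI conjI allI impI)
        show "restrict g J \<in> L1_loc J" using L by (simp add: J L1_loc_iff)
        fix h :: real assume h: "h > 0"
        have "Ap (\<lambda>t. (1 / h) *\<^sub>R (integral {\<alpha>..t + h} g - integral {\<alpha>..t} g))"
          using h by (intro scaleR mean_member_increment g) simp
        moreover have "mean J h (restrict g J) = (\<lambda>t\<in>J. (1 / h) *\<^sub>R (integral {\<alpha>..t + h} g - integral {\<alpha>..t} g))"
        proof -
          have "mean J h (restrict g J) = (\<lambda>t\<in>J. (1 / h) *\<^sub>R integral {t..t + h} (restrict g J))"
            unfolding J by (rule mean_eq) (use L h in simp_all)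
          also have "\<dots> = (\<lambda>t\<in>J. (1 / h) *\<^sub>R (integral {\<alpha>..t + h} g - integral {\<alpha>..t} g))"
          proof (rule restrict_ext)
            fix t assume "t \<in> J"
            then have t: "t \<ge> \<alpha>" by (simp add: J)
            have "integral {t..t + h} (restrict g J) = integral {t..t + h} g"
              by (rule integral_cong) (use t in \<open>simp add: J\<close>)
            then show "(1 / h) *\<^sub>R integral {t..t + h} (restrict g J) = (1 / h) *\<^sub>R (integral {\<alpha>..t + h} g - integral {\<alpha>..t} g)"
              using locally_L1_integral_diff[OF L t, of "t + h"] h by simp
          qed
          finally show ?thesis .
        qed
        ultimately show "mean J h (restrict g J) \<in> A" by (simp add: Ap_iff)
      qed
      moreover have prim: "primitive \<alpha> (restrict g J) = (\<lambda>t\<in>J. integral {\<alpha>..t} g)"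
      proof -
        have "primitive \<alpha> (restrict g J) = (\<lambda>t\<in>J. integral {\<alpha>..t} (restrict g J))"
          unfolding J by (rule primitive_eq) (use L in simp)
        also have "\<dots> = (\<lambda>t\<in>J. integral {\<alpha>..t} g)"
          by (intro restrict_ext integral_cong) (simp add: J)
        finally show ?thesis .
      qed
      moreover have "(\<lambda>t\<in>J. integral {\<alpha>..t} g) \<in> U" using Ug by (simp add: Up_def)
      ultimately have "(\<lambda>t\<in>J. integral {\<alpha>..t} g) \<in> A" using P' unfolding P'_prop_def J by metis
      then show ?thesis by (simp add: Ap_iff)
    qed
  qed
  have fL: "locally_L1 \<alpha> f" using f by (simp add: M_cls_def J L1_loc_iff)
  have f_mean: "mean_member (\<lambda>t. f t $ i)" for i
    unfolding mean_member_def
  proof (intro conjI allI impI)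
    show "locally_L1 \<alpha> (\<lambda>t. f t $ i)" by (rule locally_L1_component[OF fL])
    fix h :: real assume h: "h > 0"
    then have "mean J h f \<in> pow_cls J A" using f by (simp add: M_cls_def)
    then have "Ap (\<lambda>t. mean J h f t $ i)" by (simp add: pow_cls_def Ap_iff)
    then have "Ap (\<lambda>t. h *\<^sub>R (mean J h f t $ i))" by (rule scaleR)
    then show "Ap (\<lambda>t. integral {\<alpha>..t + h} (\<lambda>t. f t $ i) - integral {\<alpha>..t} (\<lambda>t. f t $ i))"
    proof (rule cong)
      fix t assume t: "t \<ge> \<alpha>"
      have "mean J h f t = (1 / h) *\<^sub>R (integral {\<alpha>..t + h} f - integral {\<alpha>..t} f)"
        using mean_eq[OF fL h] locally_L1_integral_diff[OF fL t, of "t + h"] h t by (simp add: J)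
      then show "h *\<^sub>R (mean J h f t $ i) = integral {\<alpha>..t + h} (\<lambda>t. f t $ i) - integral {\<alpha>..t} (\<lambda>t. f t $ i)"
        using h by (simp add: integral_vec_nth locally_L1_integrable[OF fL])
    qed
  qed
  have cz: "mean_poly_bounded \<alpha> (combination n D \<xi>)" for \<xi>
    unfolding combination_def[abs_def]
    by (intro mean_poly_bounded_sum mean_poly_bounded_bounded_linear[OF _ scaleC.bounded_linear_right]
        mean_poly_bounded_bounded_linear[OF _ bounded_linear_vec_nth]
        solution_derivs_mean_poly_bounded[OF sol n y_O[unfolded J]]) simp
  have Uz: "Up (combination n D \<xi>)" for \<xi>
  proof -
    have "Up (\<lambda>t. D k t $ i)" if "k < n" for k i
      using y_U[of k] that by (auto simp: pow_cls_def Up_def)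
    then show ?thesis
      unfolding combination_def[abs_def] by (intro U_sum U_scaleC) auto
  qed
  have all: "Ap (combination n D \<xi>)" if "\<And>i. i \<notin> {..<n} \<times> UNIV \<Longrightarrow> \<xi> i = 0" for \<xi>
  proof (rule operator_eigenvalue_induct[where B = "companion n a" and S = "\<lambda>l. Re l \<ge> 0" and I = "{..<n} \<times> UNIV"
        and P = "\<lambda>\<xi>. Ap (combination n D \<xi>)"])
    show "companion n a (\<lambda>i. c * \<xi> i + d * \<eta> i) = (\<lambda>i. c * companion n a \<xi> i + d * companion n a \<eta> i)" for c d \<xi> \<eta>
      by (rule companion_linear)
    show "companion n a \<xi> i = 0" if "i \<notin> {..<n} \<times> UNIV" for \<xi> i
      using that by (auto simp: companion_def split: prod.splits)
    show "Ap (combination n D (\<lambda>_. 0))"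
      using const[of 0] by (simp add: combination_def[abs_def] scaleC.zero_left)
    show "\<xi> = (\<lambda>_. 0)"
      if "\<not> Re l \<ge> 0" "\<And>i. i \<notin> {..<n} \<times> UNIV \<Longrightarrow> \<xi> i = 0" "\<And>i. companion n a \<xi> i = l * \<xi> i" for \<xi> l
      using that sigma by (intro companion_eigenvector_imp_\<sigma>_L[OF n, of l a \<xi>]) auto
    show "Ap (combination n D \<xi>)"
      if l: "Re l \<ge> 0" and rest: "Ap (combination n D (\<lambda>i. companion n a \<xi> i - l * \<xi> i))" for \<xi> l
    proof -
      let ?z = "combination n D \<xi>" and ?w = "combination n D (\<lambda>i. companion n a \<xi> i - l * \<xi> i)"
      let ?f = "\<lambda>s. \<Sum>i\<in>UNIV. \<xi> (n - 1, i) *\<^sub>C (f s $ i)"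
      \<comment> \<open>the part of \<open>z\<^bsub>B \<xi>\<^esub>\<close> that is already known to be a member joins the inhomogeneity\<close>
      let ?g = "\<lambda>s. ?f s + ?w s"
      have f_sum: "mean_member (\<lambda>s. \<Sum>i\<in>I. \<xi> (n - 1, i) *\<^sub>C (f s $ i))" for I
        by (induction I rule: infinite_finite_induct)
          (simp_all add: member_imp_mean_member[OF const] mean_member_add mean_member_scaleC[OF f_mean])
      have w: "mean_member ?w" by (rule member_imp_mean_member[OF rest])
      have g: "mean_member ?g" by (rule mean_member_add[OF f_sum w])
      have zc: "continuous_on {\<alpha>..} ?z" by (rule mean_poly_bounded_continuous[OF cz])
      have eq: "?z t = ?z \<alpha> + integral {\<alpha>..t} ?g + integral {\<alpha>..t} (\<lambda>s. l *\<^sub>C ?z s)" if t: "t \<ge> \<alpha>" for t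
      proof -
        have i: "?f integrable_on {\<alpha>..t}" "?w integrable_on {\<alpha>..t}"
          using f_sum[of UNIV] w by (auto simp: mean_member_def intro!: locally_L1_integrable)
        have iz: "(\<lambda>s. l *\<^sub>C ?z s) integrable_on {\<alpha>..t}"
          by (intro integrable_continuous_half_line[of \<alpha>] scaleC.continuous_on continuous_on_const zc order_refl)
        have "combination n D (companion n a \<xi>) s = ?w s + l *\<^sub>C ?z s" for s
          using combination_linear[of n D 1 "companion n a \<xi>" "- l" \<xi> s] by (simp add: scaleC.minus_left)
        then have "integral {\<alpha>..t} (combination n D (companion n a \<xi>)) = integral {\<alpha>..t} ?w + integral {\<alpha>..t} (\<lambda>s. l *\<^sub>C ?z s)"
          using Henstock_Kurzweil_Integration.integral_add[OF i(2) iz] by (metis (no_types, lifting) integral_cong)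
        moreover have "integral {\<alpha>..t} ?g = integral {\<alpha>..t} ?f + integral {\<alpha>..t} ?w"
          by (rule Henstock_Kurzweil_Integration.integral_add[OF i])
        ultimately show ?thesis
          using combination_equation[OF n sol fL t, of \<xi>] by simp
      qed
      show ?thesis
        by (rule linear_equation_member[OF g zc eq l Uz linear_equation_poly_bounded[OF g cz eq]])
    qed
  qed (use that in auto)
  show "y \<in> pow_cls J A"
    unfolding pow_cls_def
  proof (intro CollectI conjI allI)
    have y: "D 0 = y" "y \<in> extensional {\<alpha>..}"
      using sol by (auto simp: solution_derivs_def W1_loc_derivs_def)
    then show "y \<in> extensional J" by (simp add: J)
    fix i
    define \<xi> :: "nat \<times> 'r \<Rightarrow> complex" where "\<xi> = (\<lambda>p. if p = (0, i) then 1 else 0)"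
    have "Ap (combination n D \<xi>)" by (rule all) (use n in \<open>auto simp: \<xi>_def\<close>)
    moreover have "combination n D \<xi> t = y t $ i" for t
    proof -
      have "combination n D \<xi> t = (\<Sum>k<n. if k = 0 then y t $ i else 0)"
        unfolding combination_def
      proof (rule sum.cong[OF refl])
        fix k
        have "(\<Sum>i'\<in>UNIV. \<xi> (k, i') *\<^sub>C D k t $ i') = (\<Sum>i'\<in>UNIV. if i' = i then \<xi> (k, i) *\<^sub>C D k t $ i else 0)"
          by (intro sum.cong) (auto simp: \<xi>_def scaleC.zero_left)
        then show "(\<Sum>i'\<in>UNIV. \<xi> (k, i') *\<^sub>C D k t $ i') = (if k = 0 then y t $ i else 0)"
          using y(1) by (simp add: \<xi>_def scaleC.zero_left)
      qed
      also have "\<dots> = y t $ i" using n by simp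
      finally show ?thesis .
    qed
    ultimately show "(\<lambda>t\<in>J. y t $ i) \<in> A" by (simp add: Ap_iff cong: restrict_cong)
  qed
qed

end
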